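(* Let $k$ be any field with $\operatorname{char} k=0$, let $k[\mathbf{x}]=k[x_1,\ldots,x_n]$ be the polynomial ring in $n$ variables over $k$ with field of fractions $k(\mathbf{x})$, and let $k[\mathbf{x},z]=k[x_1,\ldots,x_n,z]$ be the polynomial ring in $n+1$ variables with field of fractions $k(\mathbf{x},z)$. Let $M$ be an intermediate field $k\subset M\subset k(\mathbf{x})$. If $\operatorname{tr.deg}_k M\ge 2$, $M\neq k(\mathbf{x})$ and $M$ is minimal, then there exists $\sigma\in \operatorname{Aut}_k k(\mathbf{x},z)$ such that the $k$-algebra $\mathcal{A}:=\sigma(M(z))\cap k[\mathbf{x},z]$ is not finitely generated and $Q(\mathcal{A})=\sigma(M(z))$.
   Context: For an integral domain $R$, $Q(R)$ denotes its field of fractions. An intermediate field $k\subset M\subset k(\mathbf{x})$ is called minimal if the transcendence degree over $k$ of $M\cap k[\mathbf{x}]$ equals that of $M$; equivalently, $Q(M\cap k[\mathbf{x}])=M$. $M(z)$ denotes the subfield of $k(\mathbf{x},z)$ generated by $M$ and $z$. *)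

theory Defs
  imports
    "HOL-Library.Poly_Mapping"
    "HOL-Library.Extended_Nat"
    "HOL-Computational_Algebra.Fraction_Field"
begin

section \<open>Polynomials and rational functions\<close>

text \<open>
  A polynomial is a finitely supported map from monomials to coefficients, and a monomial is a
  finitely supported map from variables to exponents.  The variables are indexed by all natural
  numbers, so that $k[x_1,\ldots,x_n]$ and $k[x_1,\ldots,x_n,z]$ (and their fields of fractions)
  live inside one field: $x_1,\ldots,x_n$ are the variables with index $0,\ldots,n-1$, and $z$ is
  the variable with index $n$.  The field $k$ is the coefficient type.
\<close>

type_synonym ('v, 'a) mpoly = "('v \<Rightarrow>\<^sub>0 nat) \<Rightarrow>\<^sub>0 'a"

type_synonym 'a ratfun = "(nat, 'a) mpoly fract"

definition poly_vars :: "('v, 'a::zero) mpoly \<Rightarrow> 'v set" where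
  "poly_vars p = (\<Union>m\<in>Poly_Mapping.keys p. Poly_Mapping.keys m)"

definition of_mpoly :: "(nat, 'a::field) mpoly \<Rightarrow> 'a ratfun" where
  "of_mpoly p = Fract p 1"

definition const_field :: "'a::field ratfun set" where
  "const_field = range (\<lambda>c. of_mpoly (Poly_Mapping.single 0 c))"

definition ratvar :: "nat \<Rightarrow> 'a::field ratfun" where
  "ratvar i = of_mpoly (Poly_Mapping.single (Poly_Mapping.single i 1) 1)"

definition poly_ring :: "nat \<Rightarrow> 'a::field ratfun set" where
  "poly_ring n = of_mpoly ` {p. poly_vars p \<subseteq> {..<n}}"

section \<open>Subrings and subfields of a field\<close>

definition is_subring :: "'b::field set \<Rightarrow> bool" where
  "is_subring A \<longleftrightarrow> 0 \<in> A \<and> 1 \<in> A \<and>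
     (\<forall>a\<in>A. \<forall>b\<in>A. a + b \<in> A) \<and> (\<forall>a\<in>A. - a \<in> A) \<and> (\<forall>a\<in>A. \<forall>b\<in>A. a * b \<in> A)"

definition is_subfield :: "'b::field set \<Rightarrow> bool" where
  "is_subfield L \<longleftrightarrow> is_subring L \<and> (\<forall>a\<in>L. inverse a \<in> L)"

text \<open>$Q(A)$ for a subring \<open>A\<close> of a field, realised inside that field.\<close>

definition frac_field :: "'b::field set \<Rightarrow> 'b set" where
  "frac_field A = {a / b | a b. a \<in> A \<and> b \<in> A \<and> b \<noteq> 0}"

definition rat_field :: "nat \<Rightarrow> 'a::field ratfun set" where
  "rat_field n = frac_field (poly_ring n)"

definition adjoin :: "'b::field set \<Rightarrow> 'b \<Rightarrow> 'b set" where
  "adjoin L a = is_subfield hull (insert a L)"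

definition fin_gen_algebra :: "'b::field set \<Rightarrow> 'b set \<Rightarrow> bool" where
  "fin_gen_algebra K A \<longleftrightarrow> (\<exists>S. finite S \<and> A = is_subring hull (K \<union> S))"

text \<open>\<open>Aut\<^sub>K L\<close>; only the restriction of a member to \<open>L\<close> is meaningful.\<close>

definition field_auts :: "'b::field set \<Rightarrow> 'b set \<Rightarrow> ('b \<Rightarrow> 'b) set" where
  "field_auts K L = {\<sigma>. bij_betw \<sigma> L L \<and> (\<forall>c\<in>K. \<sigma> c = c) \<and>
     (\<forall>a\<in>L. \<forall>b\<in>L. \<sigma> (a + b) = \<sigma> a + \<sigma> b \<and> \<sigma> (a * b) = \<sigma> a * \<sigma> b)}"

section \<open>Transcendence degree\<close>

text \<open>
  To speak about polynomial relations between the elements of a set \<open>B\<close>, these elements themselves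
  serve as the names of the variables, and evaluation substitutes each element for its own name.
\<close>

definition eval_self :: "('b, 'b::field) mpoly \<Rightarrow> 'b" where
  "eval_self p = (\<Sum>m\<in>Poly_Mapping.keys p.
     Poly_Mapping.lookup p m * (\<Prod>b\<in>Poly_Mapping.keys m. b ^ Poly_Mapping.lookup m b))"

definition alg_independent :: "'b::field set \<Rightarrow> 'b set \<Rightarrow> bool" where
  "alg_independent K B \<longleftrightarrow>
     (\<forall>p. range (Poly_Mapping.lookup p) \<subseteq> K \<and> poly_vars p \<subseteq> B \<and> eval_self p = 0 \<longrightarrow> p = 0)"

text \<open>
  Finite subsets suffice for the supremum, since an infinite algebraically independent set has
  finite ones of every cardinality; all infinite transcendence degrees are identified with \<open>\<infinity>\<close>.
  The set \<open>A\<close> is meant to be a subring containing \<open>K\<close>.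
\<close>

definition trdeg :: "'b::field set \<Rightarrow> 'b set \<Rightarrow> enat" where
  "trdeg K A = (SUP B\<in>{B. B \<subseteq> A \<and> finite B \<and> alg_independent K B}. enat (card B))"

definition minimal_field :: "nat \<Rightarrow> 'a::field ratfun set \<Rightarrow> bool" where
  "minimal_field n M \<longleftrightarrow> trdeg const_field (M \<inter> poly_ring n) = trdeg const_field M"

end

theory Submission
  imports Defs "HOL-Computational_Algebra.Polynomial" "HOL-Library.FuncSet"
begin

text \<open>
  Let \<open>A = M \<inter> k[x]\<close>.  There are a variable \<open>x\<^sub>j \<notin> M\<close> and a curve \<open>x\<^sub>i = \<phi>\<^sub>i(t)\<close>, \<open>x\<^sub>j = t\<close>, such that
  the restriction of \<open>A\<close> to the curve does not contain \<open>t\<close>, but contains \<open>\<phi>\<close> and \<open>t \<phi>\<close> for some monic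
  \<open>\<phi>\<close> of degree \<open>d \<ge> 1\<close>, and some nonzero element of \<open>A\<close> vanishes on the curve.  Let \<open>\<sigma>\<close> send
  \<open>x\<^sub>j\<close> to \<open>\<tau> = 1/x\<^sub>j + 2z\<close>, \<open>z\<close> to \<open>\<zeta> = 1/x\<^sub>j + z\<close> and the other \<open>x\<^sub>i\<close> to \<open>x\<^sub>i x\<^sub>j\<^sup>N + \<phi>\<^sub>i(\<tau>)\<close>
  for a large \<open>N\<close>, and let \<open>R\<close> consist of the elements of \<open>M(z)\<close> that \<open>\<sigma>\<close> maps to polynomials.
  The denominators of the inverse of \<open>\<sigma>\<close> are powers of \<open>2z - x\<^sub>j\<close>, which has no divisor over \<open>M\<close>;
  hence \<open>R \<subseteq> A[z]\<close>.  As \<open>t\<close> is not a restriction of an element of \<open>A\<close>, every element of \<open>R\<close> is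
  constant on the curve.  Conversely, let \<open>F \<in> A[z]\<close> vanish on the curve to the smallest possible
  order \<open>\<nu>\<close>.  For every \<open>l\<close> there is a monic \<open>G\<^sub>l \<in> A[z]\<close> of degree \<open>l\<close> for which the pole of
  \<open>\<sigma>(G\<^sub>l)\<close> along \<open>x\<^sub>j = 0\<close> has order at most \<open>d(d + 1)\<close>, so that \<open>F G\<^sub>l \<in> R\<close>.  The product of two elements
  of \<open>R\<close> that vanish on the curve vanishes to order greater than \<open>\<nu>\<close>; so if \<open>R\<close> were finitely
  generated, the coefficients of order \<open>\<nu>\<close> would span a finite-dimensional space, but those of the
  \<open>F G\<^sub>l\<close> are linearly independent.  Finally, multiplication by a power of \<open>F\<close> takes \<open>A[z]\<close> into \<open>R\<close>, hence
  \<open>Q(R) = M(z)\<close>.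
\<close>

text \<open>Near x_j = 0 the elements \<tau> and \<zeta> have the same pole, so powers of \<tau>
  would cancel those of \<zeta>; but t is by construction missed by the restrictions of A. The
  substitute is v/u, where u and v in A restrict to \<phi> and t \<phi>: its image agrees with
  \<tau> to high order. Only products u^(i-k) v^k = u^i (v/u)^k with k \<le> i are at hand; the
  approximate relation u = \<phi>(v/u) trades the other monomials for these, up to poles of order
  d(d+1). The curve has to meet opposing demands: t must be missed, yet the restrictions should have
  finite codimension in k[t], so that \<phi> exists. The first is secured by a \<mu> of degree at
  least 2 modulo which all elements of A become constants. Changing the curve by multiples of \<mu>
  preserves this and leaves enough freedom for two coprime degrees of restrictions. The factor 2 in
  \<tau> makes 2 \<zeta> - \<tau> = 1/x_j, whence \<sigma> can be inverted with powers of 2z - x_j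
  as the only denominators. Minimality is used twice: A has transcendence degree at least 2, and
  Q(A) = M because k[x] is integrally closed.\<close>

abbreviation "lookup \<equiv> Poly_Mapping.lookup"
abbreviation "keys \<equiv> Poly_Mapping.keys"

section \<open>Ring homomorphisms and substitution\<close>

locale rhom =
  fixes h :: "'a::comm_ring_1 \<Rightarrow> 'b::comm_ring_1"
  assumes hom_one [simp]: "h 1 = 1"
    and hom_add [simp]: "h (x + y) = h x + h y"
    and hom_mult [simp]: "h (x * y) = h x * h y"
begin

lemma hom_zero [simp]: "h 0 = 0"
  using hom_add[of 0 0] by simp

lemma hom_uminus [simp]: "h (- x) = - h x"
  using hom_add[of x "- x"] by (simp add: eq_neg_iff_add_eq_0 add.commute)

lemma hom_diff [simp]: "h (x - y) = h x - h y"
  using hom_add[of x "- y"] by simp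

lemma hom_power [simp]: "h (x ^ n) = h x ^ n"
  by (induction n) auto

lemma hom_sum [simp]: "h (sum f A) = (\<Sum>x\<in>A. h (f x))"
  by (induction A rule: infinite_finite_induct) auto

lemma hom_prod [simp]: "h (prod f A) = (\<Prod>x\<in>A. h (f x))"
  by (induction A rule: infinite_finite_induct) auto

lemma hom_of_nat [simp]: "h (of_nat n) = of_nat n"
  by (induction n) auto

lemma hom_numeral [simp]: "h (numeral n) = numeral n"
  using hom_of_nat[of "numeral n"] by simp

end

lemma rhom_compose: "rhom f \<Longrightarrow> rhom g \<Longrightarrow> rhom (\<lambda>x. f (g x))"
  by (simp add: rhom_def)

lemma rhom_id: "rhom (\<lambda>x. x)"
  by (simp add: rhom_def)

definition cst :: "'a::zero \<Rightarrow> ('v, 'a) mpoly" where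
  "cst c = Poly_Mapping.single 0 c"

definition var :: "'v \<Rightarrow> ('v, 'a::zero_neq_one) mpoly" where
  "var i = Poly_Mapping.single (Poly_Mapping.single i 1) 1"

lemma rhom_cst: "rhom (cst :: 'a::comm_ring_1 \<Rightarrow> ('v, 'a) mpoly)"
  by unfold_locales (simp_all add: cst_def single_add mult_single)

definition mon :: "('v \<Rightarrow> 'b::comm_ring_1) \<Rightarrow> ('v \<Rightarrow>\<^sub>0 nat) \<Rightarrow> 'b" where
  "mon \<theta> m = (\<Prod>i\<in>keys m. \<theta> i ^ lookup m i)"

text \<open>Coefficients and variables are mapped separately: restriction to a curve, both
  directions of the automorphism, specialisation at a point and the deformation \<open>blow\<close>
  are all instances, and two such maps need to be compared on constants and variables only.\<close>

definition ev :: "('a::comm_ring_1 \<Rightarrow> 'b::comm_ring_1) \<Rightarrow> ('v \<Rightarrow> 'b) \<Rightarrow> ('v, 'a) mpoly \<Rightarrow> 'b" where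
  "ev \<kappa> \<theta> p = (\<Sum>m\<in>keys p. \<kappa> (lookup p m) * mon \<theta> m)"

abbreviation "uev \<equiv> ev (\<lambda>c. [:c:])"

lemma mon_superset:
  assumes "finite S" "keys m \<subseteq> S"
  shows "mon \<theta> m = (\<Prod>i\<in>S. \<theta> i ^ lookup m i)"
  unfolding mon_def
  by (rule prod.mono_neutral_left) (use assms in \<open>auto simp: in_keys_iff\<close>)

lemma mon_add: "mon \<theta> (m + m') = mon \<theta> m * mon \<theta> m'"
proof -
  let ?S = "keys m \<union> keys m'"
  have "mon \<theta> (m + m') = (\<Prod>i\<in>?S. \<theta> i ^ lookup (m + m') i)"
    by (rule mon_superset) (auto simp: in_keys_iff lookup_add)
  also have "\<dots> = mon \<theta> m * mon \<theta> m'"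
    by (subst (1 2) mon_superset[of ?S]) (auto simp: lookup_add power_add prod.distrib)
  finally show ?thesis .
qed

lemma mon_zero [simp]: "mon \<theta> 0 = 1"
  by (simp add: mon_def)

lemma mon_single [simp]: "mon \<theta> (Poly_Mapping.single i e) = \<theta> i ^ e"
  by (simp add: mon_def)

lemma poly_mapping_sum_singles:
  "p = (\<Sum>m\<in>keys p. Poly_Mapping.single m (lookup p m))"
  by (rule poly_mapping_eqI)
    (auto simp: lookup_sum lookup_single when_def in_keys_iff)

lemma poly_mapping_add_induct [case_names zero single add]:
  fixes p :: "'v \<Rightarrow>\<^sub>0 'c::comm_monoid_add"
  assumes "P 0" "\<And>m c. P (Poly_Mapping.single m c)" "\<And>p q. P p \<Longrightarrow> P q \<Longrightarrow> P (p + q)"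
  shows "P p"
proof -
  have "P (\<Sum>m\<in>S. Poly_Mapping.single m (lookup p m))" if "finite S" for S
    using that by induction (auto intro: assms)
  then show ?thesis
    by (subst poly_mapping_sum_singles) auto
qed

context rhom
begin

lemma ev_superset:
  assumes "finite S" "keys p \<subseteq> S"
  shows "ev h \<theta> p = (\<Sum>m\<in>S. h (lookup p m) * mon \<theta> m)"
  unfolding ev_def
  by (rule sum.mono_neutral_left) (use assms in \<open>auto simp: in_keys_iff\<close>)

lemma ev_single: "ev h \<theta> (Poly_Mapping.single m c) = h c * mon \<theta> m"
  by (subst ev_superset[of "{m}"]) auto

lemma ev_add: "ev h \<theta> (p + q) = ev h \<theta> p + ev h \<theta> q"
proof -
  let ?S = "keys p \<union> keys q"
  have "ev h \<theta> (p + q) = (\<Sum>m\<in>?S. h (lookup (p + q) m) * mon \<theta> m)"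
    by (rule ev_superset) (auto simp: in_keys_iff lookup_add)
  also have "\<dots> = ev h \<theta> p + ev h \<theta> q"
    by (subst (1 2) ev_superset[of ?S]) (auto simp: lookup_add distrib_right sum.distrib)
  finally show ?thesis .
qed

lemma ev_zero: "ev h \<theta> 0 = 0"
  by (simp add: ev_def)

lemma ev_mult: "ev h \<theta> (p * q) = ev h \<theta> p * ev h \<theta> q"
proof (induction p rule: poly_mapping_add_induct)
  case zero
  then show ?case by (simp add: ev_zero)
next
  case (add p p')
  then show ?case by (simp add: distrib_right ev_add)
next
  case (single m c)
  show ?case
  proof (induction q rule: poly_mapping_add_induct)
    case zero
    then show ?case by (simp add: ev_zero)
  next
    case (single m' c')
    then show ?case by (simp add: mult_single ev_single mon_add mult_ac)
  next
    case (add p p')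
    then show ?case by (simp add: distrib_left ev_add)
  qed
qed

lemma ev_cst [simp]: "ev h \<theta> (cst c) = h c"
  by (simp add: cst_def ev_single)

lemma ev_var [simp]: "ev h \<theta> (var i) = \<theta> i"
  by (simp add: var_def ev_single)

lemma rhom_ev: "rhom (ev h \<theta>)"
proof
  show "ev h \<theta> 1 = 1"
    using ev_single[of \<theta> 0 1] by simp
qed (auto simp: ev_add ev_mult)

end

lemma poly_vars_cst [simp]: "poly_vars (cst c) = {}"
  by (auto simp: poly_vars_def cst_def split: if_splits)

lemma poly_vars_var [simp]: "poly_vars (var i :: ('v, 'a::zero_neq_one) mpoly) = {i}"
  by (simp add: poly_vars_def var_def)

lemma poly_vars_add: "poly_vars (p + q) \<subseteq> poly_vars p \<union> poly_vars q"
  using keys_add[of p q] by (auto simp: poly_vars_def)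

lemma poly_vars_mult: "poly_vars (p * q) \<subseteq> poly_vars p \<union> poly_vars q"
proof
  fix i assume "i \<in> poly_vars (p * q)"
  then obtain m where m: "m \<in> keys (p * q)" "i \<in> keys m"
    by (auto simp: poly_vars_def)
  then obtain a b where "m = a + b" "a \<in> keys p" "b \<in> keys q"
    using keys_mult[of p q] by blast
  then show "i \<in> poly_vars p \<union> poly_vars q"
    using m(2) keys_add[of a b] by (auto simp: poly_vars_def)
qed

lemma var_power: "var i ^ e = Poly_Mapping.single (Poly_Mapping.single i e) (1::'a::comm_ring_1)"
proof (induction e)
  case (Suc e)
  then show ?case by (simp add: var_def mult_single flip: single_add)
qed simp

lemma single_eq_cst_vars:
  fixes m :: "'v \<Rightarrow>\<^sub>0 nat"
  shows "Poly_Mapping.single m (c::'a::comm_ring_1) = cst c * mon var m"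
proof -
  have "mon (var :: 'v \<Rightarrow> ('v, 'a) mpoly) m = Poly_Mapping.single m 1" for m :: "'v \<Rightarrow>\<^sub>0 nat"
  proof (induction m rule: poly_mapping_add_induct)
    case (add p q)
    then show ?case by (simp add: mon_add mult_single)
  qed (simp_all add: var_power)
  then show ?thesis by (simp add: cst_def mult_single)
qed

text \<open>The variables are confined to \<open>I\<close> so that the case \<open>var\<close>
  carries the bound that membership in \<open>poly_ring n\<close> supplies.\<close>

lemma mpoly_induct [consumes 1, case_names cst var add mult]:
  fixes p :: "('v, 'a::comm_ring_1) mpoly"
  assumes vars: "poly_vars p \<subseteq> I"
    and c: "\<And>c. P (cst c)" and v: "\<And>i. i \<in> I \<Longrightarrow> P (var i)"
    and a: "\<And>p q. P p \<Longrightarrow> P q \<Longrightarrow> P (p + q)" and m: "\<And>p q. P p \<Longrightarrow> P q \<Longrightarrow> P (p * q)"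
  shows "P p"
proof -
  have one: "P 1" using c[of 1] by (simp add: cst_def)
  have zero: "P 0" using c[of 0] by (simp add: cst_def)
  have pow: "P (var i ^ e)" if "i \<in> I" for i e
    by (induction e) (auto intro: one m v that)
  have mon: "P (mon var x)" if "keys x \<subseteq> I" for x
  proof -
    have "P (\<Prod>i\<in>S. var i ^ lookup x i)" if "finite S" "S \<subseteq> I" for S
      using that by induction (auto intro: one m pow)
    then show ?thesis using that by (simp add: mon_def)
  qed
  have sing: "P (Poly_Mapping.single x (lookup p x))" if "x \<in> keys p" for x
    using that vars by (auto simp: single_eq_cst_vars poly_vars_def intro!: m c mon)
  have "P (\<Sum>x\<in>S. Poly_Mapping.single x (lookup p x))"
    if "finite S" "S \<subseteq> keys p" for S
    using that by induction (auto intro: zero a sing)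
  then show ?thesis
    by (subst poly_mapping_sum_singles) auto
qed

lemma rhom_agree:
  fixes p :: "('v, 'a::comm_ring_1) mpoly"
  assumes "rhom f" "rhom g" "poly_vars p \<subseteq> I"
    and "\<And>c. f (cst c) = g (cst c)" "\<And>i. i \<in> I \<Longrightarrow> f (var i) = g (var i)"
  shows "f p = g p"
proof -
  interpret f: rhom f by fact
  interpret g: rhom g by fact
  show ?thesis
    using assms(3) by (induction p rule: mpoly_induct) (auto simp: assms)
qed

lemma ev_agree:
  assumes "rhom h" "poly_vars p \<subseteq> I" "\<And>i. i \<in> I \<Longrightarrow> \<theta> i = \<theta>' i"
  shows "ev h \<theta> p = ev h \<theta>' p"
  using assms by (intro rhom_agree[of "ev h \<theta>" "ev h \<theta>'" p I]) (auto simp: rhom.rhom_ev rhom.ev_cst rhom.ev_var)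

lemma hom_ev:
  fixes p :: "('v, 'a::comm_ring_1) mpoly"
  assumes "rhom f" "rhom \<kappa>"
  shows "f (ev \<kappa> \<theta> p) = ev (\<lambda>c. f (\<kappa> c)) (\<lambda>i. f (\<theta> i)) p"
proof -
  have k: "rhom (\<lambda>c. f (\<kappa> c))" using assms by (rule rhom_compose)
  show ?thesis
    by (rule rhom_agree[of _ _ p UNIV])
      (use assms k in \<open>auto intro: rhom_compose rhom.rhom_ev simp: rhom.ev_cst rhom.ev_var\<close>)
qed

lemma rhom_of_mpoly: "rhom of_mpoly"
  by unfold_locales (simp_all add: of_mpoly_def One_fract_def)

interpretation of_mpoly: rhom of_mpoly by (rule rhom_of_mpoly)

instance fract :: ("{idom, ring_char_0}") field_char_0
proof
  show "inj (of_nat :: nat \<Rightarrow> 'a fract)"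
    by (rule injI) (simp add: of_nat_fract eq_fract)
qed

lemma of_mpoly_eq_iff [simp]: "of_mpoly p = of_mpoly q \<longleftrightarrow> p = q"
  by (simp add: of_mpoly_def eq_fract)

lemma of_mpoly_eq_0_iff [simp]: "of_mpoly p = 0 \<longleftrightarrow> p = 0"
  using of_mpoly_eq_iff[of p 0] by (simp del: of_mpoly_eq_iff)

definition K :: "'a::field \<Rightarrow> 'a ratfun" where "K c = of_mpoly (cst c)"

lemma rhom_K: "rhom K"
  unfolding K_def by (intro rhom_compose[OF rhom_of_mpoly rhom_cst])

interpretation K: rhom K by (rule rhom_K)

lemma K_eq_iff [simp]: "K c = K d \<longleftrightarrow> c = d"
  by (auto simp: K_def cst_def dest: arg_cong[of _ _ "\<lambda>p. lookup p 0"])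

lemma K_eq_0_iff [simp]: "K c = 0 \<longleftrightarrow> c = 0"
  using K_eq_iff[of c 0] by (simp del: K_eq_iff)

lemma const_field_eq: "const_field = range K"
  by (simp add: const_field_def K_def cst_def)

lemma ratvar_eq: "ratvar i = of_mpoly (var i)"
  by (simp add: ratvar_def var_def)

lemma of_mpoly_ev: "of_mpoly p = ev K ratvar p"
proof -
  have "of_mpoly p = of_mpoly (ev cst var p)"
    by (rule arg_cong, rule rhom_agree[OF rhom_id rhom.rhom_ev[OF rhom_cst], of p UNIV var])
      (auto simp: rhom.ev_cst[OF rhom_cst] rhom.ev_var[OF rhom_cst])
  then show ?thesis
    by (simp add: hom_ev[OF rhom_of_mpoly rhom_cst] flip: K_def ratvar_eq)
qed

lemma ratfun_cases:
  fixes y :: "'a::field ratfun"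
  obtains p q where "y = of_mpoly p / of_mpoly q" "q \<noteq> 0"
  by (cases y rule: Fract_cases) (auto simp: of_mpoly_def)

section \<open>Subrings and subfields\<close>

lemma is_subringD:
  assumes "is_subring A"
  shows "0 \<in> A" "1 \<in> A" "a \<in> A \<Longrightarrow> b \<in> A \<Longrightarrow> a + b \<in> A" "a \<in> A \<Longrightarrow> - a \<in> A"
    "a \<in> A \<Longrightarrow> b \<in> A \<Longrightarrow> a * b \<in> A" "a \<in> A \<Longrightarrow> b \<in> A \<Longrightarrow> a - b \<in> A"
    "a \<in> A \<Longrightarrow> a ^ e \<in> A" "(\<And>x. x \<in> S \<Longrightarrow> f x \<in> A) \<Longrightarrow> sum f S \<in> A"
    "(\<And>x. x \<in> S \<Longrightarrow> f x \<in> A) \<Longrightarrow> prod f S \<in> A" "of_nat e \<in> A"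
proof -
  note * = assms[unfolded is_subring_def]
  show "0 \<in> A" "1 \<in> A" "a \<in> A \<Longrightarrow> b \<in> A \<Longrightarrow> a + b \<in> A" "a \<in> A \<Longrightarrow> - a \<in> A"
    "a \<in> A \<Longrightarrow> b \<in> A \<Longrightarrow> a * b \<in> A"
    using * by auto
  show "a - b \<in> A" if "a \<in> A" "b \<in> A"
  proof -
    have "a + - b \<in> A" using * that by blast
    then show ?thesis by simp
  qed
  show "a ^ e \<in> A" if "a \<in> A"
    using that * by (induction e) auto
  show "sum f S \<in> A" if "\<And>x. x \<in> S \<Longrightarrow> f x \<in> A"
    using that by (induction S rule: infinite_finite_induct) (use * in auto)
  show "prod f S \<in> A" if "\<And>x. x \<in> S \<Longrightarrow> f x \<in> A"
    using that by (induction S rule: infinite_finite_induct) (use * in auto)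
  show "of_nat e \<in> A"
    by (induction e) (use * in auto)
qed

lemma is_subfieldD:
  assumes "is_subfield L"
  shows "is_subring L" "a \<in> L \<Longrightarrow> inverse a \<in> L" "a \<in> L \<Longrightarrow> b \<in> L \<Longrightarrow> a / b \<in> L"
  using assms by (auto simp: is_subfield_def divide_inverse intro: is_subringD)

lemma is_subring_Int: "is_subring A \<Longrightarrow> is_subring B \<Longrightarrow> is_subring (A \<inter> B)"
  by (auto simp: is_subring_def)

lemma ev_in_subring:
  assumes "is_subring A" "rhom \<kappa>" "poly_vars p \<subseteq> I" "\<And>c. \<kappa> c \<in> A" "\<And>i. i \<in> I \<Longrightarrow> \<theta> i \<in> A"
  shows "ev \<kappa> \<theta> p \<in> A"
proof -
  interpret rhom \<kappa> by fact
  interpret e: rhom "ev \<kappa> \<theta>" by (rule rhom_ev)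
  show ?thesis using assms(3)
    by (induction p rule: mpoly_induct) (auto intro: assms is_subringD)
qed

lemma is_subring_poly_ring: "is_subring (poly_ring n)"
proof -
  have "of_mpoly p + of_mpoly q \<in> poly_ring n" "of_mpoly p * of_mpoly q \<in> poly_ring n"
    if "poly_vars p \<subseteq> {..<n}" "poly_vars q \<subseteq> {..<n}" for p q :: "(nat, 'a) mpoly"
    using poly_vars_add[of p q] poly_vars_mult[of p q] that unfolding poly_ring_def
    by (auto intro!: imageI simp flip: of_mpoly.hom_add of_mpoly.hom_mult)
  moreover have "- of_mpoly p \<in> poly_ring n" if "poly_vars p \<subseteq> {..<n}" for p :: "(nat, 'a) mpoly"
  proof -
    have "poly_vars (- p) = poly_vars p"
      by (simp add: poly_vars_def in_keys_iff set_eq_iff)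
    then show ?thesis using that unfolding poly_ring_def by (auto simp flip: of_mpoly.hom_uminus)
  qed
  moreover have "0 \<in> poly_ring n" "1 \<in> poly_ring n"
    by (auto simp: poly_ring_def poly_vars_def intro!: image_eqI[of _ _ 0] image_eqI[of _ _ 1])
  ultimately show ?thesis
    by (auto simp: is_subring_def poly_ring_def)
qed

lemmas poly_ring_closed = is_subringD[OF is_subring_poly_ring]

lemma K_in_poly_ring [simp]: "K c \<in> poly_ring n"
  by (auto simp: K_def poly_ring_def)

lemma ratvar_in_poly_ring [simp]: "i < n \<Longrightarrow> ratvar i \<in> poly_ring n"
  by (auto simp: ratvar_eq poly_ring_def)

lemma poly_ring_mono: "m \<le> n \<Longrightarrow> poly_ring m \<subseteq> poly_ring n"
  by (fastforce simp: poly_ring_def)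

lemma is_subfield_frac_field:
  assumes "is_subring A"
  shows "is_subfield (frac_field A)"
proof -
  note [intro] = is_subringD[OF assms]
  have fI: "a / b \<in> frac_field A" if "a \<in> A" "b \<in> A" "b \<noteq> 0" for a b
    using that by (auto simp: frac_field_def)
  have "x + y \<in> frac_field A \<and> x * y \<in> frac_field A \<and> - x \<in> frac_field A \<and> inverse x \<in> frac_field A"
    if "x \<in> frac_field A" "y \<in> frac_field A" for x y
  proof -
    obtain a b c d where *: "x = a / b" "y = c / d" "a \<in> A" "b \<in> A" "c \<in> A" "d \<in> A" "b \<noteq> 0" "d \<noteq> 0"
      using \<open>x \<in> _\<close> \<open>y \<in> _\<close> by (auto simp: frac_field_def)
    have "x + y = (a * d + c * b) / (b * d)" "x * y = (a * c) / (b * d)" "- x = (- a) / b"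
      using * by (auto simp: field_simps)
    moreover have "inverse x = (if a = 0 then 0 / 1 else b / a)"
      using * by (auto simp: field_simps)
    moreover have "(a * d + c * b) / (b * d) \<in> frac_field A" "(a * c) / (b * d) \<in> frac_field A"
      "(- a) / b \<in> frac_field A"
      by (rule fI; use * in auto)+
    moreover have "(if a = 0 then 0 / 1 else b / a) \<in> frac_field A"
      using * fI[of 0 1] by (auto intro!: fI)
    ultimately show ?thesis by metis
  qed
  moreover have "0 / 1 \<in> frac_field A" "1 / 1 \<in> frac_field A"
    by (rule fI; use is_subringD(1,2)[OF assms] in simp)+
  ultimately show ?thesis
    by (auto simp: is_subfield_def is_subring_def)
qed

lemma subset_frac_field: "is_subring A \<Longrightarrow> A \<subseteq> frac_field A"
  using is_subringD(2)[of A] by (fastforce simp: frac_field_def intro: exI[of _ 1])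

lemma frac_field_subset: "is_subfield L \<Longrightarrow> A \<subseteq> L \<Longrightarrow> frac_field A \<subseteq> L"
  by (auto simp: frac_field_def intro!: is_subfieldD)

lemma is_subfield_hull: "is_subfield (is_subfield hull S)"
  by (rule hull_in) (auto simp: is_subfield_def is_subring_def)

lemma is_subfield_rat_field: "is_subfield (rat_field n)"
  unfolding rat_field_def by (intro is_subfield_frac_field is_subring_poly_ring)

lemma poly_ring_subset_rat_field: "poly_ring n \<subseteq> rat_field n"
  unfolding rat_field_def by (intro subset_frac_field is_subring_poly_ring)

section \<open>Counting monomials\<close>

text \<open>Gaussian elimination, one equation of \<open>Y\<close> at a time. The dimension counts
  of the development are reduced to this form.\<close>

lemma kernel_exists:
  fixes c :: "'x \<Rightarrow> 'y \<Rightarrow> 'a::field"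
  assumes "finite Y" "finite X" "card Y < card X"
  shows "\<exists>a. (\<exists>x\<in>X. a x \<noteq> 0) \<and> (\<forall>y\<in>Y. (\<Sum>x\<in>X. a x * c x y) = 0)"
  using assms
proof (induction Y arbitrary: X c rule: finite_induct)
  case empty
  then show ?case by (intro exI[of _ "\<lambda>_. 1"]) (auto simp: card_gt_0_iff)
next
  case (insert y Y)
  show ?case
  proof (cases "\<forall>x\<in>X. c x y = 0")
    case True
    with insert.IH[of X c] insert.prems insert.hyps show ?thesis by auto
  next
    case False
    then obtain x0 where x0: "x0 \<in> X" "c x0 y \<noteq> 0" by auto
    define X' where "X' = X - {x0}"
    \<comment> \<open>The coefficients that remain after the unknown \<open>x0\<close> has been
      eliminated by means of equation \<open>y\<close>.\<close>
    define c' where "c' = (\<lambda>x z. c x z - c x y / c x0 y * c x0 z)"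
    have "finite X'" "card Y < card X'"
      using insert.prems insert.hyps x0 by (auto simp: X'_def)
    from insert.IH[OF this, of c'] obtain a' where a': "\<exists>x\<in>X'. a' x \<noteq> 0" "\<And>z. z \<in> Y \<Longrightarrow> (\<Sum>x\<in>X'. a' x * c' x z) = 0"
      by auto
    \<comment> \<open>Back substitution: equation \<open>y\<close> dictates the value at
      \<open>x0\<close>.\<close>
    define a where "a = (\<lambda>x. if x = x0 then - (\<Sum>x\<in>X'. a' x * c x y) / c x0 y else a' x)"
    have split: "(\<Sum>x\<in>X. a x * c x z) = a x0 * c x0 z + (\<Sum>x\<in>X'. a' x * c x z)" for z
    proof -
      have "(\<Sum>x\<in>X. a x * c x z) = a x0 * c x0 z + (\<Sum>x\<in>X'. a x * c x z)"
        unfolding X'_def using insert.prems x0 by (simp add: sum.remove)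
      also have "(\<Sum>x\<in>X'. a x * c x z) = (\<Sum>x\<in>X'. a' x * c x z)"
        by (rule sum.cong) (auto simp: a_def X'_def)
      finally show ?thesis .
    qed
    have "(\<Sum>x\<in>X. a x * c x z) = 0" if "z \<in> insert y Y" for z
    proof (cases "z = y")
      case True
      then show ?thesis unfolding split using x0 by (simp add: a_def)
    next
      case False
      define s where "s = (\<Sum>x\<in>X'. a' x * c x y)"
      have "(\<Sum>x\<in>X'. a' x * c' x z) = (\<Sum>x\<in>X'. a' x * c x z) - s / c x0 y * c x0 z"
        by (simp add: s_def c'_def right_diff_distrib sum_subtractf sum_distrib_right sum_divide_distrib mult.assoc)
      moreover have "a x0 = - s / c x0 y" by (simp add: a_def s_def)
      ultimately show ?thesis using False that a'(2)[of z] unfolding split by simp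
    qed
    moreover have "\<exists>x\<in>X. a x \<noteq> 0"
      using a'(1) by (auto simp: a_def X'_def)
    ultimately show ?thesis by blast
  qed
qed

text \<open>A bound on every single exponent, not on the total degree: the count becomes a power,
  the bounds add under products, and a base larger than the bound separates the monomials as digits
  do.\<close>

definition box :: "nat \<Rightarrow> nat \<Rightarrow> (nat \<Rightarrow>\<^sub>0 nat) set" where
  "box n D = {m. keys m \<subseteq> {..<n} \<and> (\<forall>i. lookup m i \<le> D)}"

lemma finite_box: "finite (box n D)" and card_box: "card (box n D) \<le> (D + 1) ^ n"
proof -
  let ?f = "\<lambda>m :: nat \<Rightarrow>\<^sub>0 nat. restrict (lookup m) {..<n}"
  have inj: "inj_on ?f (box n D)"
  proof (rule inj_onI, rule poly_mapping_eqI)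
    fix m m' i assume *: "m \<in> box n D" "m' \<in> box n D" "?f m = ?f m'"
    show "lookup m i = lookup m' i"
    proof (cases "i < n")
      case True
      then show ?thesis using fun_cong[OF *(3), of i] by simp
    next
      case False
      then have "i \<notin> keys m" "i \<notin> keys m'" using * by (auto simp: box_def)
      then show ?thesis by (simp add: in_keys_iff)
    qed
  qed
  have sub: "?f ` box n D \<subseteq> PiE {..<n} (\<lambda>_. {..D})"
    by (auto simp: box_def split: if_splits)
  have fin: "finite (PiE {..<n} (\<lambda>_. {..D}))"
    by (intro finite_PiE) auto
  show "finite (box n D)"
    using finite_subset[OF sub fin] inj by (rule finite_imageD)
  show "card (box n D) \<le> (D + 1) ^ n"
    using card_inj_on_le[OF inj sub fin] by (simp add: card_PiE)
qed

definition boxed :: "nat \<Rightarrow> nat \<Rightarrow> (nat, 'a::zero) mpoly \<Rightarrow> bool" where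
  "boxed n D p \<longleftrightarrow> keys p \<subseteq> box n D"

lemma boxed_exists:
  assumes "poly_vars p \<subseteq> {..<n}"
  shows "\<exists>D. boxed n D p"
proof -
  let ?D = "\<Sum>m\<in>keys p. \<Sum>i\<in>keys m. lookup m i"
  have "lookup m i \<le> ?D" if "m \<in> keys p" for m i
  proof (cases "i \<in> keys m")
    case True
    then have "lookup m i \<le> (\<Sum>i\<in>keys m. lookup m i)"
      by (intro member_le_sum) auto
    also have "\<dots> \<le> ?D"
      using that by (intro member_le_sum[of m]) auto
    finally show ?thesis .
  qed (simp add: in_keys_iff)
  then have "boxed n ?D p"
    using assms by (auto simp: boxed_def box_def poly_vars_def)
  then show ?thesis ..
qed

lemma boxed_mono:
  assumes "boxed n D p" "D \<le> D'"
  shows "boxed n D' p"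
proof -
  have "box n D \<subseteq> box n D'"
    using assms(2) by (auto simp: box_def intro: le_trans)
  then show ?thesis using assms(1) by (auto simp: boxed_def)
qed

lemma boxed_mult:
  assumes "boxed n D p" "boxed n E q"
  shows "boxed n (D + E) (p * q)"
  unfolding boxed_def
proof
  fix m assume "m \<in> keys (p * q)"
  then obtain a b where *: "m = a + b" "a \<in> keys p" "b \<in> keys q"
    using keys_mult[of p q] by blast
  then have "a \<in> box n D" "b \<in> box n E" using assms by (auto simp: boxed_def)
  then show "m \<in> box n (D + E)"
    using keys_add[of a b] by (auto simp: box_def *(1) lookup_add intro: add_mono)
qed

lemma boxed_one: "boxed n 0 (1 :: (nat, 'a::zero_neq_one) mpoly)"
  by (auto simp: boxed_def box_def)

lemma boxed_power: "boxed n D p \<Longrightarrow> boxed n (e * D) (p ^ e)"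
  by (induction e) (auto simp: boxed_one intro: boxed_mult)

lemma boxed_prod:
  assumes "finite S" "\<And>x. x \<in> S \<Longrightarrow> boxed n (D x) (p x)"
  shows "boxed n (\<Sum>x\<in>S. D x) (\<Prod>x\<in>S. p x)"
  using assms by (induction) (auto simp: boxed_one intro: boxed_mult)

lemma lookup_cst_mult: "lookup (cst c * p) y = c * lookup p y"
  for c :: "'a::comm_ring_1" and p :: "(nat, 'a) mpoly"
  unfolding cst_def by (simp add: mult_map_scale_conv_mult[symmetric] Poly_Mapping.map.rep_eq when_def)

lemma box_dependent:
  fixes r :: "'x \<Rightarrow> (nat, 'a::field) mpoly"
  assumes "finite X" "\<And>x. x \<in> X \<Longrightarrow> boxed n D (r x)" "(D + 1) ^ n < card X"
  shows "\<exists>a. (\<exists>x\<in>X. a x \<noteq> 0) \<and> (\<Sum>x\<in>X. cst (a x) * r x) = 0"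
proof -
  obtain a where a: "\<exists>x\<in>X. a x \<noteq> 0" "\<And>y. y \<in> box n D \<Longrightarrow> (\<Sum>x\<in>X. a x * lookup (r x) y) = 0"
    using kernel_exists[OF finite_box[of n D] assms(1), of "\<lambda>x. lookup (r x)"] card_box[of n D] assms(3)
    by auto
  note l = lookup_cst_mult
  have "(\<Sum>x\<in>X. cst (a x) * r x) = 0"
  proof (rule poly_mapping_eqI)
    fix y
    show "lookup (\<Sum>x\<in>X. cst (a x) * r x) y = lookup 0 y"
    proof (cases "y \<in> box n D")
      case True
      then show ?thesis using a(2) by (simp add: lookup_sum l)
    next
      case False
      then have "y \<notin> keys (r x)" if "x \<in> X" for x
        using assms(2)[OF that] by (auto simp: boxed_def)
      then show ?thesis by (simp add: lookup_sum l in_keys_iff)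
    qed
  qed
  with a(1) show ?thesis by blast
qed

section \<open>Algebraic independence\<close>

lemma eval_self_ev: "eval_self p = ev (\<lambda>x. x) (\<lambda>x. x) p"
  by (simp add: eval_self_def ev_def mon_def)

interpretation eval_self: rhom eval_self
  using rhom.rhom_ev[OF rhom_id, of "\<lambda>x. x"] by (simp add: eval_self_ev[abs_def])

lemma eval_self_single: "eval_self (Poly_Mapping.single m c) = c * mon (\<lambda>x. x) m"
  unfolding eval_self_ev by (rule rhom.ev_single[OF rhom_id])

text \<open>\<open>alg_independent\<close> speaks of polynomials whose variables are the elements of
  \<open>B\<close> themselves; counting arguments produce relations indexed by exponent functions.
  Extensionality (\<open>PiE\<close>) ensures that different functions are different
  monomials.\<close>

lemma alg_indep_monomials:
  fixes a :: "('b::field \<Rightarrow> nat) \<Rightarrow> 'b"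
  assumes ind: "alg_independent F B" and fin: "finite B" "finite S" and F: "0 \<in> F"
    and S: "S \<subseteq> PiE B (\<lambda>_. UNIV)" and a: "\<And>\<alpha>. \<alpha> \<in> S \<Longrightarrow> a \<alpha> \<in> F"
    and eq: "(\<Sum>\<alpha>\<in>S. a \<alpha> * (\<Prod>b\<in>B. b ^ \<alpha> b)) = 0" and mem: "\<alpha> \<in> S"
  shows "a \<alpha> = 0"
proof -
  define mo where "mo = (\<lambda>\<alpha> :: 'b \<Rightarrow> nat. \<Sum>b\<in>B. Poly_Mapping.single b (\<alpha> b))"
  have lmo: "lookup (mo \<alpha>) b = (if b \<in> B then \<alpha> b else 0)" for \<alpha> b
    using fin by (auto simp: mo_def lookup_sum lookup_single when_def)
  have inj: "\<alpha> = \<beta>" if "\<alpha> \<in> S" "\<beta> \<in> S" "mo \<alpha> = mo \<beta>" for \<alpha> \<beta>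
  proof
    fix b show "\<alpha> b = \<beta> b"
    proof (cases "b \<in> B")
      case True
      then show ?thesis using that(3) lmo[of \<alpha> b] lmo[of \<beta> b] by simp
    next
      case False
      then show ?thesis
        using PiE_arb[OF subsetD[OF S that(1)] False] PiE_arb[OF subsetD[OF S that(2)] False] by simp
    qed
  qed
  define p where "p = (\<Sum>\<alpha>\<in>S. Poly_Mapping.single (mo \<alpha>) (a \<alpha>))"
  have lp: "lookup p (mo \<alpha>) = a \<alpha>" if "\<alpha> \<in> S" for \<alpha>
  proof -
    have "lookup p (mo \<alpha>) = (\<Sum>\<beta>\<in>S. if \<beta> = \<alpha> then a \<beta> else 0)"
      unfolding p_def lookup_sum by (rule sum.cong) (use inj that in \<open>auto simp: lookup_single when_def\<close>)
    then show ?thesis using that fin by simp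
  qed
  have lp': "lookup p m = 0" if "m \<notin> mo ` S" for m
    unfolding p_def lookup_sum by (rule sum.neutral) (use that in \<open>auto simp: lookup_single when_def\<close>)
  have "range (lookup p) \<subseteq> F"
  proof safe
    fix m show "lookup p m \<in> F"
      using lp lp' a F by (cases "m \<in> mo ` S") auto
  qed
  moreover have "poly_vars p \<subseteq> B"
  proof
    fix b assume "b \<in> poly_vars p"
    then obtain m where m: "lookup p m \<noteq> 0" "lookup m b \<noteq> 0"
      by (auto simp: poly_vars_def in_keys_iff)
    then obtain \<alpha> where "m = mo \<alpha>" using lp'[of m] by auto
    then show "b \<in> B" using m lmo[of \<alpha> b] by (auto split: if_splits)
  qed
  moreover have "eval_self p = 0"
  proof -
    have "mon (\<lambda>x. x) (mo \<alpha>) = (\<Prod>b\<in>B. b ^ \<alpha> b)" for \<alpha>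
      by (subst mon_superset[of B]) (use fin in \<open>auto simp: lmo in_keys_iff split: if_splits\<close>)
    then show ?thesis using eq by (simp add: p_def eval_self_single)
  qed
  ultimately have "p = 0" using ind by (auto simp: alg_independent_def)
  then show ?thesis using lp[OF mem] by simp
qed

lemma common_denominator_frac_field:
  assumes A: "is_subring A" and "finite B" "B \<subseteq> frac_field A"
  shows "\<exists>q. q \<in> A \<and> q \<noteq> 0 \<and> (\<forall>b\<in>B. q * b \<in> A)"
  using assms(2,3)
proof induction
  case empty
  then show ?case using is_subringD(2)[OF A] by (intro exI[of _ 1]) auto
next
  case (insert b B)
  then obtain q where q: "q \<in> A" "q \<noteq> 0" "\<forall>b\<in>B. q * b \<in> A" by auto
  obtain x y where xy: "b = x / y" "x \<in> A" "y \<in> A" "y \<noteq> 0"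
    using insert.prems by (auto simp: frac_field_def)
  have "q * y * c \<in> A" if "c \<in> insert b B" for c
  proof (cases "c = b")
    case True
    then show ?thesis using q xy by (auto intro: is_subringD(5)[OF A])
  next
    case False
    then have "y * (q * c) \<in> A" using q xy that by (auto intro: is_subringD(5)[OF A])
    then show ?thesis by (simp add: mult_ac)
  qed
  moreover have "q * y \<in> A" "q * y \<noteq> 0" using q xy by (auto intro: is_subringD(5)[OF A])
  ultimately show ?case by blast
qed

lemmas common_denominator = common_denominator_frac_field[OF is_subring_poly_ring, folded rat_field_def]

text \<open>Counting: if \<open>B\<close> had more than \<open>n\<close> elements, its monomials
  with exponents up to \<open>d\<close>, cleared of denominators, would outnumber the monomials in
  \<open>n\<close> variables available to them, as the former grow at least like d^(n+1) and the
  latter like d^n.\<close>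

lemma card_alg_independent_le:
  fixes B :: "'a::field ratfun set"
  assumes B: "B \<subseteq> rat_field n" "finite B" and ind: "alg_independent const_field B"
  shows "card B \<le> n"
proof (rule ccontr)
  assume "\<not> card B \<le> n"
  then have cB: "n + 1 \<le> card B" by simp
  obtain q where q: "q \<in> poly_ring n" "q \<noteq> 0" "\<forall>b\<in>B. q * b \<in> poly_ring n"
    using common_denominator[OF B(2,1)] by auto
  obtain q' where q': "q = of_mpoly q'" "poly_vars q' \<subseteq> {..<n}"
    using q(1) by (auto simp: poly_ring_def)
  have "\<forall>b\<in>B. \<exists>p. q * b = of_mpoly p \<and> poly_vars p \<subseteq> {..<n}"
    using q(3) by (auto simp: poly_ring_def)
  then obtain P where P: "\<And>b. b \<in> B \<Longrightarrow> q * b = of_mpoly (P b)" "\<And>b. b \<in> B \<Longrightarrow> poly_vars (P b) \<subseteq> {..<n}"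
    by metis
  obtain E0 where E0: "boxed n E0 q'" using boxed_exists q'(2) by blast
  have "\<forall>b\<in>B. \<exists>E. boxed n E (P b)" using P(2) boxed_exists by blast
  then obtain E where E: "\<And>b. b \<in> B \<Longrightarrow> boxed n (E b) (P b)" by metis
  define C where "C = E0 + (\<Sum>b\<in>B. E b)"
  have bP: "boxed n C (P b)" if "b \<in> B" for b
    using E[OF that] by (rule boxed_mono) (use that B in \<open>auto simp: C_def intro: trans_le_add2 member_le_sum\<close>)
  have bq: "boxed n C q'" using E0 by (rule boxed_mono) (simp add: C_def)
  \<comment> \<open>Chosen so that (d * card B * C + 1)^n \<le> (d+1)^n * d, which is less than
    (d+1)^(n+1).\<close>
  define d where "d = (card B * C + 1) ^ n"
  define X where "X = PiE B (\<lambda>_. {..d})"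
  \<comment> \<open>The monomial with exponents \<open>\<alpha>\<close>, times the same power
    \<open>q ^ (d * card B)\<close> of the common denominator for every
    \<open>\<alpha>\<close>.\<close>
  define R where "R = (\<lambda>\<alpha>. \<Prod>b\<in>B. P b ^ \<alpha> b * q' ^ (d - \<alpha> b))"
  have finX: "finite X" unfolding X_def by (intro finite_PiE) (use B in auto)
  have cX: "card X = (d + 1) ^ card B" using B by (simp add: X_def card_PiE)
  have bR: "boxed n (d * (card B * C)) (R \<alpha>)" if "\<alpha> \<in> X" for \<alpha>
  proof -
    have "boxed n (\<Sum>b\<in>B. \<alpha> b * C + (d - \<alpha> b) * C) (R \<alpha>)"
      unfolding R_def by (intro boxed_prod boxed_mult boxed_power bP bq B)
    moreover have "(\<Sum>b\<in>B. \<alpha> b * C + (d - \<alpha> b) * C) = (\<Sum>b\<in>B. d * C)"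
      by (rule sum.cong) (use that in \<open>auto simp: X_def PiE_def Pi_def simp flip: add_mult_distrib\<close>)
    ultimately show ?thesis by (simp add: mult_ac)
  qed
  have "(d * (card B * C) + 1) ^ n \<le> ((d + 1) * (card B * C + 1)) ^ n"
    by (rule power_mono) (auto simp: algebra_simps)
  also have "\<dots> = (d + 1) ^ n * d" by (simp only: power_mult_distrib d_def)
  also have "\<dots> < (d + 1) ^ (n + 1)" by simp
  also have "\<dots> \<le> (d + 1) ^ card B" by (rule power_increasing) (use cB in auto)
  finally have "(d * (card B * C) + 1) ^ n < card X" by (simp add: cX)
  from box_dependent[where r = R, OF finX bR this] obtain a where a: "\<exists>x\<in>X. a x \<noteq> 0" "(\<Sum>x\<in>X. cst (a x) * R x) = 0"
    by auto
  have RR: "of_mpoly (R \<alpha>) = q ^ (d * card B) * (\<Prod>b\<in>B. b ^ \<alpha> b)" if "\<alpha> \<in> X" for \<alpha>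
  proof -
    have "of_mpoly (R \<alpha>) = (\<Prod>b\<in>B. of_mpoly (P b) ^ \<alpha> b * q ^ (d - \<alpha> b))"
      by (simp add: R_def of_mpoly.hom_prod of_mpoly.hom_power q')
    also have "\<dots> = (\<Prod>b\<in>B. q ^ d * b ^ \<alpha> b)"
    proof (rule prod.cong)
      fix b assume b: "b \<in> B"
      then have le: "\<alpha> b \<le> d" using that by (auto simp: X_def)
      have "of_mpoly (P b) ^ \<alpha> b * q ^ (d - \<alpha> b) = q ^ (\<alpha> b + (d - \<alpha> b)) * b ^ \<alpha> b"
        unfolding P(1)[OF b, symmetric] power_mult_distrib power_add by (simp add: mult_ac)
      then show "of_mpoly (P b) ^ \<alpha> b * q ^ (d - \<alpha> b) = q ^ d * b ^ \<alpha> b" using le by simp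
    qed simp
    also have "\<dots> = q ^ (d * card B) * (\<Prod>b\<in>B. b ^ \<alpha> b)"
      by (simp add: prod.distrib power_mult)
    finally show ?thesis .
  qed
  have "0 = of_mpoly (\<Sum>x\<in>X. cst (a x) * R x)" by (simp add: a(2))
  also have "\<dots> = (\<Sum>x\<in>X. K (a x) * of_mpoly (R x))"
    by (simp add: K_def)
  also have "\<dots> = q ^ (d * card B) * (\<Sum>x\<in>X. K (a x) * (\<Prod>b\<in>B. b ^ x b))"
    unfolding sum_distrib_left by (rule sum.cong) (auto simp: RR mult_ac)
  finally have "(\<Sum>x\<in>X. K (a x) * (\<Prod>b\<in>B. b ^ x b)) = 0" using q by simp
  moreover have "X \<subseteq> PiE B (\<lambda>_. UNIV)" by (auto simp: X_def)
  ultimately have "K (a x) = 0" if "x \<in> X" for x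
    using alg_indep_monomials[OF ind B(2) finX, of "\<lambda>x. K (a x)" x] that
    by (auto simp: const_field_eq intro: range_eqI[of _ _ 0])
  with a(1) show False by auto
qed

text \<open>The bound on the cardinalities turns the supremum into a maximum; the empty set, which
  is independent, makes the family nonempty.\<close>

lemma trdeg_attained:
  assumes "\<And>B. B \<subseteq> A \<Longrightarrow> finite B \<Longrightarrow> alg_independent F B \<Longrightarrow> card B \<le> n"
  obtains B where "B \<subseteq> A" "finite B" "alg_independent F B" "trdeg F A = enat (card B)"
proof -
  let ?P = "\<lambda>B. B \<subseteq> A \<and> finite B \<and> alg_independent F B"
  have "?P {}"
  proof -
    have "p = 0" if "poly_vars p \<subseteq> {}" "eval_self p = 0" for p :: "('a, 'a) mpoly"
    proof -
      have "keys p \<subseteq> {0}"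
        using that(1) by (auto simp: poly_vars_def)
      then have "p = Poly_Mapping.single 0 (lookup p 0)"
        by (intro poly_mapping_eqI) (auto simp: lookup_single when_def in_keys_iff)
      then show ?thesis
        using that(2) by (metis eval_self_single mon_zero mult.right_neutral single_zero)
    qed
    then show ?thesis by (auto simp: alg_independent_def)
  qed
  then obtain B where B: "?P B" "\<forall>B'. ?P B' \<longrightarrow> card B' \<le> card B"
    using ex_has_greatest_nat[of ?P "{}" card "Suc n"] assms by (metis (no_types, lifting) le_imp_less_Suc)
  have "trdeg F A = enat (card B)"
    unfolding trdeg_def
    by (rule antisym) (use B in \<open>auto intro!: SUP_least SUP_upper2[of B]\<close>)
  with B that show ?thesis by blast
qed

section \<open>Leading monomials and complete integral closedness\<close>

text \<open>The order on exponents is lexicographic, the variable of smallest index deciding first,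
  and compatible with addition; for p \<noteq> 0 this is the leading monomial.\<close>

definition lm :: "(nat, 'a::zero) mpoly \<Rightarrow> (nat \<Rightarrow>\<^sub>0 nat)" where
  "lm p = Max (keys p)"

lemma lm_in_keys: "p \<noteq> 0 \<Longrightarrow> lm p \<in> keys p"
  unfolding lm_def by (rule Max_in) (auto simp: poly_mapping_eq_iff in_keys_iff fun_eq_iff)

lemma lm_ge: "m \<in> keys p \<Longrightarrow> m \<le> lm p"
  unfolding lm_def by (rule Max_ge) auto

lemma lm_eqI: "m \<in> keys p \<Longrightarrow> (\<And>m'. m' \<in> keys p \<Longrightarrow> m' \<le> m) \<Longrightarrow> lm p = m"
  unfolding lm_def by (rule Max_eqI) auto

lemma lookup_mult_lm:
  fixes p q :: "(nat, 'a::comm_ring_1) mpoly"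
  shows "lookup (p * q) (lm p + lm q) = lookup p (lm p) * lookup q (lm q)"
proof -
  define a where "a = Poly_Mapping.single (lm p) (lookup p (lm p))"
  define b where "b = Poly_Mapping.single (lm q) (lookup q (lm q))"
  have kp: "m < lm p" if "m \<in> keys (p - a)" for m
  proof -
    have "m \<noteq> lm p" "m \<in> keys p"
      using that by (auto simp: a_def in_keys_iff lookup_minus lookup_single when_def split: if_splits)
    then show ?thesis using lm_ge[of m p] by simp
  qed
  have kq: "m < lm q" if "m \<in> keys (q - b)" for m
  proof -
    have "m \<noteq> lm q" "m \<in> keys q"
      using that by (auto simp: b_def in_keys_iff lookup_minus lookup_single when_def split: if_splits)
    then show ?thesis using lm_ge[of m q] by simp
  qed
  have "lm p + lm q \<notin> keys (a * (q - b))"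
  proof
    assume "lm p + lm q \<in> keys (a * (q - b))"
    then obtain x y where "lm p + lm q = x + y" "x \<in> keys a" "y \<in> keys (q - b)"
      using keys_mult[of a "q - b"] by blast
    then show False using kq[of y] by (auto simp: a_def split: if_splits)
  qed
  moreover have "lm p + lm q \<notin> keys ((p - a) * q)"
  proof
    assume "lm p + lm q \<in> keys ((p - a) * q)"
    then obtain x y where "lm p + lm q = x + y" "x \<in> keys (p - a)" "y \<in> keys q"
      using keys_mult[of "p - a" q] by blast
    then show False using kp[of x] lm_ge[of y q] add_less_le_mono[of x "lm p" y "lm q"] by simp
  qed
  moreover have "p * q = a * b + a * (q - b) + (p - a) * q"
    by (simp add: algebra_simps)
  ultimately have "lookup (p * q) (lm p + lm q) = lookup (a * b) (lm p + lm q)"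
    by (simp add: lookup_add in_keys_iff)
  then show ?thesis by (simp add: a_def b_def mult_single)
qed

lemma lm_mult:
  fixes p q :: "(nat, 'a::idom) mpoly"
  assumes "p \<noteq> 0" "q \<noteq> 0"
  shows "lm (p * q) = lm p + lm q"
proof (rule lm_eqI)
  show "lm p + lm q \<in> keys (p * q)"
    using assms lm_in_keys[of p] lm_in_keys[of q] by (simp add: in_keys_iff lookup_mult_lm)
  fix m assume "m \<in> keys (p * q)"
  then obtain x y where "m = x + y" "x \<in> keys p" "y \<in> keys q"
    using keys_mult[of p q] by blast
  then show "m \<le> lm p + lm q" by (auto intro: add_mono lm_ge)
qed

lemma lm_power:
  fixes p :: "(nat, 'a::idom) mpoly"
  assumes "p \<noteq> 0"
  shows "lookup (lm (p ^ e)) v = e * lookup (lm p) v"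
proof (induction e)
  case 0
  have "lm (1 :: (nat, 'a) mpoly) = 0" by (rule lm_eqI) auto
  then show ?case by simp
next
  case (Suc e)
  then show ?case using assms by (simp add: lm_mult lookup_add)
qed

text \<open>With infinitely many variables the order has descending chains x_0 > x_1 > x_2 > ...; on
  monomials in \<open>n\<close> variables it embeds into the well-founded \<open>lex\<close> and can
  serve as a termination measure.\<close>

lemma mono_less_lex:
  assumes "m < m'" "keys m \<subseteq> {..<n}" "keys m' \<subseteq> {..<n}"
  shows "(map (lookup m) [0..<n], map (lookup m') [0..<n]) \<in> lex less_than"
proof -
  from assms(1) obtain k where k: "lookup m k < lookup m' k"
    "\<And>i. i < k \<Longrightarrow> lookup m i = lookup m' i"
    by (auto simp: less_poly_mapping.rep_eq less_fun_def)
  have kn: "k < n" using k(1) assms(3) by (auto simp: in_keys_iff subset_eq)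
  have sp: "map f [0..<n] = map f [0..<k] @ f k # map f [Suc k..<n]" for f :: "nat \<Rightarrow> nat"
    using kn upt_add_eq_append[of 0 k "n - k"] upt_conv_Cons[of k n] by simp
  have eq: "map (lookup m) [0..<k] = map (lookup m') [0..<k]"
    using k(2) by simp
  show ?thesis
    unfolding sp[of "lookup m"] sp[of "lookup m'"] eq
    by (intro lex_append_leftI) (use k(1) in simp)
qed

lemma poly_vars_diff:
  fixes p q :: "('v, 'a::ab_group_add) mpoly"
  shows "poly_vars (p - q) \<subseteq> poly_vars p \<union> poly_vars q"
proof
  fix i assume "i \<in> poly_vars (p - q)"
  then obtain m where m: "m \<in> keys (p - q)" "i \<in> keys m"
    by (auto simp: poly_vars_def)
  then have "m \<in> keys p \<or> m \<in> keys q"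
    by (auto simp: in_keys_iff lookup_minus)
  then show "i \<in> poly_vars p \<union> poly_vars q"
    using m(2) by (auto simp: poly_vars_def)
qed

text \<open>Division by leading monomials takes the place of unique factorisation: D p^i = r q^i for
  all i forces the leading monomial of q to divide that of p. The quotient \<open>s\<close> of the
  leading terms is a polynomial, p/q - s satisfies the same hypothesis, and its numerator is 0 or
  has a smaller leading monomial.\<close>

lemma poly_ring_completely_closed:
  fixes p q D :: "(nat, 'a::field) mpoly"
  assumes "q \<noteq> 0" "D \<noteq> 0" "poly_vars p \<subseteq> {..<n}" "poly_vars q \<subseteq> {..<n}" "poly_vars D \<subseteq> {..<n}"
    and "\<And>i. of_mpoly D * (of_mpoly p / of_mpoly q) ^ i \<in> poly_ring n"
  shows "of_mpoly p / of_mpoly q \<in> poly_ring n"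
proof -
  define \<mu> where "\<mu> = (\<lambda>p :: (nat, 'a) mpoly. map (lookup (lm p)) [0..<n])"
  have wf: "wf (inv_image (lex less_than) \<mu>)" by (intro wf_inv_image wf_lex wf_less_than)
  show ?thesis
    using wf assms(3,6)
  proof (induction p rule: wf_induct_rule)
    case (less p)
    show ?case
    proof (cases "p = 0")
      case True
      then show ?thesis by (simp add: poly_ring_closed)
    next
      case False
      have le: "lookup (lm q) v \<le> lookup (lm p) v" for v
      proof (rule ccontr)
        assume *: "\<not> ?thesis"
        \<comment> \<open>If q exceeded p in the exponent of \<open>v\<close>, then D would have to
          supply \<open>i\<close> missing units of it; \<open>i\<close> is one more than its leading
          monomial has.\<close>
        define i where "i = Suc (lookup (lm D) v)"
        obtain r where r: "of_mpoly D * (of_mpoly p / of_mpoly q) ^ i = of_mpoly r"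
          using less.prems(2)[of i] by (auto simp: poly_ring_def)
        then have "of_mpoly D * of_mpoly p ^ i = of_mpoly r * of_mpoly q ^ i"
          using assms(1) by (simp add: power_divide field_simps)
        then have eq: "D * p ^ i = r * q ^ i"
          by (simp flip: of_mpoly.hom_power of_mpoly.hom_mult)
        then have "r \<noteq> 0" using False assms(2) by auto
        from arg_cong[OF eq, of "\<lambda>p. lookup (lm p) v"]
        have "lookup (lm D) v + i * lookup (lm p) v =
          lookup (lm r) v + i * lookup (lm q) v"
          using False assms(1,2) \<open>r \<noteq> 0\<close> by (simp add: lm_mult lookup_add lm_power)
        moreover have "i * lookup (lm p) v + i \<le> i * lookup (lm q) v"
          using * by (metis add.commute mult_Suc_right mult_le_mono2 not_less_eq_eq)
        ultimately show False by (simp add: i_def)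
      qed
      define t where "t = lm p - lm q"
      have t: "lm p = t + lm q"
        by (rule poly_mapping_eqI) (use le in \<open>simp add: t_def lookup_add lookup_minus\<close>)
      define s where "s = Poly_Mapping.single t (lookup p (lm p) / lookup q (lm q))"
      have lp: "keys (lm p) \<subseteq> {..<n}"
        using less.prems(1) lm_in_keys[OF False] by (auto simp: poly_vars_def)
      have "keys t \<subseteq> {..<n}"
        using lp by (auto simp: t in_keys_iff lookup_add subset_eq)
      then have vs: "poly_vars s \<subseteq> {..<n}"
        by (auto simp: s_def poly_vars_def split: if_splits)
      then have ps: "of_mpoly s \<in> poly_ring n" by (auto simp: poly_ring_def)
      have lq: "lookup q (lm q) \<noteq> 0" using lm_in_keys[OF assms(1)] by (simp add: in_keys_iff)
      have lpn: "lookup p (lm p) \<noteq> 0" using lm_in_keys[OF False] by (simp add: in_keys_iff)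
      have "lookup s t \<noteq> 0" using lq lpn by (simp add: s_def)
      then have sn: "s \<noteq> 0" by auto
      have lms: "lm s = t"
        by (rule lm_eqI) (use lq lpn in \<open>auto simp: s_def split: if_splits\<close>)
      have lmsq: "lm (s * q) = lm p"
        using sn assms(1) by (simp add: lm_mult lms t)
      have lst: "lookup s t = lookup p (lm p) / lookup q (lm q)"
        by (simp add: s_def)
      have "lookup (s * q) (lm s + lm q) = lookup s (lm s) * lookup q (lm q)"
        by (rule lookup_mult_lm)
      then have c: "lookup (s * q) (lm p) = lookup p (lm p)"
        using lq unfolding lms t[symmetric] by (simp add: lst)
      define p' where "p' = p - s * q"
      have vp': "poly_vars p' \<subseteq> {..<n}"
        using poly_vars_diff[of p "s * q"] poly_vars_mult[of s q] less.prems(1) vs assms(4)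
        unfolding p'_def by blast
      have y: "of_mpoly p' / of_mpoly q = of_mpoly p / of_mpoly q - of_mpoly s"
        using assms(1) by (simp add: p'_def field_simps)
      have "of_mpoly p' / of_mpoly q \<in> poly_ring n"
      proof (cases "p' = 0")
        case True
        then show ?thesis by (simp add: poly_ring_closed)
      next
        case p'0: False
        have "lm p' \<in> keys p \<union> keys (s * q)"
          using lm_in_keys[OF p'0] keys_diff by (auto simp: p'_def in_keys_iff lookup_minus)
        then have "lm p' \<le> lm p" using lm_ge[of "lm p'" p] lm_ge[of "lm p'" "s * q"] lmsq by auto
        moreover have "lm p' \<noteq> lm p"
          using lm_in_keys[OF p'0] c by (auto simp: p'_def in_keys_iff lookup_minus)
        ultimately have "lm p' < lm p" by simp
        moreover have "keys (lm p') \<subseteq> {..<n}"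
          using vp' lm_in_keys[OF p'0] by (auto simp: poly_vars_def)
        ultimately have "(p', p) \<in> inv_image (lex less_than) \<mu>"
          using lp by (auto simp: \<mu>_def intro: mono_less_lex)
        moreover have "of_mpoly D * (of_mpoly p' / of_mpoly q) ^ i \<in> poly_ring n" for i
        proof -
          have "(of_mpoly p' / of_mpoly q) ^ i = (of_mpoly p / of_mpoly q + - of_mpoly s) ^ i"
            by (simp add: y)
          also have "of_mpoly D * \<dots> = (\<Sum>k\<le>i. of_nat (i choose k) * (of_mpoly D * (of_mpoly p / of_mpoly q) ^ k) * (- of_mpoly s) ^ (i - k))"
            unfolding binomial_ring sum_distrib_left by (simp add: mult_ac)
          also have "\<dots> \<in> poly_ring n"
            by (intro poly_ring_closed less.prems ps)
          finally show ?thesis .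
        qed
        ultimately show ?thesis using less.IH vp' by blast
      qed
      then have "of_mpoly p' / of_mpoly q + of_mpoly s \<in> poly_ring n" using ps by (rule poly_ring_closed)
      then show ?thesis by (simp add: y)
    qed
  qed
qed

definition coeffs_in :: "'b::zero set \<Rightarrow> 'b poly set" where
  "coeffs_in A = {f. \<forall>i. coeff f i \<in> A}"

lemma coeffs_inD: "f \<in> coeffs_in A \<Longrightarrow> coeff f i \<in> A"
  by (simp add: coeffs_in_def)

text \<open>A monic equation of degree d reduces all powers of y to the first d, so b^d is a common
  denominator of all powers of y = a / b, and complete closedness applies.\<close>

lemma poly_ring_integrally_closed:
  fixes f :: "'a::field ratfun poly"
  assumes y: "y \<in> rat_field n" and f: "f \<in> coeffs_in (poly_ring n)" "lead_coeff f = 1" "poly f y = 0"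
  shows "y \<in> poly_ring n"
proof -
  obtain a b where ab: "y = a / b" "a \<in> poly_ring n" "b \<in> poly_ring n" "b \<noteq> 0"
    using y by (auto simp: rat_field_def frac_field_def)
  define d where "d = degree f"
  have yd: "y ^ d = - (\<Sum>j<d. coeff f j * y ^ j)"
  proof -
    have "poly f y = (\<Sum>j<d. coeff f j * y ^ j) + y ^ d"
      using f(2) unfolding poly_altdef d_def by (simp add: lessThan_Suc_atMost[symmetric])
    then show ?thesis using f(3) by (simp add: eq_neg_iff_add_eq_0 add.commute)
  qed
  have pw: "b ^ d * y ^ i \<in> poly_ring n" for i
  proof (induction i rule: less_induct)
    case (less i)
    show ?case
    proof (cases "i < d")
      case True
      then have "b ^ d = b ^ (d - i) * b ^ i" by (simp flip: power_add)
      then have "b ^ d * y ^ i = b ^ (d - i) * a ^ i" using ab by (simp add: power_divide)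
      then show ?thesis using ab by (simp add: poly_ring_closed)
    next
      case False
      then have "b ^ d * y ^ i = b ^ d * (y ^ (i - d) * y ^ d)" by (simp flip: power_add)
      also have "\<dots> = - (\<Sum>j<d. coeff f j * (b ^ d * y ^ (i - d + j)))"
        by (simp add: yd sum_distrib_left power_add mult_ac)
      also have "\<dots> \<in> poly_ring n"
        using f(1) False by (intro poly_ring_closed less) (auto dest: coeffs_inD)
      finally show ?thesis .
    qed
  qed
  obtain p where p: "a = of_mpoly p" "poly_vars p \<subseteq> {..<n}" using ab(2) by (auto simp: poly_ring_def)
  obtain q where q: "b = of_mpoly q" "poly_vars q \<subseteq> {..<n}" using ab(3) by (auto simp: poly_ring_def)
  have "b ^ d \<in> poly_ring n" using ab by (simp add: poly_ring_closed)
  then obtain D where D: "b ^ d = of_mpoly D" "poly_vars D \<subseteq> {..<n}" by (auto simp: poly_ring_def)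
  have "D \<noteq> 0" using D(1) ab(4) by auto
  with poly_ring_completely_closed[of q D p n] show ?thesis
    using ab pw p q D by auto
qed

section \<open>Minimal fields\<close>

lemma is_subring_coeffs_in:
  assumes "is_subring A"
  shows "0 \<in> coeffs_in A" "1 \<in> coeffs_in A" "f \<in> coeffs_in A \<Longrightarrow> g \<in> coeffs_in A \<Longrightarrow> f + g \<in> coeffs_in A"
    "f \<in> coeffs_in A \<Longrightarrow> g \<in> coeffs_in A \<Longrightarrow> f - g \<in> coeffs_in A"
    "f \<in> coeffs_in A \<Longrightarrow> g \<in> coeffs_in A \<Longrightarrow> f * g \<in> coeffs_in A"
    "f \<in> coeffs_in A \<Longrightarrow> f ^ e \<in> coeffs_in A"
    "a \<in> A \<Longrightarrow> monom a i \<in> coeffs_in A" "a \<in> A \<Longrightarrow> f \<in> coeffs_in A \<Longrightarrow> smult a f \<in> coeffs_in A"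
    "a \<in> A \<Longrightarrow> f \<in> coeffs_in A \<Longrightarrow> pCons a f \<in> coeffs_in A"
proof -
  note * = is_subringD[OF assms]
  show m: "f * g \<in> coeffs_in A" if "f \<in> coeffs_in A" "g \<in> coeffs_in A" for f g
    using that by (auto simp: coeffs_in_def coeff_mult intro!: *)
  show one: "1 \<in> coeffs_in A"
    by (auto simp: coeffs_in_def coeff_pCons one_pCons split: nat.split intro: *)
  show "f ^ e \<in> coeffs_in A" if "f \<in> coeffs_in A"
    by (induction e) (auto intro: m one that)
qed (auto simp: coeffs_in_def coeff_pCons split: nat.split intro: is_subringD[OF assms])

text \<open>By minimality, a largest independent set \<open>B\<close> in A is also a largest one in
  M. So every m in M outside \<open>B\<close> is a root of a nonzero polynomial over k[B], a part of
  A. With its leading coefficient a, the element a m is integral over k[x] and lies in M, hence in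
  A; and m = (a m) / a.\<close>

lemma minimal_frac_field:
  fixes M :: "'a::field ratfun set"
  assumes M: "is_subfield M" "const_field \<subseteq> M" "M \<subseteq> rat_field n" and min: "minimal_field n M"
  shows "frac_field (M \<inter> poly_ring n) = M"
proof
  let ?A = "M \<inter> poly_ring n"
  have A: "is_subring ?A" using M is_subring_poly_ring by (intro is_subring_Int) (auto intro: is_subfieldD)
  note Ac = is_subringD[OF A]
  show "frac_field ?A \<subseteq> M" using M by (intro frac_field_subset) auto
  obtain B where B: "B \<subseteq> ?A" "finite B" "alg_independent const_field B" "trdeg const_field ?A = enat (card B)"
    using trdeg_attained[of ?A const_field n] card_alg_independent_le[of _ n] M(3)
    by (metis (no_types, lifting) inf.coboundedI1 subset_trans)
  have cA: "K c \<in> ?A" for c using M(2) by (auto simp: const_field_eq)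
  show "M \<subseteq> frac_field ?A"
  proof
    fix m assume m: "m \<in> M"
    show "m \<in> frac_field ?A"
    proof (cases "m \<in> B")
      case True
      then show ?thesis using B subset_frac_field[OF A] by blast
    next
      case False
      have "\<not> alg_independent const_field (insert m B)"
      proof
        assume "alg_independent const_field (insert m B)"
        then have "enat (card (insert m B)) \<le> trdeg const_field M"
          unfolding trdeg_def using B m by (intro SUP_upper) auto
        moreover have "trdeg const_field M = enat (card B)" using min B(4) by (simp add: minimal_field_def)
        ultimately show False using B(2) False by simp
      qed
      then obtain p where p: "range (lookup p) \<subseteq> const_field" "poly_vars p \<subseteq> insert m B" "eval_self p = 0" "p \<noteq> 0"
        by (auto simp: alg_independent_def)
      \<comment> \<open>The monomial with its power of \<open>m\<close> removed: this regroups the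
        relation \<open>p\<close> as a polynomial in \<open>m\<close> with coefficients in
        k[B].\<close>
      define dr where "dr = (\<lambda>\<mu> :: 'a ratfun \<Rightarrow>\<^sub>0 nat. \<mu> - Poly_Mapping.single m (lookup \<mu> m))"
      have dr: "\<mu> = dr \<mu> + Poly_Mapping.single m (lookup \<mu> m)" for \<mu>
        by (rule poly_mapping_eqI) (auto simp: dr_def lookup_add lookup_minus lookup_single when_def)
      have kdr: "keys (dr \<mu>) \<subseteq> B" if "\<mu> \<in> keys p" for \<mu>
      proof -
        have "keys \<mu> \<subseteq> insert m B" using that p(2) by (auto simp: poly_vars_def)
        then show ?thesis
          by (auto simp: dr_def subset_iff in_keys_iff lookup_minus lookup_single when_def split: if_splits)
      qed
      define f where "f = (\<Sum>\<mu>\<in>keys p. monom (lookup p \<mu> * mon (\<lambda>x. x) (dr \<mu>)) (lookup \<mu> m))"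
      have "poly f m = eval_self p"
      proof -
        have md: "mon (\<lambda>x. x) (dr \<mu>) * m ^ lookup \<mu> m = mon (\<lambda>x. x) \<mu>" for \<mu>
          using arg_cong[OF dr[of \<mu>], of "mon (\<lambda>x. x)"] by (simp only: mon_add mon_single)
        have "poly f m = (\<Sum>\<mu>\<in>keys p. lookup p \<mu> * (mon (\<lambda>x. x) (dr \<mu>) * m ^ lookup \<mu> m))"
          by (simp add: f_def poly_sum poly_monom mult.assoc)
        then show ?thesis by (simp only: md eval_self_ev ev_def)
      qed
      with p have fm: "poly f m = 0" by simp
      \<comment> \<open>The coefficient of m^j, kept as a formal polynomial: if it is nonzero, it
        cannot evaluate to 0 since \<open>B\<close> is independent, and so \<open>f\<close> is
        nonzero.\<close>
      define P where "P = (\<lambda>j. \<Sum>\<mu>\<in>{\<mu>\<in>keys p. lookup \<mu> m = j}. Poly_Mapping.single (dr \<mu>) (lookup p \<mu>))"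
      have cf: "coeff f j = eval_self (P j)" for j
        unfolding f_def P_def eval_self.hom_sum coeff_sum sum.inter_filter[OF finite_keys]
        by (rule sum.cong) (simp_all add: eval_self_single)
      have injdr: "\<mu> = \<nu>" if "dr \<mu> = dr \<nu>" "lookup \<mu> m = lookup \<nu> m" for \<mu> \<nu>
        using dr[of \<mu>] dr[of \<nu>] that by metis
      have lP: "lookup (P j) (dr \<mu>) = lookup p \<mu>" if "lookup \<mu> m = j" for \<mu> j
      proof -
        have "lookup (P j) (dr \<mu>) = (\<Sum>\<nu>\<in>{\<nu>\<in>keys p. lookup \<nu> m = j}. if \<nu> = \<mu> then lookup p \<nu> else 0)"
          unfolding P_def lookup_sum by (rule sum.cong) (use injdr that in \<open>auto simp: lookup_single when_def\<close>)
        then show ?thesis using that by (auto simp: in_keys_iff)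
      qed
      have lP0: "lookup (P j) \<kappa> = 0 \<or> (\<exists>\<mu>\<in>keys p. \<kappa> = dr \<mu> \<and> lookup \<mu> m = j)" for j \<kappa>
        unfolding P_def lookup_sum by (rule disjCI, rule sum.neutral) (auto simp: lookup_single when_def)
      have "f \<noteq> 0"
      proof
        assume "f = 0"
        obtain \<mu> where \<mu>: "\<mu> \<in> keys p" using p(4) keys_eq_empty by blast
        define j where "j = lookup \<mu> m"
        have "range (lookup (P j)) \<subseteq> const_field"
        proof safe
          fix \<kappa> show "lookup (P j) \<kappa> \<in> const_field"
            using lP0[of j \<kappa>] lP p(1) by (auto simp: const_field_eq intro: range_eqI[of _ _ 0])
        qed
        moreover have "poly_vars (P j) \<subseteq> B"
          using lP0[of j] kdr by (fastforce simp: poly_vars_def in_keys_iff)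
        moreover have "eval_self (P j) = 0" using cf[of j] \<open>f = 0\<close> by simp
        ultimately have "P j = 0" using B(3) by (auto simp: alg_independent_def)
        then have "lookup p \<mu> = 0" using lP[of \<mu> j] by (simp add: j_def)
        then show False using \<mu> by (simp add: in_keys_iff)
      qed
      have fA: "coeff f j \<in> ?A" for j
        unfolding cf eval_self_ev ev_def mon_def
      proof (intro Ac)
        fix \<mu> assume \<mu>: "\<mu> \<in> keys (P j)"
        have "lookup (P j) \<mu> \<in> const_field"
            using lP0[of j \<mu>] lP p(1) by (auto simp: const_field_eq intro: range_eqI[of _ _ 0])
        then show "lookup (P j) \<mu> \<in> ?A" using cA by (auto simp: const_field_eq)
        fix b assume "b \<in> keys \<mu>"
        moreover obtain \<mu>' where "\<mu>' \<in> keys p" "\<mu> = dr \<mu>'"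
          using lP0[of j \<mu>] \<mu> by (auto simp: in_keys_iff)
        ultimately have "b \<in> B" using kdr by blast
        then show "b \<in> ?A" using B by auto
      qed
      define d where "d = degree f"
      define a where "a = lead_coeff f"
      have a: "a \<noteq> 0" "a \<in> ?A" using \<open>f \<noteq> 0\<close> fA by (auto simp: a_def)
      have d: "d > 0"
      proof (rule ccontr)
        assume "\<not> d > 0"
        then obtain c where "f = [:c:]" by (auto simp: d_def elim: degree_eq_zeroE)
        then show False using fm \<open>f \<noteq> 0\<close> by simp
      qed
      \<comment> \<open>The monic polynomial a^(d-1) f(T/a), which has the root a m.\<close>
      define g where "g = monom 1 d + (\<Sum>j<d. monom (coeff f j * a ^ (d - 1 - j)) j)"
      have cg: "coeff g i = (if i = d then 1 else if i < d then coeff f i * a ^ (d - 1 - i) else 0)" for i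
        by (auto simp: g_def coeff_sum)
      have "degree g = d"
        by (rule antisym, rule degree_le, simp add: cg, rule le_degree, simp add: cg)
      moreover have "g \<in> coeffs_in (poly_ring n)"
        using fA a by (auto simp: coeffs_in_def cg intro!: poly_ring_closed)
      moreover have "poly g (a * m) = a ^ (d - 1) * poly f m"
      proof -
        have t: "a ^ (d - Suc j) * (a * m) ^ j = a ^ (d - 1) * m ^ j" if "j < d" for j
        proof -
          have "a ^ (d - Suc j) * (a * m) ^ j = a ^ (d - Suc j + j) * m ^ j"
            by (simp add: power_mult_distrib power_add)
          also have "d - Suc j + j = d - 1" using that by simp
          finally show ?thesis .
        qed
        have "poly g (a * m) = (a * m) ^ d + (\<Sum>j<d. coeff f j * a ^ (d - Suc j) * (a * m) ^ j)"
          by (simp add: g_def poly_sum poly_monom)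
        also have "\<dots> = a ^ (d - 1) * (a * m ^ d) + (\<Sum>j<d. coeff f j * (a ^ (d - 1) * m ^ j))"
        proof -
          obtain e where "d = Suc e" using d by (cases d) auto
          then have "(a * m) ^ d = a ^ (d - 1) * (a * m ^ d)" by (simp add: power_mult_distrib mult_ac)
          then show ?thesis by (simp add: t mult.assoc)
        qed
        also have "\<dots> = a ^ (d - 1) * poly f m"
          unfolding poly_altdef by (simp add: lessThan_Suc_atMost[symmetric] d_def a_def sum_distrib_left algebra_simps)
        finally show ?thesis .
      qed
      moreover have "a * m \<in> M" using a m M by (auto intro: is_subringD is_subfieldD)
      ultimately have "a * m \<in> poly_ring n"
        using fm M(3) by (intro poly_ring_integrally_closed[of _ n g]) (auto simp: cg)
      then have "a * m \<in> ?A" using \<open>a * m \<in> M\<close> by simp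
      moreover have "m = (a * m) / a" using a by simp
      ultimately show ?thesis unfolding frac_field_def using a by blast
    qed
  qed
qed

section \<open>Polynomials with coefficients in a subring or subfield\<close>

lemma coeffs_in_mono: "A \<subseteq> B \<Longrightarrow> coeffs_in A \<subseteq> coeffs_in B"
  by (auto simp: coeffs_in_def)

lemma poly_in_subring:
  assumes "is_subring A" "f \<in> coeffs_in A" "a \<in> A"
  shows "poly f a \<in> A"
  unfolding poly_altdef using assms by (auto intro!: is_subringD dest: coeffs_inD)

text \<open>Only the leading coefficient of the divisor has to be invertible in the subring, so this
  serves subfields, the polynomial ring and local rings alike.\<close>

lemma coeffs_in_division:
  fixes f g :: "'b::field poly"
  assumes A: "is_subring A" and g: "g \<in> coeffs_in A" "inverse (lead_coeff g) \<in> A" "g \<noteq> 0"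
    and f: "f \<in> coeffs_in A"
  shows "\<exists>q r. q \<in> coeffs_in A \<and> r \<in> coeffs_in A \<and> f = q * g + r \<and> (r = 0 \<or> degree r < degree g)"
  using f
proof (induction "degree f" arbitrary: f rule: less_induct)
  case less
  note c = is_subring_coeffs_in[OF A]
  show ?case
  proof (cases "f = 0 \<or> degree f < degree g")
    case True
    then show ?thesis using less.prems c(1) by (intro exI[of _ 0] exI[of _ f]) auto
  next
    case False
    define t where "t = monom (lead_coeff f * inverse (lead_coeff g)) (degree f - degree g)"
    have t: "t \<in> coeffs_in A" unfolding t_def by (intro c is_subringD[OF A] coeffs_inD[OF less.prems] g)
    have tn: "t \<noteq> 0" "lead_coeff t = lead_coeff f * inverse (lead_coeff g)" "degree t = degree f - degree g"
      using False g by (auto simp: t_def degree_monom_eq)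
    have dt: "degree (t * g) = degree f"
      using False tn g by (simp add: degree_mult_eq)
    have lt: "lead_coeff (t * g) = lead_coeff f" unfolding lead_coeff_mult tn(2) using g by simp
    define f' where "f' = f - t * g"
    have f': "f' \<in> coeffs_in A" unfolding f'_def by (intro c t g less.prems)
    have "f' = 0 \<or> degree f' < degree f"
    proof (rule disjCI)
      assume n: "\<not> degree f' < degree f"
      have "degree f' \<le> degree f" unfolding f'_def using dt by (intro degree_diff_le) auto
      then have d: "degree f' = degree f" using n by simp
      have "coeff f' (degree f) = 0" using lt by (simp add: f'_def dt)
      then show "f' = 0" by (metis d leading_coeff_0_iff)
    qed
    then show ?thesis
    proof
      assume "f' = 0"
      then show ?thesis using t c(1) by (intro exI[of _ t] exI[of _ 0]) (auto simp: f'_def)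
    next
      assume "degree f' < degree f"
      from less.hyps[OF this f'] obtain q r where
        "q \<in> coeffs_in A" "r \<in> coeffs_in A" "f' = q * g + r" "r = 0 \<or> degree r < degree g" by blast
      then show ?thesis
        by (intro exI[of _ "q + t"] exI[of _ r]) (auto simp: f'_def algebra_simps intro: c t)
    qed
  qed
qed

text \<open>Division with remainder is unique over the whole field, so the quotient there is the one
  computed inside the subring.\<close>

lemma coeffs_in_divisor:
  fixes f g :: "'b::field poly"
  assumes A: "is_subring A" and g: "g \<in> coeffs_in A" "inverse (lead_coeff g) \<in> A" "g \<noteq> 0"
    and f: "q * g \<in> coeffs_in A"
  shows "q \<in> coeffs_in A"
proof -
  obtain q' r where *: "q' \<in> coeffs_in A" "q * g = q' * g + r" "r = 0 \<or> degree r < degree g"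
    using coeffs_in_division[OF A g f] by blast
  have "r = (q - q') * g" using *(2) by (simp add: algebra_simps)
  then have "q - q' = 0"
    using *(3) g(3) by (metis degree_mult_right_le linorder_not_le mult.commute mult_eq_0_iff)
  then show ?thesis using * by simp
qed

lemma coeffs_in_ideal_principal:
  fixes I :: "'b::field poly set"
  assumes L: "is_subfield L" and I: "I \<subseteq> coeffs_in L"
    and add: "\<And>f g. f \<in> I \<Longrightarrow> g \<in> I \<Longrightarrow> f + g \<in> I"
    and mult: "\<And>f q. f \<in> I \<Longrightarrow> q \<in> coeffs_in L \<Longrightarrow> q * f \<in> I"
    and nz: "f0 \<in> I" "f0 \<noteq> 0"
  obtains d where "d \<in> I" "lead_coeff d = 1" "\<And>f. f \<in> I \<Longrightarrow> \<exists>q\<in>coeffs_in L. f = q * d"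
proof -
  have A: "is_subring L" using L by (rule is_subfieldD)
  note c = is_subring_coeffs_in[OF A]
  obtain d0 where d0: "d0 \<in> I" "d0 \<noteq> 0" "\<And>f. f \<in> I \<Longrightarrow> f \<noteq> 0 \<Longrightarrow> degree d0 \<le> degree f"
    using ex_has_least_nat[of "\<lambda>f. f \<in> I \<and> f \<noteq> 0" f0 degree] nz by blast
  define d where "d = [:inverse (lead_coeff d0):] * d0"
  have u: "[:inverse (lead_coeff d0):] \<in> coeffs_in L"
    using d0(1) I by (intro c is_subfieldD[OF L]) (auto dest: coeffs_inD)
  have d: "d \<in> I" unfolding d_def by (intro mult d0 u)
  have dd: "lead_coeff d = 1" "degree d = degree d0" "d \<noteq> 0"
    using d0(2) by (auto simp: d_def)
  have "\<exists>q\<in>coeffs_in L. f = q * d" if f: "f \<in> I" for f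
  proof -
    obtain q r where qr: "q \<in> coeffs_in L" "r \<in> coeffs_in L" "f = q * d + r" "r = 0 \<or> degree r < degree d"
      using coeffs_in_division[OF A, of d f] d f I dd is_subringD(2)[OF A] by auto
    have "f + (- q) * d \<in> I"
      using c(4)[OF c(1) qr(1)] by (intro add mult f d) simp
    moreover have "r = f + (- q) * d" using qr(3) by simp
    ultimately have "r = 0" using qr(4) d0(3)[of r] dd by fastforce
    then show ?thesis using qr by auto
  qed
  with d dd that show ?thesis by blast
qed

lemma coeffs_in_bezout:
  fixes f g :: "'b::field poly"
  assumes L: "is_subfield L" and fg: "f \<in> coeffs_in L" "g \<in> coeffs_in L" "g \<noteq> 0"
  obtains d u v s t where "lead_coeff d = 1" "d = u * f + v * g" "f = s * d" "g = t * d"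
    "d \<in> coeffs_in L" "u \<in> coeffs_in L" "v \<in> coeffs_in L" "s \<in> coeffs_in L" "t \<in> coeffs_in L"
proof -
  have A: "is_subring L" using L by (rule is_subfieldD)
  note c = is_subring_coeffs_in[OF A]
  define I where "I = {u * f + v * g | u v. u \<in> coeffs_in L \<and> v \<in> coeffs_in L}"
  have I: "u * f + v * g \<in> I" if "u \<in> coeffs_in L" "v \<in> coeffs_in L" for u v
    using that by (auto simp: I_def)
  have fI: "f \<in> I" "g \<in> I" using I[OF c(2,1)] I[OF c(1,2)] by simp_all
  obtain d where d: "d \<in> I" "lead_coeff d = 1" "\<And>f. f \<in> I \<Longrightarrow> \<exists>q\<in>coeffs_in L. f = q * d"
  proof (rule coeffs_in_ideal_principal[OF L, of I g])
    show "I \<subseteq> coeffs_in L" unfolding I_def using fg by (auto intro: c)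
    show "x + y \<in> I" if "x \<in> I" "y \<in> I" for x y
    proof -
      from that obtain u v u' v' where *: "x = u * f + v * g" "y = u' * f + v' * g"
        "u \<in> coeffs_in L" "v \<in> coeffs_in L" "u' \<in> coeffs_in L" "v' \<in> coeffs_in L" by (auto simp: I_def)
      have "x + y = (u + u') * f + (v + v') * g" by (simp add: * algebra_simps)
      then show ?thesis using I * c(3) by metis
    qed
    show "q * x \<in> I" if "x \<in> I" "q \<in> coeffs_in L" for x q
    proof -
      from that obtain u v where *: "x = u * f + v * g" "u \<in> coeffs_in L" "v \<in> coeffs_in L" by (auto simp: I_def)
      have "q * x = (q * u) * f + (q * v) * g" by (simp add: * algebra_simps)
      then show ?thesis using I * c(5) that(2) by metis
    qed
  qed (use fI fg in auto)
  then obtain u v where "d = u * f + v * g" "u \<in> coeffs_in L" "v \<in> coeffs_in L" by (auto simp: I_def)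
  moreover have "d \<in> coeffs_in L" using calculation fg by (auto intro: c)
  ultimately show ?thesis using d(2) d(3)[OF fI(1)] d(3)[OF fI(2)] that by blast
qed

lemma adjoin_eq:
  assumes L: "is_subfield L"
  shows "adjoin L a = {poly f a / poly g a | f g. f \<in> coeffs_in L \<and> g \<in> coeffs_in L \<and> poly g a \<noteq> 0}" (is "_ = ?R")
proof
  have A: "is_subring L" using L by (rule is_subfieldD)
  note c = is_subring_coeffs_in[OF A]
  have R: "?R = frac_field {poly f a | f. f \<in> coeffs_in L}"
    unfolding frac_field_def by blast
  have pI: "poly f a \<in> {poly f a | f. f \<in> coeffs_in L}" if "f \<in> coeffs_in L" for f
    using that by blast
  have "is_subring {poly f a | f. f \<in> coeffs_in L}"
    unfolding is_subring_def
  proof (intro conjI ballI)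
    show "0 \<in> {poly f a | f. f \<in> coeffs_in L}" using pI[OF c(1)] by simp
    show "1 \<in> {poly f a | f. f \<in> coeffs_in L}" using pI[OF c(2)] by simp
    fix x assume "x \<in> {poly f a | f. f \<in> coeffs_in L}"
    then obtain f where f: "x = poly f a" "f \<in> coeffs_in L" by blast
    show "- x \<in> {poly f a | f. f \<in> coeffs_in L}" using pI[OF c(4)[OF c(1) f(2)]] f by simp
    fix y assume "y \<in> {poly f a | f. f \<in> coeffs_in L}"
    then obtain g where g: "y = poly g a" "g \<in> coeffs_in L" by blast
    show "x + y \<in> {poly f a | f. f \<in> coeffs_in L}" using pI[OF c(3)[OF f(2) g(2)]] f g by simp
    show "x * y \<in> {poly f a | f. f \<in> coeffs_in L}" using pI[OF c(5)[OF f(2) g(2)]] f g by simp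
  qed
  then have sf: "is_subfield ?R" and sub: "{poly f a | f. f \<in> coeffs_in L} \<subseteq> ?R"
    unfolding R by (fact is_subfield_frac_field, fact subset_frac_field)
  have mem: "x \<in> {poly f a | f. f \<in> coeffs_in L}" if "x \<in> insert a L" for x
  proof (cases "x = a")
    case True
    from pI[OF c(7)[OF is_subringD(2)[OF A], of 1]] show ?thesis
      unfolding True poly_monom mult_1 power_one_right .
  next
    case False
    then have "x \<in> L" using that by simp
    from pI[OF c(7)[OF this, of 0]] show ?thesis
      unfolding poly_monom power_0 mult_1_right .
  qed
  show "adjoin L a \<subseteq> ?R"
    unfolding adjoin_def
    by (rule hull_minimal, rule subset_trans[OF _ sub], rule subsetI, erule mem, rule sf)
  have H: "is_subfield (adjoin L a)" "a \<in> adjoin L a" "L \<subseteq> adjoin L a"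
    unfolding adjoin_def using hull_subset[of "insert a L" is_subfield] by (auto simp: is_subfield_hull)
  show "?R \<subseteq> adjoin L a"
  proof
    fix x assume "x \<in> ?R"
    then obtain f g where fg: "x = poly f a / poly g a" "f \<in> coeffs_in L" "g \<in> coeffs_in L" by blast
    have "poly f a \<in> adjoin L a" if "f \<in> coeffs_in L" for f
      using that coeffs_in_mono[OF H(3)] by (intro poly_in_subring is_subfieldD H) auto
    then show "x \<in> adjoin L a" using fg by (auto intro: is_subfieldD[OF H(1)])
  qed
qed

text \<open>For the last claim: if g(a) \<noteq> 0, the gcd d of g and \<mu> does not vanish at a,
  so the cofactor of d in \<mu> does and is divisible by \<mu>. Hence d = 1, and Bezout gives an
  inverse of g(a) that is a polynomial in a.\<close>

lemma min_poly_exists: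
  assumes L: "is_subfield L" and f: "f \<in> coeffs_in L" "f \<noteq> 0" "poly f a = 0"
  obtains \<mu> where "\<mu> \<in> coeffs_in L" "lead_coeff \<mu> = 1" "poly \<mu> a = 0"
    "\<And>g. g \<in> coeffs_in L \<Longrightarrow> poly g a = 0 \<Longrightarrow> \<mu> dvd g"
    "adjoin L a = {poly g a | g. g \<in> coeffs_in L}"
proof -
  have A: "is_subring L" using L by (rule is_subfieldD)
  note c = is_subring_coeffs_in[OF A]
  obtain \<mu> where \<mu>: "\<mu> \<in> coeffs_in L" "poly \<mu> a = 0" "lead_coeff \<mu> = 1"
    "\<And>g. g \<in> {g \<in> coeffs_in L. poly g a = 0} \<Longrightarrow> \<exists>q\<in>coeffs_in L. g = q * \<mu>"
    by (rule coeffs_in_ideal_principal[OF L, of "{g \<in> coeffs_in L. poly g a = 0}" f])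
      (use f in \<open>auto intro: c\<close>)
  have dvd: "\<mu> dvd g" if "g \<in> coeffs_in L" "poly g a = 0" for g
    using \<mu>(4)[of g] that by auto
  have inv: "\<exists>u\<in>coeffs_in L. inverse (poly g a) = poly u a" if g: "g \<in> coeffs_in L" "poly g a \<noteq> 0" for g
  proof -
    have \<mu>0: "\<mu> \<noteq> 0" using \<mu>(3) by auto
    obtain d u v s t where d: "lead_coeff d = 1" "d = u * g + v * \<mu>" "g = s * d" "\<mu> = t * d"
      "d \<in> coeffs_in L" "u \<in> coeffs_in L" "t \<in> coeffs_in L"
      using coeffs_in_bezout[OF L g(1) \<mu>(1) \<mu>0] by metis
    have "poly d a \<noteq> 0" using arg_cong[OF d(3), of "\<lambda>p. poly p a"] g(2) by auto
    then have "poly t a = 0" using \<mu>(2) arg_cong[OF d(4), of "\<lambda>p. poly p a"] by auto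
    then have "\<mu> dvd t" using d(7) by (intro dvd)
    moreover have t0: "t \<noteq> 0" "d \<noteq> 0" using d(4) \<mu>0 by auto
    ultimately have "degree \<mu> \<le> degree t" by (intro dvd_imp_degree_le)
    moreover have "degree \<mu> = degree t + degree d"
      unfolding d(4) by (rule degree_mult_eq[OF t0])
    ultimately have "degree d = 0" by simp
    then have "d = 1" using d(1) by (metis degree_0_id lead_coeff_1 one_pCons)
    then have "poly u a * poly g a = 1" using arg_cong[OF d(2), of "\<lambda>p. poly p a"] \<mu>(2) by simp
    then show ?thesis using d(6) g(2) by (intro bexI[of _ u]) (auto simp: field_simps)
  qed
  have "adjoin L a = {poly g a | g. g \<in> coeffs_in L}"
  proof
    show "adjoin L a \<subseteq> {poly g a | g. g \<in> coeffs_in L}"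
    proof
      fix x assume "x \<in> adjoin L a"
      then obtain f g where *: "x = poly f a / poly g a" "f \<in> coeffs_in L" "g \<in> coeffs_in L" "poly g a \<noteq> 0"
        by (auto simp: adjoin_eq[OF L])
      then obtain u where "u \<in> coeffs_in L" "inverse (poly g a) = poly u a" using inv by blast
      then have "x = poly (f * u) a" "f * u \<in> coeffs_in L" using * by (auto simp: divide_inverse intro: c)
      then show "x \<in> {poly g a | g. g \<in> coeffs_in L}" by blast
    qed
    show "{poly g a | g. g \<in> coeffs_in L} \<subseteq> adjoin L a"
    proof
      fix x assume "x \<in> {poly g a | g. g \<in> coeffs_in L}"
      then obtain g where "x = poly g a / poly 1 a" "g \<in> coeffs_in L" by auto
      then show "x \<in> adjoin L a" unfolding adjoin_eq[OF L] using c(2) by fastforce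
    qed
  qed
  with \<mu> dvd that show ?thesis by blast
qed

text \<open>f(a^2) = a g(a^2) would be a polynomial identity, with even degree on the left and odd
  degree on the right.\<close>

lemma square_adjoin_not_mem:
  assumes L: "is_subfield L" and tr: "\<And>f. f \<in> coeffs_in L \<Longrightarrow> poly f a = 0 \<Longrightarrow> f = 0"
  shows "a \<notin> adjoin L (a ^ 2)"
proof
  have A: "is_subring L" using L by (rule is_subfieldD)
  note c = is_subring_coeffs_in[OF A]
  assume "a \<in> adjoin L (a ^ 2)"
  then obtain f g where fg: "a = poly f (a ^ 2) / poly g (a ^ 2)" "f \<in> coeffs_in L" "g \<in> coeffs_in L" "poly g (a ^ 2) \<noteq> 0"
    by (auto simp: adjoin_eq[OF L])
  define s :: "'a poly" where "s = monom 1 2"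
  have s: "s \<in> coeffs_in L" "degree s = 2" "monom 1 1 \<in> coeffs_in L"
    by (auto simp: s_def degree_monom_eq intro: c is_subringD[OF A])
  have pc: "pcompose f s \<in> coeffs_in L" if "f \<in> coeffs_in L" for f
    using that
  proof (induction f)
    case (pCons b f)
    have "b \<in> L" using coeffs_inD[OF pCons.prems, of 0] by simp
    moreover have "f \<in> coeffs_in L" unfolding coeffs_in_def
      using coeffs_inD[OF pCons.prems, of "Suc i" for i] by simp
    ultimately show ?case using pCons.IH s c(9)[OF _ c(1)] by (auto simp: pcompose_pCons intro!: c)
  qed (simp add: c)
  have "poly (pcompose f s - monom 1 1 * pcompose g s) a = 0"
    using fg by (simp add: poly_pcompose s_def poly_monom field_simps)
  then have eq: "pcompose f s = monom 1 1 * pcompose g s"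
    using tr[of "pcompose f s - monom 1 1 * pcompose g s"] s pc fg by (auto intro: c)
  have "g \<noteq> 0" using fg by auto
  then have "pcompose g s \<noteq> 0" using s(2) by (metis degree_0 pcompose_eq_0 zero_neq_numeral neq0_conv)
  then have "degree (pcompose f s) = 1 + degree (pcompose g s)"
    unfolding eq by (subst degree_mult_eq) (auto simp: degree_monom_eq)
  then have "degree f * 2 = 1 + degree g * 2" by (simp add: degree_pcompose s)
  then show False by presburger
qed

section \<open>Localisation at a homomorphism\<close>

text \<open>The localisation at the kernel of \<open>h\<close>, inside the field of fractions. For
  the evaluation at a point it is the local ring of the point, for \<open>hyp j\<close> that of the
  hyperplane x_j = 0, and for an injective \<open>h\<close> the whole field.\<close>

definition loc_ring :: "((nat, 'a::field) mpoly \<Rightarrow> 'b::field) \<Rightarrow> 'a ratfun set" where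
  "loc_ring h = {of_mpoly p / of_mpoly q | p q. h q \<noteq> 0}"

definition loc_hom :: "((nat, 'a::field) mpoly \<Rightarrow> 'b::field) \<Rightarrow> 'a ratfun \<Rightarrow> 'b" where
  "loc_hom h y = (THE v. \<exists>p q. y = of_mpoly p / of_mpoly q \<and> h q \<noteq> 0 \<and> v = h p / h q)"

context
  fixes h :: "(nat, 'a::field) mpoly \<Rightarrow> 'b::field"
  assumes h: "rhom h"
begin

interpretation rhom h by (rule h)

lemma loc_hom_frac:
  assumes "h q \<noteq> 0"
  shows "loc_hom h (of_mpoly p / of_mpoly q) = h p / h q"
  unfolding loc_hom_def
proof (rule the_equality)
  fix v assume "\<exists>p' q'. of_mpoly p / of_mpoly q = of_mpoly p' / of_mpoly q' \<and> h q' \<noteq> 0 \<and> v = h p' / h q'"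
  then obtain p' q' where *: "of_mpoly p / of_mpoly q = of_mpoly p' / of_mpoly q'" "h q' \<noteq> 0" "v = h p' / h q'" by auto
  have "q \<noteq> 0" "q' \<noteq> 0" using assms *(2) by auto
  then have "of_mpoly (p * q') = of_mpoly (p' * q)" using *(1) by (simp add: field_simps)
  then have "p * q' = p' * q" by (simp only: of_mpoly_eq_iff)
  then have eq: "h p * h q' = h p' * h q" by (metis hom_mult)
  show "v = h p / h q" unfolding *(3) using assms *(2) eq by (simp add: frac_eq_eq)
qed (use assms in blast)

lemma loc_ringI: "h q \<noteq> 0 \<Longrightarrow> of_mpoly p / of_mpoly q \<in> loc_ring h"
  by (auto simp: loc_ring_def)

lemma of_mpoly_in_loc_ring: "of_mpoly p \<in> loc_ring h"
  using loc_ringI[of 1 p] by simp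

lemma loc_hom_of_mpoly: "loc_hom h (of_mpoly p) = h p"
  using loc_hom_frac[of 1 p] by simp

lemma loc_add_mult:
  assumes "x \<in> loc_ring h" "y \<in> loc_ring h"
  shows "x + y \<in> loc_ring h" "x * y \<in> loc_ring h"
    "loc_hom h (x + y) = loc_hom h x + loc_hom h y" "loc_hom h (x * y) = loc_hom h x * loc_hom h y"
proof -
  obtain p q p' q' where *: "x = of_mpoly p / of_mpoly q" "y = of_mpoly p' / of_mpoly q'" "h q \<noteq> 0" "h q' \<noteq> 0"
    using assms by (auto simp: loc_ring_def)
  have nz: "q \<noteq> 0" "q' \<noteq> 0" "h (q * q') \<noteq> 0" using * by auto
  have s: "x + y = of_mpoly (p * q' + p' * q) / of_mpoly (q * q')" "x * y = of_mpoly (p * p') / of_mpoly (q * q')"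
    unfolding *(1,2) using nz by (simp_all add: field_simps)
  show "x + y \<in> loc_ring h" "x * y \<in> loc_ring h"
    unfolding s by (rule loc_ringI[OF nz(3)])+
  show "loc_hom h (x + y) = loc_hom h x + loc_hom h y" "loc_hom h (x * y) = loc_hom h x * loc_hom h y"
    unfolding s loc_hom_frac[OF nz(3)] unfolding *(1,2) loc_hom_frac[OF *(3)] loc_hom_frac[OF *(4)]
    using * by (simp_all add: field_simps)
qed

lemma is_subring_loc_ring: "is_subring (loc_ring h)"
  unfolding is_subring_def
proof (intro conjI ballI)
  show "0 \<in> loc_ring h" "1 \<in> loc_ring h"
    using of_mpoly_in_loc_ring[of 0] of_mpoly_in_loc_ring[of 1] by simp_all
  fix a assume "a \<in> loc_ring h"
  then show "- a \<in> loc_ring h" using loc_add_mult(2)[OF of_mpoly_in_loc_ring[of "-1"]] by fastforce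
qed (auto intro: loc_add_mult)

lemma loc_hom_sum:
  assumes "\<And>x. x \<in> S \<Longrightarrow> f x \<in> loc_ring h"
  shows "loc_hom h (sum f S) = (\<Sum>x\<in>S. loc_hom h (f x))"
  using assms
proof (induction S rule: infinite_finite_induct)
  case (insert x F)
  have "sum f F \<in> loc_ring h" using insert.prems by (intro is_subringD[OF is_subring_loc_ring]) auto
  with insert show ?case by (simp add: loc_add_mult)
qed (use loc_hom_of_mpoly[of 0] in auto)

lemma loc_map_poly:
  assumes "f \<in> coeffs_in (loc_ring h)" "g \<in> coeffs_in (loc_ring h)"
  shows "map_poly (loc_hom h) (f + g) = map_poly (loc_hom h) f + map_poly (loc_hom h) g"
    "map_poly (loc_hom h) (f * g) = map_poly (loc_hom h) f * map_poly (loc_hom h) g"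
proof -
  have z: "loc_hom h 0 = 0" using loc_hom_of_mpoly[of 0] by simp
  show "map_poly (loc_hom h) (f + g) = map_poly (loc_hom h) f + map_poly (loc_hom h) g"
    by (rule poly_eqI) (use assms in \<open>simp add: coeff_map_poly z loc_add_mult coeffs_inD\<close>)
  show "map_poly (loc_hom h) (f * g) = map_poly (loc_hom h) f * map_poly (loc_hom h) g"
    by (rule poly_eqI) (use assms in \<open>simp add: coeff_map_poly z coeff_mult loc_hom_sum loc_add_mult coeffs_inD\<close>)
qed

end

section \<open>Weights separating monomials\<close>

text \<open>Digits in base \<open>B\<close>, that of x_i at position \<open>e i\<close>. At the
  lowest position where the monomials differ, the equation modulo the next power of \<open>B\<close>
  makes the difference of the digits divisible by \<open>B\<close>, although its absolute value is
  smaller.\<close>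

lemma weights_inj_on_box:
  fixes e :: "nat \<Rightarrow> nat"
  assumes e: "inj_on e {..<n}" and B: "D < B" and m: "m \<in> box n D" "m' \<in> box n D"
    and eq: "(\<Sum>i<n. B ^ e i * lookup m i) = (\<Sum>i<n. B ^ e i * lookup m' i)"
  shows "m = m'"
proof (rule ccontr)
  assume ne: "m \<noteq> m'"
  define \<delta> where "\<delta> = (\<lambda>i. int (lookup m i) - int (lookup m' i))"
  define S where "S = {i. i < n \<and> \<delta> i \<noteq> 0}"
  have "S \<noteq> {}"
  proof
    assume "S = {}"
    have "lookup m i = lookup m' i" for i
    proof (cases "i < n")
      case True
      then show ?thesis using \<open>S = {}\<close> by (auto simp: S_def \<delta>_def)
    next
      case False
      then have "i \<notin> keys m" "i \<notin> keys m'" using m by (auto simp: box_def)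
      then show ?thesis by (simp add: in_keys_iff)
    qed
    then show False using ne by (auto intro: poly_mapping_eqI)
  qed
  moreover have "finite S" by (simp add: S_def)
  ultimately obtain i where i: "i \<in> S" "\<And>i'. i' \<in> S \<Longrightarrow> e i \<le> e i'"
    using ex_has_least_nat[of "\<lambda>i. i \<in> S" _ e] by blast
  have "(\<Sum>i<n. int B ^ e i * int (lookup m i)) = (\<Sum>i<n. int B ^ e i * int (lookup m' i))"
    using arg_cong[OF eq, of int] by simp
  then have "(\<Sum>i<n. int B ^ e i * \<delta> i) = 0"
    by (simp add: \<delta>_def right_diff_distrib sum_subtractf)
  moreover have "(\<Sum>i<n. int B ^ e i * \<delta> i) = (\<Sum>i\<in>S. int B ^ e i * \<delta> i)"
    by (rule sum.mono_neutral_right) (auto simp: S_def)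
  ultimately have "int B ^ e i * \<delta> i = - (\<Sum>i'\<in>S - {i}. int B ^ e i' * \<delta> i')"
    using i(1) \<open>finite S\<close> by (simp add: sum.remove eq_neg_iff_add_eq_0)
  moreover have "int B ^ (e i + 1) dvd int B ^ e i' * \<delta> i'" if "i' \<in> S - {i}" for i'
  proof -
    have "e i' \<noteq> e i" using that i(1) inj_onD[OF e, of i' i] by (auto simp: S_def)
    then have "e i + 1 \<le> e i'" using i(2)[of i'] that by auto
    then show ?thesis by (intro dvd_mult2 le_imp_power_dvd)
  qed
  ultimately have "int B ^ (e i + 1) dvd int B ^ e i * \<delta> i"
    by (simp only: dvd_minus_iff) (intro dvd_sum, blast)
  then have "int B dvd \<delta> i" using B by (simp add: mult.commute)
  moreover have "\<bar>\<delta> i\<bar> < int B"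
  proof -
    have "lookup m i \<le> D" "lookup m' i \<le> D" using m by (auto simp: box_def)
    then show ?thesis using B by (simp add: \<delta>_def)
  qed
  moreover have "\<delta> i \<noteq> 0" using i(1) by (simp add: S_def)
  ultimately show False using dvd_imp_le_int[of "\<delta> i" "int B"] by simp
qed

lemma mon_box:
  assumes "m \<in> box n D"
  shows "mon \<theta> m = (\<Prod>i<n. \<theta> i ^ lookup m i)"
  by (rule mon_superset) (use assms in \<open>auto simp: box_def\<close>)

lemma finite_poly_vars: "finite (poly_vars p)"
  by (simp add: poly_vars_def)

text \<open>Kronecker substitution x_i = t^((D+1)^i) keeps the monomials apart; the resulting
  nonzero polynomial in t has finitely many roots in an infinite field.\<close>

lemma nonzero_point_exists:
  fixes p :: "(nat, 'a::field_char_0) mpoly"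
  assumes "p \<noteq> 0"
  shows "\<exists>c. ev (\<lambda>x. x) c p \<noteq> 0"
proof -
  obtain n where n: "poly_vars p \<subseteq> {..<n}"
    using finite_nat_bounded[OF finite_poly_vars] by auto
  obtain D where D: "boxed n D p" using boxed_exists[OF n] by auto
  define w where "w = (\<lambda>m :: nat \<Rightarrow>\<^sub>0 nat. \<Sum>i<n. (D + 1) ^ i * lookup m i)"
  define P where "P = (\<Sum>m\<in>keys p. monom (lookup p m) (w m))"
  have inj: "m = m'" if "m \<in> keys p" "m' \<in> keys p" "w m = w m'" for m m'
    using that D by (intro weights_inj_on_box[of "\<lambda>i. i" n D "D + 1"]) (auto simp: w_def boxed_def)
  obtain m where m: "m \<in> keys p" using assms keys_eq_empty by blast
  have "coeff P (w m) = (\<Sum>m'\<in>keys p. if m' = m then lookup p m' else 0)"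
    unfolding P_def coeff_sum by (rule sum.cong) (use inj m in auto)
  then have "coeff P (w m) \<noteq> 0" using m by (simp add: in_keys_iff)
  then have "P \<noteq> 0" by auto
  then have "finite {t. poly P t = 0}" by (rule poly_roots_finite)
  then obtain t where t: "poly P t \<noteq> 0"
    using ex_new_if_finite[OF infinite_UNIV_char_0] by blast
  have "ev (\<lambda>x. x) (\<lambda>i. t ^ ((D + 1) ^ i)) p = poly P t"
  proof -
    have "mon (\<lambda>i. t ^ ((D + 1) ^ i)) m = t ^ w m" if "m \<in> keys p" for m
      using D that by (subst mon_box[of _ n D]) (auto simp: boxed_def w_def power_sum power_mult)
    then show ?thesis by (simp add: ev_def P_def poly_sum poly_monom)
  qed
  with t show ?thesis by metis
qed

section \<open>A curve base point\<close>

lemma hull_adjoin: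
  "is_subfield hull (insert a (is_subfield hull S)) = is_subfield hull (insert a S)"
proof (rule antisym)
  show "is_subfield hull (insert a (is_subfield hull S)) \<subseteq> is_subfield hull (insert a S)"
  proof (rule hull_minimal)
    have "is_subfield hull S \<subseteq> is_subfield hull (insert a S)" by (rule hull_mono) auto
    moreover have "a \<in> is_subfield hull (insert a S)" using hull_subset[of "insert a S" is_subfield] by auto
    ultimately show "insert a (is_subfield hull S) \<subseteq> is_subfield hull (insert a S)" by auto
  qed (rule is_subfield_hull)
  show "is_subfield hull (insert a S) \<subseteq> is_subfield hull (insert a (is_subfield hull S))"
    by (rule hull_mono) (use hull_subset[of S is_subfield] in auto)
qed

lemma rat_field_subset:
  assumes "is_subfield L" "const_field \<subseteq> L" "\<And>i. i < n \<Longrightarrow> ratvar i \<in> L"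
  shows "rat_field n \<subseteq> L"
  unfolding rat_field_def
proof (rule frac_field_subset[OF assms(1)])
  show "poly_ring n \<subseteq> L"
    using assms by (auto simp: poly_ring_def of_mpoly_ev const_field_eq intro!: ev_in_subring rhom_K is_subfieldD(1))
qed

lemma ratvar_in_rat_field [simp]: "i < n \<Longrightarrow> ratvar i \<in> rat_field n"
  using poly_ring_subset_rat_field[of n] by auto

text \<open>Adjoin x_0, x_1, ... to M successively. The step that first reaches k(x) yields x_j and
  a proper subfield \<open>F j\<close> with \<open>F j\<close>(x_j) = k(x). If x_j is transcendental
  over \<open>F j\<close>, adjoining x_j^2 gives a field over which x_j is quadratic.\<close>

lemma primitive_variable_exists:
  fixes M :: "'a::field ratfun set"
  assumes M: "is_subfield M" "const_field \<subseteq> M" "M \<subseteq> rat_field n" "M \<noteq> rat_field n"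
  obtains j L where "j < n" "is_subfield L" "M \<subseteq> L" "L \<subseteq> rat_field n" "ratvar j \<notin> L"
    "adjoin L (ratvar j) = rat_field n"
    "\<exists>f\<in>coeffs_in L. f \<noteq> 0 \<and> poly f (ratvar j) = 0"
proof -
  define F where "F = (\<lambda>m. is_subfield hull (M \<union> ratvar ` {..<m}))"
  have sub: "F m \<subseteq> rat_field n" if "m \<le> n" for m
    unfolding F_def using M that by (intro hull_minimal is_subfield_rat_field) auto
  have FM: "M \<subseteq> F m" "\<And>i. i < m \<Longrightarrow> ratvar i \<in> F m" for m
    unfolding F_def using hull_subset[of "M \<union> ratvar ` {..<m}" is_subfield] by auto
  have Fsf: "is_subfield (F m)" for m unfolding F_def by (rule is_subfield_hull)
  have Fn: "F n = rat_field n"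
    using sub[of n] FM(2)[of _ n] FM(1)[of n] M(2) by (intro antisym rat_field_subset Fsf) auto
  have F0: "F 0 = M" unfolding F_def using hull_same[of is_subfield M] M(1) by simp
  define k where "k = (LEAST m. F m = rat_field n)"
  have k: "F k = rat_field n" "k \<le> n"
    unfolding k_def using Fn LeastI[of "\<lambda>m. F m = rat_field n" n] Least_le[of "\<lambda>m. F m = rat_field n" n]
    by simp_all
  then obtain j where j: "k = Suc j" using F0 M(4) by (cases k) auto
  have Fj: "F j \<noteq> rat_field n" using not_less_Least[of j "\<lambda>m. F m = rat_field n"] j by (auto simp: k_def)
  have ad: "adjoin (F j) (ratvar j) = rat_field n"
  proof -
    have "adjoin (F j) (ratvar j) = F k"
      unfolding adjoin_def F_def hull_adjoin j by (simp add: lessThan_Suc)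
    then show ?thesis using k by simp
  qed
  have jn: "j < n" using k j by simp
  have nF: "ratvar j \<notin> F j"
  proof
    assume "ratvar j \<in> F j"
    then have "adjoin (F j) (ratvar j) = F j"
      unfolding adjoin_def by (simp add: insert_absorb hull_same[where S = is_subfield] Fsf)
    then show False using ad Fj by simp
  qed
  show thesis
  proof (cases "\<exists>f\<in>coeffs_in (F j). f \<noteq> 0 \<and> poly f (ratvar j) = 0")
    case True
    then show thesis using that[of j "F j"] jn FM Fsf sub[of j] nF ad by simp
  next
    case False
    define L where "L = adjoin (F j) (ratvar j ^ 2)"
    have L: "is_subfield L" "F j \<subseteq> L" "ratvar j ^ 2 \<in> L"
      unfolding L_def adjoin_def using hull_subset[of "insert (ratvar j ^ 2) (F j)" is_subfield]
      by (auto simp: is_subfield_hull)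
    have Lsub: "L \<subseteq> rat_field n"
      unfolding L_def adjoin_def using sub[of j] jn poly_ring_subset_rat_field[of n]
      by (intro hull_minimal is_subfield_rat_field)
        (auto intro!: is_subringD(7)[OF is_subfieldD(1)[OF is_subfield_rat_field]])
    have "ratvar j \<notin> L"
      unfolding L_def using False by (intro square_adjoin_not_mem Fsf) auto
    moreover have "adjoin L (ratvar j) = rat_field n"
    proof
      show "adjoin L (ratvar j) \<subseteq> rat_field n"
        unfolding adjoin_def using Lsub jn poly_ring_subset_rat_field[of n]
        by (intro hull_minimal is_subfield_rat_field) auto
      show "rat_field n \<subseteq> adjoin L (ratvar j)"
        unfolding ad[symmetric] adjoin_def using L(2) by (intro hull_mono) auto
    qed
    moreover have "\<exists>f\<in>coeffs_in L. f \<noteq> 0 \<and> poly f (ratvar j) = 0"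
    proof (rule bexI, rule conjI)
      have A: "is_subring L" using L by (intro is_subfieldD)
      note c = is_subring_coeffs_in[OF A]
      show "monom 1 2 - monom (ratvar j ^ 2) 0 \<in> coeffs_in L"
        by (intro c L is_subringD[OF A])
      have "coeff (monom 1 2 - monom (ratvar j ^ 2) 0) 2 = (1 :: 'a ratfun)" by simp
      then show "monom 1 2 - monom (ratvar j ^ 2) 0 \<noteq> (0 :: 'a ratfun poly)" by (metis coeff_0 zero_neq_one)
      show "poly (monom 1 2 - monom (ratvar j ^ 2) 0) (ratvar j) = 0"
        by (simp add: poly_monom)
    qed
    ultimately show thesis using that[of j L] jn FM(1)[of j] L Lsub by auto
  qed
qed

lemma rhom_const_poly: "rhom (\<lambda>c::'b::comm_ring_1. [:c:])"
  by unfold_locales (simp_all add: one_pCons)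

lemma rhom_poly: "rhom (\<lambda>f. poly f a)"
  by unfold_locales auto

text \<open>
  \<open>x\<^sub>j\<close> is algebraic over some \<open>L \<supseteq> M\<close> with \<open>x\<^sub>j \<notin> L\<close> and \<open>L(x\<^sub>j) = k(x)\<close>.  The curve arises by
  specialising the coefficients of the \<open>x\<^sub>i \<in> L[x\<^sub>j]\<close> at a point, and \<open>\<mu>\<close> by specialising the minimal
  polynomial of \<open>x\<^sub>j\<close>; elements of \<open>M\<close> become constants.
\<close>

lemma base_curve_exists:
  fixes M :: "'a::field_char_0 ratfun set"
  assumes M: "is_subfield M" "const_field \<subseteq> M" "M \<subseteq> rat_field n" "M \<noteq> rat_field n"
  obtains j \<mu> \<rho> where "j < n" "ratvar j \<notin> M" "lead_coeff \<mu> = 1" "degree \<mu> \<ge> 2" "\<rho> j = [:0, 1:]"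
    "\<And>p. poly_vars p \<subseteq> {..<n} \<Longrightarrow> of_mpoly p \<in> M \<Longrightarrow> \<exists>c. \<mu> dvd uev \<rho> p - [:c:]"
proof -
  obtain j L where j: "j < n" and L: "is_subfield L" "M \<subseteq> L" "L \<subseteq> rat_field n" "ratvar j \<notin> L"
    "adjoin L (ratvar j) = rat_field n"
    and alg: "\<exists>f\<in>coeffs_in L. f \<noteq> 0 \<and> poly f (ratvar j) = 0"
    by (rule primitive_variable_exists[OF M])
  have A: "is_subring L" using L by (intro is_subfieldD)
  note c = is_subring_coeffs_in[OF A]
  from alg obtain f where f: "f \<in> coeffs_in L" "f \<noteq> 0" "poly f (ratvar j) = 0" by auto
  obtain m where m: "m \<in> coeffs_in L" "lead_coeff m = 1" "poly m (ratvar j) = 0"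
    "\<And>g. g \<in> coeffs_in L \<Longrightarrow> poly g (ratvar j) = 0 \<Longrightarrow> m dvd g"
    "adjoin L (ratvar j) = {poly g (ratvar j) | g. g \<in> coeffs_in L}"
    by (rule min_poly_exists[OF L(1) f]) (rule that; (assumption | blast))
  \<comment> \<open>In degree at most 1 the monic \<open>m\<close> would put x_j into
    \<open>L\<close>.\<close>
  have deg: "degree m \<ge> 2"
  proof (rule ccontr)
    assume "\<not> degree m \<ge> 2"
    then have le: "degree m \<le> 1" by simp
    define a b where "a = coeff m 0" and "b = coeff m 1"
    have ab: "m = [:a, b:]"
    proof (rule poly_eqI)
      fix i show "coeff m i = coeff [:a, b:] i"
      proof (cases "i \<le> 1")
        case True
        then have "i = 0 \<or> i = 1" by auto
        then show ?thesis by (auto simp: a_def b_def)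
      next
        case False
        then have "coeff m i = 0" using le by (intro coeff_eq_0) auto
        moreover have "coeff [:a, b:] i = 0"
          using False by (intro coeff_eq_0) auto
        ultimately show ?thesis by simp
      qed
    qed
    have aL: "a \<in> L" using coeffs_inD[OF m(1), of 0] by (simp add: a_def)
    have "b = 1"
    proof (cases "degree m = 0")
      case True
      then have "coeff m 0 = 1" using m(2) by simp
      moreover have "b = 0" using True by (simp add: b_def coeff_eq_0)
      ultimately show ?thesis using m(3) unfolding ab by (simp add: a_def)
    next
      case False
      then have "degree m = 1" using le by simp
      then show ?thesis using m(2) by (simp add: b_def)
    qed
    then have "ratvar j = - a"
      using m(3) ab by (simp add: eq_neg_iff_add_eq_0 add.commute)
    then show False using L(4) is_subringD(4)[OF A aL] by simp
  qed
  have cL: "K c \<in> L" for c using M(2) L(2) by (auto simp: const_field_eq)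
  have "\<forall>i. \<exists>g. i < n \<longrightarrow> g \<in> coeffs_in L \<and> ratvar i = poly g (ratvar j)"
  proof
    fix i
    have "ratvar i \<in> adjoin L (ratvar j)" if "i < n"
      using that L(5) poly_ring_subset_rat_field[of n] by auto
    then show "\<exists>g. i < n \<longrightarrow> g \<in> coeffs_in L \<and> ratvar i = poly g (ratvar j)"
      unfolding m(5) by blast
  qed
  then obtain r0 where r0: "\<And>i. i < n \<Longrightarrow> r0 i \<in> coeffs_in L \<and> ratvar i = poly (r0 i) (ratvar j)" by metis
  \<comment> \<open>At \<open>j\<close> the representation is fixed to be the variable itself, so
    that the curve has x_j = t.\<close>
  define r where "r = (\<lambda>i. if i = j then monom 1 1 else r0 i)"
  have r: "r i \<in> coeffs_in L" "ratvar i = poly (r i) (ratvar j)" if "i < n" for i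
    using r0[OF that] by (auto simp: r_def poly_monom intro: c is_subringD[OF A])
  have finc: "finite (range (coeff g))" for g :: "'a ratfun poly"
  proof -
    have "range (coeff g) \<subseteq> insert 0 (coeff g ` {..degree g})"
    proof safe
      fix i assume "coeff g i \<notin> coeff g ` {..degree g}"
      then have "\<not> i \<le> degree g" by auto
      then show "coeff g i = 0" by (intro coeff_eq_0) simp
    qed
    then show ?thesis by (rule finite_subset) auto
  qed
  \<comment> \<open>All coefficients of the minimal polynomial and of the curve, finitely many
    elements of k(x): they can be specialised at any point where their common denominator does not
    vanish.\<close>
  define T where "T = range (coeff m) \<union> (\<Union>i<n. range (coeff (r i)))"
  have "finite T" "T \<subseteq> rat_field n"
    unfolding T_def using finc coeffs_inD[OF m(1)] coeffs_inD[OF r(1)] L(3) by auto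
  from common_denominator[OF this] obtain q where q: "q \<in> poly_ring n" "q \<noteq> 0" "\<And>b. b \<in> T \<Longrightarrow> q * b \<in> poly_ring n"
    by auto
  then obtain q' where q': "q = of_mpoly q'" by (auto simp: poly_ring_def)
  then obtain x where x: "ev (\<lambda>c. c) x q' \<noteq> 0" using nonzero_point_exists[of q'] q(2) by auto
  define h where "h = ev (\<lambda>c. c) x"
  have h: "rhom h" unfolding h_def by (rule rhom.rhom_ev[OF rhom_id])
  let ?O = "loc_ring h"
  have O: "is_subring ?O" using h by (rule is_subring_loc_ring)
  note cO = is_subring_coeffs_in[OF O]
  have TO: "T \<subseteq> ?O"
  proof
    fix b assume "b \<in> T"
    then obtain p where "q * b = of_mpoly p" using q(3) by (auto simp: poly_ring_def)
    then have "b = of_mpoly p / of_mpoly q'" using q(2) q' by (simp add: field_simps)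
    then show "b \<in> ?O" using x loc_ringI[OF h, of q' p] by (simp add: h_def)
  qed
  have mO: "m \<in> coeffs_in ?O" using TO by (auto simp: T_def coeffs_in_def)
  have rO: "r i \<in> coeffs_in ?O" if "i < n" for i
    using TO that unfolding T_def coeffs_in_def by blast
  let ?e = "loc_hom h"
  let ?E = "map_poly (loc_hom h)"
  interpret h: rhom h by (rule h)
  have e0: "?e 0 = 0" and e1: "?e 1 = 1" using loc_hom_of_mpoly[OF h, of 0] loc_hom_of_mpoly[OF h, of 1] by simp_all
  have eK: "?e (K c) = c" for c
    unfolding K_def loc_hom_of_mpoly[OF h] by (simp add: h_def rhom.ev_cst[OF rhom_id])
  define \<mu> where "\<mu> = ?E m"
  define \<rho> where "\<rho> = (\<lambda>i. ?E (r i))"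
  have d\<mu>: "degree \<mu> = degree m" "lead_coeff \<mu> = 1"
    using m(2) e0 e1 by (auto simp: \<mu>_def coeff_map_poly map_poly_degree_eq)
  have "\<rho> j = [:0, 1:]"
    by (simp add: \<rho>_def r_def monom_altdef map_poly_pCons e0 e1)
  have hK: "rhom (\<lambda>c. [:K c:])" using rhom_compose[OF rhom_const_poly rhom_K] .
  have evE: "ev (\<lambda>c. [:K c:]) r p \<in> coeffs_in ?O \<and> ?E (ev (\<lambda>c. [:K c:]) r p) = uev \<rho> p"
    if "poly_vars p \<subseteq> {..<n}" for p
    using that
  proof (induction p rule: mpoly_induct)
    case (cst c)
    have "[:K c:] \<in> coeffs_in ?O"
      using of_mpoly_in_loc_ring[OF h] by (intro cO) (simp add: K_def)
    then show ?case
      by (simp add: rhom.ev_cst[OF hK] rhom.ev_cst[OF rhom_const_poly] map_poly_pCons e0 eK)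
  next
    case (var i)
    then show ?case using rO by (simp add: rhom.ev_var[OF hK] rhom.ev_var[OF rhom_const_poly] \<rho>_def)
  next
    case (add p q)
    then show ?case by (simp add: rhom.ev_add[OF hK] rhom.ev_add[OF rhom_const_poly] cO loc_map_poly[OF h])
  next
    case (mult p q)
    then show ?case by (simp add: rhom.ev_mult[OF hK] rhom.ev_mult[OF rhom_const_poly] cO loc_map_poly[OF h])
  qed
  have main: "\<exists>c. \<mu> dvd uev \<rho> p - [:c:]" if p: "poly_vars p \<subseteq> {..<n}" "of_mpoly p \<in> M" for p
  proof -
    define g where "g = ev (\<lambda>c. [:K c:]) r p"
    have gL: "g \<in> coeffs_in L" unfolding g_def
      using p(1)
    proof (induction p rule: mpoly_induct)
      case (cst c)
      then show ?case using cL by (simp add: rhom.ev_cst[OF hK] c)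
    next
      case (var i)
      then show ?case using r by (simp add: rhom.ev_var[OF hK])
    qed (simp_all add: rhom.ev_add[OF hK] rhom.ev_mult[OF hK] c)
    have "poly g (ratvar j) = ev K (\<lambda>i. poly (r i) (ratvar j)) p"
      unfolding g_def using hom_ev[OF rhom_poly[of "ratvar j"] hK, where \<theta> = r and p = p] by simp
    also have "\<dots> = of_mpoly p"
      unfolding of_mpoly_ev by (rule ev_agree[OF rhom_K p(1)], rule r(2)[symmetric], simp)
    finally have g1: "poly g (ratvar j) = of_mpoly p" .
    have pL: "of_mpoly p \<in> L" using p L by auto
    have "m dvd g - [:of_mpoly p:]"
      using gL pL by (intro m(4)) (auto simp: g1 intro!: c)
    then obtain k where k: "g - [:of_mpoly p:] = k * m" by (metis dvdE mult.commute)
    have gO: "g - [:of_mpoly p:] \<in> coeffs_in ?O"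
      using evE[OF p(1)] of_mpoly_in_loc_ring[OF h] by (auto simp: g_def intro!: cO)
    \<comment> \<open>As \<open>m\<close> is monic, the quotient \<open>k\<close> stays over the
      local ring, and the divisibility survives the specialisation.\<close>
    have kO: "k \<in> coeffs_in ?O"
    proof (rule coeffs_in_divisor[OF O mO])
      show "m \<noteq> 0" using m(2) by auto
    qed (use gO m(2) is_subringD(2)[OF O] in \<open>simp_all add: k\<close>)
    have "g = k * m + [:of_mpoly p:]" using k by (simp add: algebra_simps)
    moreover have "k * m \<in> coeffs_in ?O" "[:of_mpoly p:] \<in> coeffs_in ?O"
      using kO mO of_mpoly_in_loc_ring[OF h] by (auto intro!: cO)
    ultimately have "?E g = ?E k * \<mu> + [:h p:]"
      using kO mO by (simp add: loc_map_poly[OF h] \<mu>_def map_poly_pCons e0 loc_hom_of_mpoly[OF h])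
    then have "uev \<rho> p - [:h p:] = ?E k * \<mu>" using evE[OF p(1)] by (simp add: g_def)
    then show ?thesis by (metis dvd_triv_right)
  qed
  have "ratvar j \<notin> M" using L by auto
  then show thesis using that[of j \<mu> \<rho>] j d\<mu> deg \<open>\<rho> j = [:0, 1:]\<close> main by simp
qed

section \<open>Degrees along a curve\<close>

text \<open>The coefficient below the leading one. For a monic polynomial it is minus the sum of the
  roots, hence additive under products; \<open>reflect_poly\<close> makes this the product rule for
  linear coefficients and gives 0 in degree 0.\<close>

definition sec :: "'a::comm_ring_1 poly \<Rightarrow> 'a" where
  "sec f = coeff (reflect_poly f) 1"

lemma sec_mult:
  fixes f g :: "'a::field poly"
  assumes "lead_coeff f = 1" "lead_coeff g = 1"
  shows "sec (f * g) = sec f + sec g"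
proof -
  have "coeff (reflect_poly f * reflect_poly g) 1 =
    coeff (reflect_poly f) 0 * coeff (reflect_poly g) 1 + coeff (reflect_poly f) 1 * coeff (reflect_poly g) 0"
    by (simp add: coeff_mult)
  then show ?thesis using assms by (simp add: sec_def reflect_poly_mult)
qed

lemma sec_eq: "sec f = (if degree f = 0 then 0 else coeff f (degree f - 1))"
  by (auto simp: sec_def coeff_reflect_poly)

definition monicp :: "'a::comm_ring_1 poly \<Rightarrow> bool" where
  "monicp f \<longleftrightarrow> lead_coeff f = 1"

lemma monicpD: "monicp f \<Longrightarrow> lead_coeff f = 1" "monicp f \<Longrightarrow> f \<noteq> 0"
  by (auto simp: monicp_def)

lemma monicp_mult:
  fixes f g :: "'a::field poly"
  assumes "monicp f" "monicp g"
  shows "monicp (f * g)" "degree (f * g) = degree f + degree g" "sec (f * g) = sec f + sec g"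
proof -
  show "monicp (f * g)" using assms unfolding monicp_def lead_coeff_mult by simp
  show "degree (f * g) = degree f + degree g" using assms monicpD by (intro degree_mult_eq) auto
  show "sec (f * g) = sec f + sec g" using assms by (intro sec_mult monicpD)
qed

lemma monicp_1: "monicp 1" "sec 1 = 0"
  by (simp_all add: monicp_def sec_eq)

lemma monicp_power:
  fixes f :: "'a::field poly"
  assumes "monicp f"
  shows "monicp (f ^ e) \<and> degree (f ^ e) = e * degree f \<and> sec (f ^ e) = of_nat e * sec f"
  by (induction e) (use assms in \<open>auto simp: monicp_1 monicp_mult algebra_simps\<close>)

lemma monicp_prod:
  fixes f :: "'i \<Rightarrow> 'a::field poly"
  assumes "finite S" "\<And>i. i \<in> S \<Longrightarrow> monicp (f i)"
  shows "monicp (prod f S) \<and> degree (prod f S) = (\<Sum>i\<in>S. degree (f i)) \<and> sec (prod f S) = (\<Sum>i\<in>S. sec (f i))"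
  using assms by induction (auto simp: monicp_1 monicp_mult)

text \<open>The leading coefficients cancel and the next ones do not; degrees of the form P Q - 1
  are produced in this way.\<close>

lemma monic_diff_degree:
  fixes f g :: "'a::field poly"
  assumes "monicp f" "monicp g" "degree f = degree g" "sec f \<noteq> sec g"
  shows "degree (f - g) = degree f - 1 \<and> f - g \<noteq> 0"
proof -
  have d: "degree f \<noteq> 0"
  proof
    assume "degree f = 0"
    then have "sec f = sec g" using assms(3) by (simp add: sec_eq)
    then show False using assms(4) by simp
  qed
  then have c: "coeff (f - g) (degree f - 1) \<noteq> 0" using assms(3,4) by (simp add: sec_eq)
  then have "degree f - 1 \<le> degree (f - g)" by (rule le_degree)
  moreover have "degree (f - g) \<le> degree f - 1"
  proof (rule degree_le, intro allI impI)
    fix i assume "degree f - 1 < i"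
    then have "i = degree f \<or> degree f < i" by auto
    then show "coeff (f - g) i = 0" using monicpD(1)[OF assms(1)] monicpD(1)[OF assms(2)] assms(3) by (auto simp: coeff_eq_0)
  qed
  ultimately show ?thesis using c by auto
qed

text \<open>\<open>w m\<close> will be the degree of the monomial \<open>m\<close> after each x_i is
  replaced by a monic polynomial of degree B^(e i). Since \<open>D\<close> is less than
  \<open>B\<close>, a polynomial in the box has a unique top monomial.\<close>

locale weights =
  fixes n B D :: nat and e :: "nat \<Rightarrow> nat"
  assumes inj_e: "inj_on e {..<n}" and DB: "D < B"
begin

definition w :: "(nat \<Rightarrow>\<^sub>0 nat) \<Rightarrow> nat" where
  "w m = (\<Sum>i<n. B ^ e i * lookup m i)"

lemma w_inj: "m \<in> box n D \<Longrightarrow> m' \<in> box n D \<Longrightarrow> w m = w m' \<Longrightarrow> m = m'"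
  unfolding w_def using inj_e DB by (rule weights_inj_on_box)

lemma top_exists:
  assumes "p \<noteq> 0" "boxed n D p"
  obtains E where "E \<in> keys p" "\<And>m. m \<in> keys p \<Longrightarrow> m \<noteq> E \<Longrightarrow> w m < w E"
proof -
  have ne: "keys p \<noteq> {}" using assms by (auto simp: poly_mapping_eq_iff in_keys_iff fun_eq_iff)
  define E where "E = arg_max_on w (keys p)"
  obtain E where E: "E \<in> keys p" "\<And>m. m \<in> keys p \<Longrightarrow> w m \<le> w E"
    using ne Max_in[of "w ` keys p"] Max_ge[of "w ` keys p"] by fastforce
  have "w m < w E" if "m \<in> keys p" "m \<noteq> E" for m
    using E(2)[OF that(1)] w_inj[of m E] that E(1) assms(2) by (auto simp: boxed_def le_less)
  with E(1) that show thesis by blast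
qed

text \<open>The coefficient below the leading one has two sources: the top monomial
  \<open>E\<close>, through the second coefficients of the \<open>\<Phi> i\<close>, and the
  monomials of weight \<open>w E - 1\<close>, through their leading coefficients. The latter
  contribution does not depend on \<open>\<Phi>\<close>.\<close>

lemma ev_degree:
  fixes \<Phi> :: "nat \<Rightarrow> 'a::field poly"
  assumes p: "boxed n D p" and E: "E \<in> keys p" "\<And>m. m \<in> keys p \<Longrightarrow> m \<noteq> E \<Longrightarrow> w m < w E"
    and \<Phi>: "\<And>i. i < n \<Longrightarrow> monicp (\<Phi> i) \<and> degree (\<Phi> i) = B ^ e i"
  shows "degree (uev \<Phi> p) = w E" "lead_coeff (uev \<Phi> p) = lookup p E"
    "w E \<noteq> 0 \<Longrightarrow> coeff (uev \<Phi> p) (w E - 1) = lookup p E * (\<Sum>i<n. of_nat (lookup E i) * sec (\<Phi> i))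
      + (\<Sum>m\<in>{m\<in>keys p. w m = w E - 1}. lookup p m)"
proof -
  have mon': "monicp (mon \<Phi> m) \<and> degree (mon \<Phi> m) = w m \<and> sec (mon \<Phi> m) = (\<Sum>i<n. of_nat (lookup m i) * sec (\<Phi> i))"
    if "m \<in> keys p" for m
  proof -
    have m: "mon \<Phi> m = (\<Prod>i<n. \<Phi> i ^ lookup m i)"
      using p that by (intro mon_box) (auto simp: boxed_def)
    have pw: "monicp (\<Phi> i ^ a)" "degree (\<Phi> i ^ a) = B ^ e i * a" "sec (\<Phi> i ^ a) = of_nat a * sec (\<Phi> i)"
      if "i < n" for i a
      using monicp_power[of "\<Phi> i" a] \<Phi>[OF that] by (simp_all add: mult.commute)
    have "(\<Sum>i<n. degree (\<Phi> i ^ lookup m i)) = w m"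
      unfolding w_def by (rule sum.cong) (auto simp: pw)
    moreover have "(\<Sum>i<n. sec (\<Phi> i ^ lookup m i)) = (\<Sum>i<n. of_nat (lookup m i) * sec (\<Phi> i))"
      by (rule sum.cong) (auto simp: pw)
    ultimately show ?thesis
      unfolding m using monicp_prod[of "{..<n}" "\<lambda>i. \<Phi> i ^ lookup m i"] pw(1) by simp
  qed
  have mon: "lead_coeff (mon \<Phi> m) = 1 \<and> degree (mon \<Phi> m) = w m \<and> sec (mon \<Phi> m) = (\<Sum>i<n. of_nat (lookup m i) * sec (\<Phi> i))"
    if "m \<in> keys p" for m
    using mon'[OF that] by (auto dest: monicpD)
  define F where "F = uev \<Phi> p"
  have cF: "coeff F i = (\<Sum>m\<in>keys p. lookup p m * coeff (mon \<Phi> m) i)" for i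
    by (simp add: F_def ev_def coeff_sum)
  have split: "coeff F i = lookup p E * coeff (mon \<Phi> E) i +
    (\<Sum>m\<in>keys p - {E}. lookup p m * coeff (mon \<Phi> m) i)" for i
    unfolding cF using E(1) by (simp add: sum.remove)
  have top: "coeff F i = lookup p E * coeff (mon \<Phi> E) i" if "i \<ge> w E" for i
  proof -
    have "coeff (mon \<Phi> m) i = 0" if m: "m \<in> keys p - {E}" for m
      using mon[of m] E(2)[of m] m \<open>i \<ge> w E\<close> by (intro coeff_eq_0) auto
    then show ?thesis unfolding split by simp
  qed
  have E0: "lookup p E \<noteq> 0" using E(1) by (simp add: in_keys_iff)
  have "coeff (mon \<Phi> E) (w E) = 1" using mon[OF E(1)] by metis
  then have lE: "coeff F (w E) = lookup p E" using top[of "w E"] by simp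
  show d: "degree F = w E"
  proof (rule antisym)
    show "degree F \<le> w E"
    proof (rule degree_le, intro allI impI)
      fix i assume "w E < i"
      then show "coeff F i = 0" using top[of i] mon[OF E(1)] by (simp add: coeff_eq_0)
    qed
    show "w E \<le> degree F" using lE E0 by (intro le_degree) simp
  qed
  show "lead_coeff F = lookup p E" using lE d by simp
  assume wE: "w E \<noteq> 0"
  have "coeff (mon \<Phi> E) (w E - 1) = (\<Sum>i<n. of_nat (lookup E i) * sec (\<Phi> i))"
  proof -
    have dE: "degree (mon \<Phi> E) = w E" using mon[OF E(1)] by simp
    have "sec (mon \<Phi> E) = coeff (mon \<Phi> E) (w E - 1)" unfolding sec_eq dE using wE by simp
    then show ?thesis using mon[OF E(1)] by simp
  qed
  moreover have "(\<Sum>m\<in>keys p - {E}. lookup p m * coeff (mon \<Phi> m) (w E - 1)) =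
    (\<Sum>m\<in>keys p - {E}. if w m = w E - 1 then lookup p m else 0)"
  proof (rule sum.cong)
    fix m assume m: "m \<in> keys p - {E}"
    then have "w m < w E" using E(2) by auto
    then have "w m = w E - 1 \<or> w m < w E - 1" by auto
    then show "lookup p m * coeff (mon \<Phi> m) (w E - 1) = (if w m = w E - 1 then lookup p m else 0)"
      using mon[of m] m by (auto simp: coeff_eq_0)
  qed simp
  moreover have "\<dots> = (\<Sum>m\<in>{m\<in>keys p - {E}. w m = w E - 1}. lookup p m)"
    by (rule sum.inter_filter[symmetric]) simp
  moreover have "{m\<in>keys p - {E}. w m = w E - 1} = {m\<in>keys p. w m = w E - 1}"
    using wE by auto
  ultimately show "coeff F (w E - 1) = lookup p E * (\<Sum>i<n. of_nat (lookup E i) * sec (\<Phi> i))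
      + (\<Sum>m\<in>{m\<in>keys p. w m = w E - 1}. lookup p m)"
    unfolding split by simp
qed

end

section \<open>Two independent polynomials\<close>

lemma pair_independent:
  fixes F G :: "'a::field ratfun"
  assumes ind: "alg_independent const_field B" and FG: "F \<in> B" "G \<in> B" "F \<noteq> G" and S: "finite S" "(i, k) \<in> S"
    and eq: "(\<Sum>(i, k)\<in>S. K (a (i, k)) * F ^ i * G ^ k) = 0"
  shows "a (i, k) = 0"
proof -
  have ind2: "alg_independent const_field {F, G}"
    using ind FG by (auto simp: alg_independent_def)
  define \<alpha> where "\<alpha> = (\<lambda>(i, k). restrict (\<lambda>b. if b = F then i else k) {F, G} :: 'a ratfun \<Rightarrow> nat)"
  have \<alpha>: "\<alpha> (i, k) F = i" "\<alpha> (i, k) G = k" for i k using FG by (auto simp: \<alpha>_def)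
  have inj: "inj_on \<alpha> S"
    by (rule inj_onI, clarify) (metis \<alpha>)
  define b where "b = (\<lambda>x. K (a (x F, x G)))"
  have "(\<Sum>x\<in>\<alpha> ` S. b x * (\<Prod>y\<in>{F, G}. y ^ x y)) = (\<Sum>s\<in>S. b (\<alpha> s) * (\<Prod>y\<in>{F, G}. y ^ \<alpha> s y))"
    by (rule sum.reindex_cong[OF inj]) auto
  also have "\<dots> = (\<Sum>(i, k)\<in>S. K (a (i, k)) * F ^ i * G ^ k)"
    using FG by (intro sum.cong) (auto simp: b_def \<alpha> mult.assoc)
  finally have "b (\<alpha> (i, k)) = 0"
    using S eq by (intro alg_indep_monomials[OF ind2, of "\<alpha> ` S" b]) (auto simp: b_def const_field_eq \<alpha>_def split: if_splits intro: range_eqI[of _ _ 0])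
  then show ?thesis by (simp add: b_def \<alpha>)
qed

lemma trdeg_two_pair:
  fixes A :: "'a::field ratfun set"
  assumes A: "A \<subseteq> poly_ring n" and tr: "trdeg const_field A \<ge> 2"
  obtains f g :: "(nat, 'a) mpoly" where "of_mpoly f \<in> A" "of_mpoly g \<in> A"
    "\<And>S a i k. finite S \<Longrightarrow> (\<Sum>(i, k)\<in>S. cst (a (i, k)) * f ^ i * g ^ k) = 0 \<Longrightarrow> (i, k) \<in> S \<Longrightarrow> a (i, k) = 0"
proof -
  have "A \<subseteq> rat_field n" using A poly_ring_subset_rat_field by blast
  then obtain B where B: "B \<subseteq> A" "finite B" "alg_independent const_field B" "trdeg const_field A = enat (card B)"
    using trdeg_attained[of A const_field n] card_alg_independent_le[of _ n] by (metis subset_trans)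
  have "enat 2 \<le> enat (card B)" using tr B(4) by (simp add: numeral_eq_enat)
  then have "card B \<ge> 2" by simp
  then obtain F G where FG: "F \<in> B" "G \<in> B" "F \<noteq> G"
    by (metis One_nat_def card_le_Suc0_iff_eq B(2) not_less_eq_eq numeral_2_eq_2)
  then obtain f g where fg: "F = of_mpoly f" "G = of_mpoly g" using B A by (fastforce simp: poly_ring_def)
  have "a (i, k) = 0" if "finite S" "(\<Sum>(i, k)\<in>S. cst (a (i, k)) * f ^ i * g ^ k) = 0" "(i, k) \<in> S" for S a i k
  proof (rule pair_independent[OF B(3) FG that(1,3)])
    have "(\<Sum>(i, k)\<in>S. K (a (i, k)) * F ^ i * G ^ k) = of_mpoly (\<Sum>(i, k)\<in>S. cst (a (i, k)) * f ^ i * g ^ k)"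
      by (simp add: fg K_def case_prod_unfold)
    then show "(\<Sum>(i, k)\<in>S. K (a (i, k)) * F ^ i * G ^ k) = 0" using that(2) by simp
  qed
  then show thesis using that[of f g] FG B fg by blast
qed

section \<open>Subalgebras of a univariate polynomial ring\<close>

text \<open>P and P Q - 1 are coprime, so \<open>S\<close> contains elements of every large degree
  and has finite codimension in k[t]. Multiplication by t followed by reduction modulo
  \<open>S\<close> then has a kernel on a large enough finite-dimensional part of \<open>S\<close>;
  its elements \<open>u\<close> satisfy t u \<in> S.\<close>

lemma conductor_exists:
  fixes S :: "'a::field poly set" and p r :: "'a poly"
  assumes one: "1 \<in> S" and add: "\<And>f g. f \<in> S \<Longrightarrow> g \<in> S \<Longrightarrow> f + g \<in> S"
    and mult: "\<And>f g. f \<in> S \<Longrightarrow> g \<in> S \<Longrightarrow> f * g \<in> S" and cst: "\<And>c. [:c:] \<in> S"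
    and p: "p \<in> S" "degree p = P" "P \<ge> 1" and r: "r \<in> S" "r \<noteq> 0" "degree r = P * Q - 1" "Q \<ge> 1"
  obtains u where "u \<in> S" "[:0, 1:] * u \<in> S" "lead_coeff u = 1" "degree u \<ge> 1"
proof -
  have pow: "f ^ e \<in> S" if "f \<in> S" for f e by (induction e) (auto intro: one mult that)
  have sm: "smult c f \<in> S" if "f \<in> S" for c f using mult[OF cst[of c] that] by simp
  have zero: "0 \<in> S" using cst[of 0] by simp
  have diff: "f - g \<in> S" if "f \<in> S" "g \<in> S" for f g using add[OF that(1) sm[OF that(2), of "-1"]] by simp
  have sum: "sum f X \<in> S" if "\<And>x. x \<in> X \<Longrightarrow> f x \<in> S" for f :: "nat \<Rightarrow> 'a poly" and X
    using that by (induction X rule: infinite_finite_induct) (auto intro: zero add)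
  \<comment> \<open>From here on every degree is attained: fewer than P factors \<open>r\<close> are
    needed, and together they have degree less than P (P Q).\<close>
  define N0 where "N0 = P * (P * Q)"
  have N0: "N0 \<ge> 1" using p r by (simp add: N0_def)
  have deg: "\<exists>f\<in>S. degree f = N \<and> lead_coeff f = 1" if "N \<ge> N0" for N
  proof -
    have p0: "p \<noteq> 0" using p by auto
    \<comment> \<open>The degree of \<open>r\<close> is -1 modulo P, so \<open>b\<close> factors
      \<open>r\<close> correct the residue of N: N + b is divisible by P.\<close>
    define b where "b = (P - N mod P) mod P"
    have b: "b \<le> P - 1" "(N + b) mod P = 0"
    proof -
      have "b < P" using p by (simp add: b_def)
      then show "b \<le> P - 1" by simp
      have "(N + b) mod P = (N mod P + (P - N mod P)) mod P" unfolding b_def by presburger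
      also have "\<dots> = 0" using p by (simp add: less_imp_le)
      finally show "(N + b) mod P = 0" .
    qed
    have "b * (P * Q - 1) + b = b * (P * Q)" using p r by (simp add: algebra_simps)
    also have "\<dots> \<le> N0" unfolding N0_def using b by (intro mult_right_mono) auto
    finally have bN: "b * (P * Q - 1) + b \<le> N" using that by simp
    then have "N + b - (b * (P * Q - 1) + b) = N - b * (P * Q - 1)" by simp
    moreover have "P dvd N + b" using b(2) by auto
    moreover have "b * (P * Q - 1) + b = P * (b * Q)"
      using \<open>b * (P * Q - 1) + b = b * (P * Q)\<close> by (simp add: mult_ac)
    ultimately have "P dvd N - b * (P * Q - 1)" by (metis dvd_diff_nat dvd_triv_left)
    then obtain a where a: "N - b * (P * Q - 1) = P * a" by (elim dvdE)
    define f where "f = p ^ a * r ^ b"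
    have f0: "f \<noteq> 0" using p0 r by (simp add: f_def)
    have "degree f = a * P + b * (P * Q - 1)"
      using p0 p r by (simp add: f_def degree_mult_eq degree_power_eq)
    then have "degree f = N" using a bN by (simp add: mult.commute)
    moreover have "f \<in> S" unfolding f_def by (intro mult pow p r)
    ultimately show ?thesis using f0
      by (intro bexI[of _ "smult (inverse (lead_coeff f)) f"] sm) auto
  qed
  have red: "\<exists>s\<in>S. s = h \<or> degree (h - s) < N0" for h
  proof (induction "degree h" arbitrary: h rule: less_induct)
    case less
    show ?case
    proof (cases "degree h < N0")
      case True
      then show ?thesis using zero by (intro bexI[of _ 0]) auto
    next
      case False
      then obtain f where f: "f \<in> S" "degree f = degree h" "lead_coeff f = 1" using deg[of "degree h"] by auto
      define h' where "h' = h - smult (lead_coeff h) f"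
      have "degree h' < degree h"
      proof (rule ccontr)
        assume n: "\<not> degree h' < degree h"
        have "degree h' \<le> degree h" unfolding h'_def using f by (intro degree_diff_le) auto
        then have d: "degree h' = degree h" using n by simp
        have "coeff h' (degree h) = 0" using f by (simp add: h'_def)
        then have "h' = 0" by (metis d leading_coeff_0_iff)
        then show False using d False N0 by simp
      qed
      from less[OF this] obtain s where s: "s \<in> S" "s = h' \<or> degree (h' - s) < N0" by auto
      have "s + smult (lead_coeff h) f \<in> S" by (intro add sm s f)
      moreover have "h' - s = h - (s + smult (lead_coeff h) f)" by (simp add: h'_def)
      ultimately show ?thesis using s(2) by (intro bexI[of _ "s + smult (lead_coeff h) f"]) (auto simp: h'_def algebra_simps)
    qed
  qed
  \<comment> \<open>N0 + 1 elements of \<open>S\<close> against the N0 coefficients of a reduced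
    polynomial.\<close>
  define X where "X = {N0..2 * N0}"
  obtain f where f: "\<And>N. N \<in> X \<Longrightarrow> f N \<in> S \<and> degree (f N) = N \<and> lead_coeff (f N) = 1"
    using deg unfolding X_def by (metis atLeastAtMost_iff)
  obtain s where s: "\<And>h. s h \<in> S \<and> (s h = h \<or> degree (h - s h) < N0)"
    using red by metis
  define rem where "rem = (\<lambda>N. [:0, 1:] * f N - s ([:0, 1:] * f N))"
  have "card {..<N0} < card X" by (simp add: X_def)
  from kernel_exists[OF _ _ this, of "\<lambda>N. coeff (rem N)"] obtain a where
    a: "\<exists>N\<in>X. a N \<noteq> 0" "\<And>y. y < N0 \<Longrightarrow> (\<Sum>N\<in>X. a N * coeff (rem N) y) = 0"
    unfolding X_def by auto
  have z: "(\<Sum>N\<in>X. smult (a N) (rem N)) = 0"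
  proof (rule poly_eqI)
    fix y show "coeff (\<Sum>N\<in>X. smult (a N) (rem N)) y = coeff 0 y"
    proof (cases "y < N0")
      case True
      then show ?thesis using a(2) by (simp add: coeff_sum)
    next
      case False
      have "coeff (rem N) y = 0" for N
      proof (cases "rem N = 0")
        case False
        then have "degree (rem N) < N0" using s[of "[:0, 1:] * f N"] by (auto simp: rem_def)
        then show ?thesis using \<open>\<not> y < N0\<close> by (intro coeff_eq_0) simp
      qed simp
      then show ?thesis by (simp add: coeff_sum)
    qed
  qed
  define u where "u = (\<Sum>N\<in>X. smult (a N) (f N))"
  have uS: "u \<in> S" unfolding u_def using f by (intro sum sm) auto
  have "[:0, 1:] * u = (\<Sum>N\<in>X. smult (a N) (rem N)) + (\<Sum>N\<in>X. smult (a N) (s ([:0, 1:] * f N)))"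
    unfolding u_def rem_def sum_distrib_left sum.distrib[symmetric] by (intro sum.cong) (simp_all add: smult_diff_right)
  then have tuS: "[:0, 1:] * u \<in> S" using s by (simp only: z add_0_left) (intro sum sm, blast)
  \<comment> \<open>The largest degree with a nonzero coefficient; it is at least 1, so
    \<open>u\<close> is not constant.\<close>
  define N where "N = Max {N \<in> X. a N \<noteq> 0}"
  have finX: "finite {N \<in> X. a N \<noteq> 0}" by (simp add: X_def)
  have N: "N \<in> X" "a N \<noteq> 0" "\<And>N'. N' \<in> X \<Longrightarrow> a N' \<noteq> 0 \<Longrightarrow> N' \<le> N"
    using Max_in[OF finX] Max_ge[OF finX] a(1) by (auto simp: N_def)
  have "coeff u N = (\<Sum>N'\<in>X. if N' = N then a N else 0)"
    unfolding u_def coeff_sum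
  proof (rule sum.cong)
    fix N' assume N': "N' \<in> X"
    show "coeff (smult (a N') (f N')) N = (if N' = N then a N else 0)"
    proof (cases "N' = N")
      case True
      then show ?thesis using f[OF N'] by auto
    next
      case False
      then have "a N' = 0 \<or> N' < N" using N(3)[OF N'] by (metis le_neq_implies_less)
      then show ?thesis using f[OF N'] False by (auto simp: coeff_eq_0)
    qed
  qed simp
  then have cu: "coeff u N \<noteq> 0" using N by (simp add: X_def)
  then have "degree u \<ge> N" by (rule le_degree)
  moreover have "N \<ge> 1" using N(1) N0 by (simp add: X_def)
  ultimately have du: "degree u \<ge> 1" by simp
  have u0: "u \<noteq> 0" using cu by auto
  define u' where "u' = smult (inverse (lead_coeff u)) u"
  have "u' \<in> S" unfolding u'_def by (intro sm uS)
  moreover have "[:0, 1:] * u' \<in> S" using sm[OF tuS, of "inverse (lead_coeff u)"] by (simp add: u'_def)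
  moreover have "lead_coeff u' = 1" "degree u' \<ge> 1" using u0 du by (simp_all add: u'_def)
  ultimately show thesis by (rule that)
qed

section \<open>The curve\<close>

lemma monicp_pCons: "monicp [:c, 1:]"
  by (simp add: monicp_def)

lemma sec_pCons: "sec [:c, 1:] = c"
  by (simp add: sec_eq)

text \<open>Take \<mu> \<psi> + (\<rho> mod \<mu>): the two highest coefficients are set through
  \<psi>, of degree W - deg \<mu> \<ge> 1, and the remainder is too small to disturb them.\<close>

lemma prescribed_residue:
  fixes \<mu> \<rho> :: "'a::field poly"
  assumes \<mu>: "lead_coeff \<mu> = 1" "degree \<mu> \<ge> 2" and W: "W > degree \<mu>"
  obtains \<phi> where "monicp \<phi>" "degree \<phi> = W" "sec \<phi> = c" "\<mu> dvd \<phi> - \<rho>"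
proof -
  define d where "d = degree \<mu>"
  have m\<mu>: "monicp \<mu>" using \<mu> by (simp add: monicp_def)
  define \<psi> where "\<psi> = [:0, 1:] ^ (W - d - 1) * [:c - sec \<mu>, 1:]"
  have x: "monicp ([:0, 1:] ^ k :: 'a poly)" "degree ([:0, 1:] ^ k :: 'a poly) = k" "sec ([:0, 1:] ^ k :: 'a poly) = 0" for k
    using monicp_power[OF monicp_pCons[of "0 :: 'a"], of k] by (simp_all add: sec_pCons)
  have \<psi>: "monicp \<psi>" "degree \<psi> = W - d" "sec \<psi> = c - sec \<mu>"
    unfolding \<psi>_def using monicp_mult[OF x(1)[of "W - d - 1"] monicp_pCons[of "c - sec \<mu>"]] x[of "W - d - 1"] W
    by (simp_all add: sec_pCons d_def)
  have p: "monicp (\<mu> * \<psi>)" "degree (\<mu> * \<psi>) = W" "sec (\<mu> * \<psi>) = c"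
    using monicp_mult[OF m\<mu> \<psi>(1)] \<psi> W by (simp_all add: d_def)
  define r where "r = \<rho> mod \<mu>"
  have r: "r = 0 \<or> degree r < d" unfolding r_def d_def using \<mu> by (intro degree_mod_less) auto
  define \<phi> where "\<phi> = \<mu> * \<psi> + r"
  have cr: "coeff r i = 0" if "i \<ge> d" for i using r that by (auto intro: coeff_eq_0)
  have c\<phi>: "coeff \<phi> i = coeff (\<mu> * \<psi>) i" if "i \<ge> d" for i using cr[OF that] by (simp add: \<phi>_def)
  have deg: "degree \<phi> = W"
  proof (rule antisym)
    show "degree \<phi> \<le> W"
      by (rule degree_le) (use W p(2) in \<open>auto simp: c\<phi> coeff_eq_0 d_def\<close>)
    have "coeff \<phi> W = 1" using c\<phi>[of W] W p(1,2) by (auto simp: d_def monicp_def)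
    then show "W \<le> degree \<phi>" by (intro le_degree) simp
  qed
  have "monicp \<phi>" unfolding monicp_def deg using c\<phi>[of W] W p(1,2) by (auto simp: d_def monicp_def)
  moreover have "sec \<phi> = c"
    using c\<phi>[of "W - 1"] W p(2,3) by (auto simp: sec_eq deg d_def)
  moreover have "\<mu> dvd \<phi> - \<rho>"
  proof -
    have "\<phi> - \<rho> = \<mu> * \<psi> + (\<rho> mod \<mu> - \<rho>)" by (simp add: \<phi>_def r_def)
    moreover have "\<mu> dvd \<rho> mod \<mu> - \<rho>" by (metis dvd_minus_mod dvd_diff_commute)
    ultimately show ?thesis by (metis dvd_add dvd_triv_left)
  qed
  ultimately show thesis using that deg by blast
qed

lemma ev_cong_mod:
  fixes \<Phi> \<rho> :: "nat \<Rightarrow> 'a::field poly"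
  assumes "\<And>i. i < n \<Longrightarrow> \<mu> dvd \<Phi> i - \<rho> i" "poly_vars p \<subseteq> {..<n}"
  shows "\<mu> dvd uev \<Phi> p - uev \<rho> p"
  using assms(2)
proof (induction p rule: mpoly_induct)
  case (cst c)
  then show ?case by (simp add: rhom.ev_cst[OF rhom_const_poly])
next
  case (var i)
  then show ?case using assms(1) by (simp add: rhom.ev_var[OF rhom_const_poly])
next
  case (add p q)
  from dvd_add[OF add] show ?case by (simp add: rhom.ev_add[OF rhom_const_poly] algebra_simps)
next
  case (mult p q)
  have "x * y - x' * y' = (x - x') * y + x' * (y - y')" for x y x' y' :: "'a poly" by (simp add: algebra_simps)
  then show ?case using mult by (simp add: rhom.ev_mult[OF rhom_const_poly])
qed

locale subalgebra =
  fixes n :: nat and A :: "'a::field_char_0 ratfun set"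
  assumes A: "is_subring A" and A_sub: "A \<subseteq> poly_ring n" and cst_A: "K c \<in> A"
begin

lemma of_mpoly_A:
  "of_mpoly (cst c) \<in> A" "of_mpoly p \<in> A \<Longrightarrow> of_mpoly q \<in> A \<Longrightarrow> of_mpoly (p + q) \<in> A"
  "of_mpoly p \<in> A \<Longrightarrow> of_mpoly q \<in> A \<Longrightarrow> of_mpoly (p * q) \<in> A"
  "of_mpoly p \<in> A \<Longrightarrow> of_mpoly (p ^ k) \<in> A"
  "(\<And>x. x \<in> S \<Longrightarrow> of_mpoly (f x) \<in> A) \<Longrightarrow> of_mpoly (sum f S) \<in> A"
proof -
  show "of_mpoly (sum f S) \<in> A" if "\<And>x. x \<in> S \<Longrightarrow> of_mpoly (f x) \<in> A"
    using is_subringD(8)[OF A, of S "\<lambda>x. of_mpoly (f x)"] that by simp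
qed (use cst_A is_subringD[OF A] in \<open>auto simp: K_def\<close>)

lemma vars_A: "of_mpoly p \<in> A \<Longrightarrow> poly_vars p \<subseteq> {..<n}"
  by (drule subsetD[OF A_sub]) (auto simp: poly_ring_def)

definition restr :: "(nat \<Rightarrow> 'a poly) \<Rightarrow> 'a poly set" where
  "restr \<Phi> = {uev \<Phi> p | p. of_mpoly p \<in> A}"

lemma restr_closed:
  "1 \<in> restr \<Phi>" "[:c:] \<in> restr \<Phi>" "x \<in> restr \<Phi> \<Longrightarrow> y \<in> restr \<Phi> \<Longrightarrow> x + y \<in> restr \<Phi>"
  "x \<in> restr \<Phi> \<Longrightarrow> y \<in> restr \<Phi> \<Longrightarrow> x * y \<in> restr \<Phi>"
proof -
  interpret rhom "uev \<Phi>" by (rule rhom.rhom_ev[OF rhom_const_poly])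
  show c: "[:c:] \<in> restr \<Phi>" for c
    unfolding restr_def
    by (intro CollectI exI[of _ "cst c"]) (simp add: of_mpoly_A rhom.ev_cst[OF rhom_const_poly])
  show "1 \<in> restr \<Phi>" using c[of 1] by (simp add: one_pCons)
  assume "x \<in> restr \<Phi>" "y \<in> restr \<Phi>"
  then obtain p q where *: "x = uev \<Phi> p" "of_mpoly p \<in> A" "y = uev \<Phi> q" "of_mpoly q \<in> A"
    by (auto simp: restr_def)
  have "x + y = uev \<Phi> (p + q)" "x * y = uev \<Phi> (p * q)" by (simp_all add: *)
  then show "x + y \<in> restr \<Phi>" "x * y \<in> restr \<Phi>"
    unfolding restr_def using of_mpoly_A(2)[OF *(2,4)] of_mpoly_A(3)[OF *(2,4)] by blast+
qed

text \<open>
  Adding multiples of \<open>\<mu>\<close> leaves the two highest coefficients of \<open>\<Phi> i\<close> free.  Widely spaced degrees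
  identify the leading monomials of \<open>f\<close> and \<open>g\<close>, and a generic second coefficient makes the difference
  of suitable powers drop in degree by exactly one.
\<close>

lemma coprime_degrees_exist:
  fixes f g :: "(nat, 'a) mpoly" and \<mu> :: "'a poly"
  assumes fg: "of_mpoly f \<in> A" "of_mpoly g \<in> A"
    and ind: "\<And>S a i k. finite S \<Longrightarrow> (\<Sum>(i, k)\<in>S. cst (a (i, k)) * f ^ i * g ^ k) = 0 \<Longrightarrow> (i, k) \<in> S \<Longrightarrow> a (i, k) = 0"
    and j: "j < n" and \<mu>: "lead_coeff \<mu> = 1" "degree \<mu> \<ge> 2" and \<rho>: "\<rho> j = [:0, 1:]"
  obtains \<Phi> P Q p r where "\<Phi> j = [:0, 1:]" "\<And>i. i < n \<Longrightarrow> \<mu> dvd \<Phi> i - \<rho> i"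
    "p \<in> restr \<Phi>" "degree p = P" "P \<ge> 1" "r \<in> restr \<Phi>" "r \<noteq> 0" "degree r = P * Q - 1" "Q \<ge> 1"
proof -
  \<comment> \<open>x_j has weight 1 because its image t has degree 1; the others get degrees
    B^(i+1), larger than deg \<mu> as \<open>prescribed_residue\<close> requires.\<close>
  define e where "e = (\<lambda>i. if i = j then 0 else Suc i)"
  have inj_e: "inj_on e {..<n}" by (auto simp: inj_on_def e_def)
  obtain Df Dg where D: "boxed n Df f" "boxed n Dg g" using vars_A[OF fg(1)] vars_A[OF fg(2)] boxed_exists by metis
  define C where "C = Df + Dg"
  \<comment> \<open>Then (d+1)^2 products f^i g^k face at most D + 1 = d C + 1 linear
    conditions.\<close>
  define d where "d = C + 1"
  define D where "D = d * C"
  define B where "B = Suc (max D (degree \<mu>))"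
  have B: "D < B" "degree \<mu> < B" by (auto simp: B_def)
  interpret weights n B D e by unfold_locales (use inj_e B in auto)
  have bf: "boxed n D f" using D(1) by (rule boxed_mono) (simp add: D_def d_def C_def algebra_simps)
  have f0: "f \<noteq> 0"
  proof
    assume "f = 0"
    then have "(\<Sum>(i, k)\<in>{(1, 0)}. cst 1 * f ^ i * g ^ k) = 0" by simp
    from ind[OF _ this, of 1 0] show False by simp
  qed
  have fc: "f \<noteq> cst c" for c
  proof
    assume f: "f = cst c"
    define a :: "nat \<times> nat \<Rightarrow> 'a" where "a = (\<lambda>s. if s = (0, 0) then - c else 1)"
    have "(\<Sum>(i, k)\<in>{(0, 0), (1, 0)}. cst (a (i, k)) * f ^ i * g ^ k) = cst (- c) + cst 1 * cst c"
      by (simp add: a_def f)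
    also have "\<dots> = 0" by (simp add: rhom.hom_uminus[OF rhom_cst] rhom.hom_one[OF rhom_cst])
    finally have "a (1, 0) = 0" using ind[of "{(0, 0), (1, 0)}" a 1 0] by simp
    then show False by (simp add: a_def)
  qed
  obtain E where E: "E \<in> keys f" "\<And>m. m \<in> keys f \<Longrightarrow> m \<noteq> E \<Longrightarrow> w m < w E"
    using top_exists[OF f0 bf] by metis
  have w0: "w m = 0 \<Longrightarrow> m = 0" if "m \<in> box n D" for m
    using w_inj[OF that, of 0] by (simp add: w_def box_def)
  have Eb: "E \<in> box n D" using E(1) bf by (auto simp: boxed_def)
  have P: "w E \<ge> 1"
  proof (rule ccontr)
    assume "\<not> w E \<ge> 1"
    then have wE: "w E = 0" by simp
    then have "E = 0" using w0 Eb by blast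
    then have "keys f \<subseteq> {0}" using E(2) wE by fastforce
    then have "f = cst (lookup f 0)"
      by (intro poly_mapping_eqI) (auto simp: cst_def lookup_single when_def in_keys_iff)
    then show False using fc by blast
  qed
  obtain i0 where i0: "i0 < n" "lookup E i0 \<noteq> 0"
  proof (rule ccontr)
    assume "\<not> thesis"
    then have "w E = 0" using that by (auto simp: w_def)
    then show False using P by simp
  qed
  define X where "X = {..d} \<times> {..d}"
  \<comment> \<open>The monomials proportional to the top monomial \<open>E\<close> of
    \<open>f\<close>, each determined by its exponent at \<open>i0\<close>. A combination of the f^i
    g^k in which all of them cancel has a top monomial not proportional to \<open>E\<close>.\<close>
  define Y where "Y = {m \<in> box n D. \<forall>i<n. lookup m i * lookup E i0 = lookup E i * lookup m i0}"
  have finY: "finite Y" unfolding Y_def using finite_box by simp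
  have "card Y \<le> card {..D}"
  proof (rule card_inj_on_le)
    show "inj_on (\<lambda>m. lookup m i0) Y"
    proof (rule inj_onI, rule poly_mapping_eqI)
      fix m m' i assume m: "m \<in> Y" "m' \<in> Y" "lookup m i0 = lookup m' i0"
      show "lookup m i = lookup m' i"
      proof (cases "i < n")
        case True
        then have "lookup m i * lookup E i0 = lookup m' i * lookup E i0"
          using m by (simp add: Y_def)
        then show ?thesis using i0 by simp
      next
        case False
        then have "i \<notin> keys m" "i \<notin> keys m'" using m by (auto simp: Y_def box_def)
        then show ?thesis by (simp add: in_keys_iff)
      qed
    qed
  qed (auto simp: Y_def box_def)
  also have "\<dots> < card X" by (simp add: X_def D_def d_def algebra_simps)
  finally obtain a where a: "\<exists>s\<in>X. a s \<noteq> 0"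
    "\<And>y. y \<in> Y \<Longrightarrow> (\<Sum>s\<in>X. a s * lookup (f ^ fst s * g ^ snd s) y) = 0"
    using kernel_exists[OF finY, of X "\<lambda>s. lookup (f ^ fst s * g ^ snd s)"] by (auto simp: X_def)
  define r where "r = (\<Sum>s\<in>X. cst (a s) * (f ^ fst s * g ^ snd s))"
  have rA: "of_mpoly r \<in> A" unfolding r_def by (intro of_mpoly_A fg)
  have lr: "lookup r y = (\<Sum>s\<in>X. a s * lookup (f ^ fst s * g ^ snd s) y)" for y
    by (simp add: r_def lookup_sum lookup_cst_mult)
  have r0: "r \<noteq> 0"
  proof
    assume "r = 0"
    then have "(\<Sum>(i, k)\<in>X. cst (a (i, k)) * f ^ i * g ^ k) = 0"
      by (simp add: r_def case_prod_unfold mult.assoc)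
    then have "a (i, k) = 0" if "(i, k) \<in> X" for i k
      using ind[of X a i k] that by (simp add: X_def)
    then show False using a(1) by auto
  qed
  have br: "boxed n D r"
    unfolding boxed_def
  proof
    fix y assume y: "y \<in> keys r"
    show "y \<in> box n D"
    proof (rule ccontr)
      assume nb: "y \<notin> box n D"
      have "lookup (f ^ fst s * g ^ snd s) y = 0" if s: "s \<in> X" for s
      proof -
        have "boxed n (fst s * Df + snd s * Dg) (f ^ fst s * g ^ snd s)"
          by (intro boxed_mult boxed_power D)
        moreover have "fst s * Df + snd s * Dg \<le> D"
          using s by (auto simp: X_def D_def C_def distrib_left intro!: add_mono mult_right_mono)
        ultimately have "boxed n D (f ^ fst s * g ^ snd s)" by (rule boxed_mono)
        then show ?thesis using nb by (auto simp: boxed_def in_keys_iff)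
      qed
      then show False using y by (simp add: in_keys_iff lr)
    qed
  qed
  obtain E' where E': "E' \<in> keys r" "\<And>m. m \<in> keys r \<Longrightarrow> m \<noteq> E' \<Longrightarrow> w m < w E'"
    using top_exists[OF r0 br] by metis
  have E'b: "E' \<in> box n D" using E'(1) br by (auto simp: boxed_def)
  have E'Y: "E' \<notin> Y" using E'(1) a(2)[of E'] by (auto simp: in_keys_iff lr)
  have Q: "w E' \<ge> 1"
  proof (rule ccontr)
    assume "\<not> w E' \<ge> 1"
    then have "E' = 0" using w0[OF E'b] by simp
    then show False using E'Y by (simp add: Y_def box_def)
  qed
  \<comment> \<open>The second coefficient of \<open>\<Phi> j\<close> is fixed, so proportionality
    has to fail at another variable. If it held at all others, comparing the total weights would
    give it at \<open>j\<close> as well.\<close>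
  have "\<exists>i<n. i \<noteq> j \<and> w E' * lookup E i \<noteq> w E * lookup E' i"
  proof (rule ccontr)
    assume "\<not> ?thesis"
    then have eq: "w E' * lookup E i = w E * lookup E' i" if "i < n" "i \<noteq> j" for i
      using that by blast
    have wsp: "w m = lookup m j + (\<Sum>i\<in>{..<n} - {j}. B ^ e i * lookup m i)" for m
      unfolding w_def using j by (subst sum.remove[of _ j]) (auto simp: e_def)
    have "w E' * (\<Sum>i\<in>{..<n} - {j}. B ^ e i * lookup E i) = w E * (\<Sum>i\<in>{..<n} - {j}. B ^ e i * lookup E' i)"
      unfolding sum_distrib_left by (rule sum.cong) (auto simp: eq mult.left_commute)
    moreover have "w E' * (lookup E j + (\<Sum>i\<in>{..<n} - {j}. B ^ e i * lookup E i)) =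
      w E * (lookup E' j + (\<Sum>i\<in>{..<n} - {j}. B ^ e i * lookup E' i))"
      unfolding wsp[symmetric] by (rule mult.commute)
    ultimately have "w E' * lookup E j = w E * lookup E' j"
      unfolding distrib_left by simp
    then have eq': "w E' * lookup E i = w E * lookup E' i" if "i < n" for i
      using eq[OF that] by (cases "i = j") auto
    have "lookup E' i * lookup E i0 = lookup E i * lookup E' i0" if "i < n" for i
    proof -
      have "w E * (lookup E' i * lookup E i0) = w E' * lookup E i * lookup E i0"
        using eq'[OF that] by simp
      also have "\<dots> = lookup E i * (w E * lookup E' i0)"
        using eq'[OF i0(1)] by (simp add: mult_ac)
      finally have "w E * (lookup E' i * lookup E i0) = w E * (lookup E i * lookup E' i0)"
        by (simp add: mult_ac)
      then show ?thesis using P by simp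
    qed
    then show False using E'Y E'b by (simp add: Y_def)
  qed
  then obtain i1 where i1: "i1 < n" "i1 \<noteq> j" "w E' * lookup E i1 \<noteq> w E * lookup E' i1" by blast
  \<comment> \<open>A one-parameter family of curves congruent to \<rho> modulo \<mu>:
    \<open>t\<close> is the second coefficient at \<open>i1\<close>, and the other second
    coefficients are 0.\<close>
  define G where "G = (\<lambda>(t::'a) i \<phi>. (if i = j then \<phi> = [:0, 1:] else \<mu> dvd \<phi> - \<rho> i) \<and> monicp \<phi> \<and>
    degree \<phi> = B ^ e i \<and> sec \<phi> = (if i = i1 then t else 0))"
  have "\<exists>\<phi>. G t i \<phi>" for t i
  proof (cases "i = j")
    case True
    then show ?thesis using i1(2) by (auto simp: G_def monicp_pCons sec_pCons e_def)
  next
    case False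
    have "B ^ e i \<ge> B" using False B by (simp add: e_def)
    then have "B ^ e i > degree \<mu>" using B by linarith
    from prescribed_residue[OF \<mu> this, of "if i = i1 then t else 0" "\<rho> i"] show ?thesis
      using False unfolding G_def by metis
  qed
  then obtain \<Psi> where \<Psi>: "\<And>t i. G t i (\<Psi> t i)" by metis
  have \<Psi>m: "monicp (\<Psi> t i) \<and> degree (\<Psi> t i) = B ^ e i" and \<Psi>s: "sec (\<Psi> t i) = (if i = i1 then t else 0)" for t i
    using \<Psi>[of t i] by (auto simp: G_def)
  \<comment> \<open>Within the family, the second coefficient of a normalised restriction is affine
    in \<open>t\<close>; its slope is the exponent of \<open>i1\<close> in the top monomial.\<close>
  have key: "\<exists>\<gamma>. \<forall>t. \<exists>q\<in>restr (\<Psi> t). monicp q \<and> degree q = w E \<and> sec q = t * of_nat (lookup E i1) + \<gamma>"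
    if p: "of_mpoly p \<in> A" "boxed n D p" "E \<in> keys p" "\<And>m. m \<in> keys p \<Longrightarrow> m \<noteq> E \<Longrightarrow> w m < w E" "w E \<ge> 1"
    for p E
  proof (rule exI, rule allI)
    fix t
    let ?F = "uev (\<Psi> t) p" and ?l = "lookup p E"
    have l: "?l \<noteq> 0" using p(3) by (simp add: in_keys_iff)
    have d: "degree ?F = w E" "lead_coeff ?F = ?l"
      "coeff ?F (w E - 1) = ?l * (\<Sum>i<n. of_nat (lookup E i) * sec (\<Psi> t i))
        + (\<Sum>m\<in>{m\<in>keys p. w m = w E - 1}. lookup p m)"
      using ev_degree[OF p(2-4) \<Psi>m] p(5) by simp_all
    have s: "(\<Sum>i<n. of_nat (lookup E i) * sec (\<Psi> t i)) = t * of_nat (lookup E i1)"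
    proof -
      have "(\<Sum>i<n. of_nat (lookup E i) * sec (\<Psi> t i)) = (\<Sum>i<n. if i = i1 then t * of_nat (lookup E i1) else 0)"
        by (rule sum.cong) (auto simp: \<Psi>s)
      then show ?thesis using i1 by simp
    qed
    let ?q = "[:inverse ?l:] * ?F"
    have "?F \<in> restr (\<Psi> t)" unfolding restr_def using p by blast
    then have "?q \<in> restr (\<Psi> t)" by (intro restr_closed)
    moreover have dq: "degree ?q = w E" using d l by simp
    moreover have "monicp ?q" unfolding monicp_def using d l by simp
    moreover have "sec ?q = t * of_nat (lookup E i1) + inverse ?l * (\<Sum>m\<in>{m\<in>keys p. w m = w E - 1}. lookup p m)"
    proof -
      have "sec ?q = coeff ?q (w E - 1)" unfolding sec_eq dq using p(5) by simp
      also have "\<dots> = inverse ?l * coeff ?F (w E - 1)" by simp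
      also have "\<dots> = t * of_nat (lookup E i1) + inverse ?l * (\<Sum>m\<in>{m\<in>keys p. w m = w E - 1}. lookup p m)"
        unfolding d(3) s distrib_left mult.assoc[symmetric] using l by simp
      finally show ?thesis .
    qed
    ultimately show "\<exists>q\<in>restr (\<Psi> t). monicp q \<and> degree q = w E \<and> sec q = t * of_nat (lookup E i1)
      + inverse ?l * (\<Sum>m\<in>{m\<in>keys p. w m = w E - 1}. lookup p m)" by blast
  qed
  obtain \<gamma> where \<gamma>: "\<And>t. \<exists>q\<in>restr (\<Psi> t). monicp q \<and> degree q = w E \<and> sec q = t * of_nat (lookup E i1) + \<gamma>"
    using key[OF fg(1) bf E P] by metis
  obtain \<gamma>' where \<gamma>': "\<And>t. \<exists>q\<in>restr (\<Psi> t). monicp q \<and> degree q = w E' \<and> sec q = t * of_nat (lookup E' i1) + \<gamma>'"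
    using key[OF rA br E' Q] by metis
  \<comment> \<open>Suitable powers of the two restrictions are monic of the same degree
    \<open>w E * w E'\<close>. By the choice of \<open>i1\<close> and characteristic 0 their second
    coefficients have different slopes in \<open>t\<close>, so they differ for some
    \<open>t\<close>.\<close>
  have "\<exists>t. of_nat (w E') * (t * of_nat (lookup E i1) + \<gamma>) \<noteq> of_nat (w E) * (t * of_nat (lookup E' i1) + \<gamma>')"
  proof (rule ccontr)
    assume "\<not> ?thesis"
    then have eq: "of_nat (w E') * (t * of_nat (lookup E i1) + \<gamma>) = of_nat (w E) * (t * of_nat (lookup E' i1) + \<gamma>')" for t
      by blast
    have "of_nat (w E' * lookup E i1) = (of_nat (w E * lookup E' i1) :: 'a)"
      using eq[of 0] eq[of 1] by (simp add: distrib_left)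
    then show False using i1(3) by (simp only: of_nat_eq_iff)
  qed
  then obtain t where t: "of_nat (w E') * (t * of_nat (lookup E i1) + \<gamma>) \<noteq> of_nat (w E) * (t * of_nat (lookup E' i1) + \<gamma>')" by blast
  obtain p where p: "p \<in> restr (\<Psi> t)" "monicp p" "degree p = w E" "sec p = t * of_nat (lookup E i1) + \<gamma>"
    using \<gamma> by blast
  obtain q where q: "q \<in> restr (\<Psi> t)" "monicp q" "degree q = w E'" "sec q = t * of_nat (lookup E' i1) + \<gamma>'"
    using \<gamma>' by blast
  have pow: "x ^ k \<in> restr (\<Psi> t)" if "x \<in> restr (\<Psi> t)" for x k
    by (induction k) (auto intro: restr_closed that)
  have "p ^ w E' + [:-1:] * q ^ w E \<in> restr (\<Psi> t)"
    by (intro restr_closed pow p q)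
  then have rr: "p ^ w E' - q ^ w E \<in> restr (\<Psi> t)" by simp
  have "degree (p ^ w E' - q ^ w E) = degree (p ^ w E') - 1 \<and> p ^ w E' - q ^ w E \<noteq> 0"
    by (rule monic_diff_degree) (use monicp_power[OF p(2), of "w E'"] monicp_power[OF q(2), of "w E"] p q t in simp_all)
  then have dr: "degree (p ^ w E' - q ^ w E) = w E * w E' - 1" "p ^ w E' - q ^ w E \<noteq> 0"
    using monicp_power[OF p(2), of "w E'"] p(3) by (simp_all add: mult.commute)
  show thesis
  proof (rule that[of "\<Psi> t" p "w E" "p ^ w E' - q ^ w E" "w E'"])
    show "\<Psi> t j = [:0, 1:]" using \<Psi>[of t j] by (simp add: G_def)
    show "\<mu> dvd \<Psi> t i - \<rho> i" for i
      using \<Psi>[of t i] \<rho> by (cases "i = j") (auto simp: G_def)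
  qed (use p rr dr P Q in auto)
qed

text \<open>(d+1)^2 products f^i g^k restrict to polynomials of degree at most d^2, so a nontrivial
  combination restricts to 0; it is nonzero because f and g are independent.\<close>

lemma vanishing_exists:
  fixes f g :: "(nat, 'a) mpoly"
  assumes fg: "of_mpoly f \<in> A" "of_mpoly g \<in> A"
    and ind: "\<And>S a i k. finite S \<Longrightarrow> (\<Sum>(i, k)\<in>S. cst (a (i, k)) * f ^ i * g ^ k) = 0 \<Longrightarrow> (i, k) \<in> S \<Longrightarrow> a (i, k) = 0"
  obtains q where "of_mpoly q \<in> A" "q \<noteq> 0" "uev \<Phi> q = 0"
proof -
  interpret h: rhom "uev \<Phi>" by (rule rhom.rhom_ev[OF rhom_const_poly])
  define P where "P = uev \<Phi> f"
  define Q where "Q = uev \<Phi> g"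
  define d where "d = degree P + degree Q + 1"
  define X where "X = {..d} \<times> {..d}"
  have "card {..d * d} < card X" by (simp add: X_def algebra_simps) (simp add: d_def)
  then obtain a where a: "\<exists>s\<in>X. a s \<noteq> 0"
    "\<And>y. y \<in> {..d * d} \<Longrightarrow> (\<Sum>s\<in>X. a s * coeff (P ^ fst s * Q ^ snd s) y) = 0"
    using kernel_exists[of "{..d * d}" X "\<lambda>s. coeff (P ^ fst s * Q ^ snd s)"] by (auto simp: X_def)
  define q where "q = (\<Sum>s\<in>X. cst (a s) * (f ^ fst s * g ^ snd s))"
  have "of_mpoly q \<in> A" unfolding q_def by (intro of_mpoly_A fg)
  moreover have "q \<noteq> 0"
  proof
    assume "q = 0"
    then have "(\<Sum>(i, k)\<in>X. cst (a (i, k)) * f ^ i * g ^ k) = 0"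
      by (simp add: q_def case_prod_unfold mult.assoc)
    then have "a (i, k) = 0" if "(i, k) \<in> X" for i k
      using ind[of X a i k] that by (simp add: X_def)
    then show False using a(1) by auto
  qed
  moreover have "uev \<Phi> q = 0"
  proof (rule poly_eqI)
    fix y
    have "coeff (uev \<Phi> q) y = (\<Sum>s\<in>X. a s * coeff (P ^ fst s * Q ^ snd s) y)"
      by (simp add: q_def P_def Q_def rhom.ev_cst[OF rhom_const_poly] coeff_sum)
    also have "\<dots> = 0"
    proof (cases "y \<le> d * d")
      case True
      then show ?thesis using a(2) by simp
    next
      case False
      have "coeff (P ^ fst s * Q ^ snd s) y = 0" if s: "s \<in> X" for s
      proof (rule coeff_eq_0)
        have "degree (P ^ fst s * Q ^ snd s) \<le> degree P * fst s + degree Q * snd s"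
          by (rule order_trans[OF degree_mult_le]) (intro add_mono degree_power_le)
        also have "\<dots> \<le> degree P * d + degree Q * d"
          using s by (intro add_mono mult_left_mono) (auto simp: X_def)
        also have "\<dots> \<le> d * d" by (simp add: d_def algebra_simps)
        finally show "degree (P ^ fst s * Q ^ snd s) < y" using False by simp
      qed
      then show ?thesis by simp
    qed
    finally show "coeff (uev \<Phi> q) y = coeff 0 y" by simp
  qed
  ultimately show thesis by (rule that)
qed

end

text \<open>\<Phi> is congruent to the base curve \<rho> modulo \<mu>, so elements of A still
  restrict to constants modulo \<mu>; as deg \<mu> \<ge> 2, none restricts to t. The degrees P and P
  Q - 1 found on \<Phi> give \<open>u\<close> and \<open>v\<close> by
  \<open>conductor_exists\<close>.\<close>

theorem curve_exists:
  fixes M :: "'a::field_char_0 ratfun set"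
  assumes M: "is_subfield M" "const_field \<subseteq> M" "M \<subseteq> rat_field n" "M \<noteq> rat_field n"
    and tr: "trdeg const_field (M \<inter> poly_ring n) \<ge> 2"
  obtains j \<Phi> u v q where "j < n" "ratvar j \<notin> M" "\<Phi> j = [:0, 1:]"
    "\<And>p. of_mpoly p \<in> M \<inter> poly_ring n \<Longrightarrow> uev \<Phi> p \<noteq> [:0, 1:]"
    "of_mpoly u \<in> M \<inter> poly_ring n" "of_mpoly v \<in> M \<inter> poly_ring n" "of_mpoly q \<in> M \<inter> poly_ring n"
    "lead_coeff (uev \<Phi> u) = 1" "degree (uev \<Phi> u) \<ge> 1"
    "uev \<Phi> v = [:0, 1:] * uev \<Phi> u"
    "q \<noteq> 0" "uev \<Phi> q = 0"
proof -
  let ?A = "M \<inter> poly_ring n"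
  interpret subalgebra n ?A
    using M is_subring_Int[OF is_subfieldD(1)[OF M(1)] is_subring_poly_ring]
    by unfold_locales (auto simp: const_field_eq)
  obtain j \<mu> \<rho> where j: "j < n" "ratvar j \<notin> M" "lead_coeff \<mu> = 1" "degree \<mu> \<ge> 2" "\<rho> j = [:0, 1:]"
    "\<And>p. poly_vars p \<subseteq> {..<n} \<Longrightarrow> of_mpoly p \<in> M \<Longrightarrow> \<exists>c. \<mu> dvd uev \<rho> p - [:c:]"
    by (rule base_curve_exists[OF M]) (rule that; (assumption | blast))
  obtain f g :: "(nat, 'a) mpoly" where fg: "of_mpoly f \<in> ?A" "of_mpoly g \<in> ?A"
    and ind: "\<And>S a i k. finite S \<Longrightarrow> (\<Sum>(i, k)\<in>S. cst (a (i, k)) * f ^ i * g ^ k) = 0 \<Longrightarrow> (i, k) \<in> S \<Longrightarrow> a (i, k) = 0"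
    by (rule trdeg_two_pair[OF A_sub tr]) (rule that; (assumption | blast))
  obtain \<Phi> P Q p r where \<Phi>: "\<Phi> j = [:0, 1:]" "\<And>i. i < n \<Longrightarrow> \<mu> dvd \<Phi> i - \<rho> i"
    and pr: "p \<in> restr \<Phi>" "degree p = P" "P \<ge> 1" "r \<in> restr \<Phi>" "r \<noteq> 0" "degree r = P * Q - 1" "Q \<ge> 1"
    by (rule coprime_degrees_exist[of f g j \<mu> \<rho>, OF fg _ j(1,3-5)])
      ((rule ind; assumption) | (rule that; (assumption | blast)))+
  obtain u' where u': "u' \<in> restr \<Phi>" "[:0, 1:] * u' \<in> restr \<Phi>" "lead_coeff u' = 1" "degree u' \<ge> 1"
    by (rule conductor_exists[OF restr_closed(1,3,4,2) pr]) (assumption | (rule that; (assumption | blast)))+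
  obtain u where u: "u' = uev \<Phi> u" "of_mpoly u \<in> ?A" using u'(1) by (auto simp: restr_def)
  obtain v where v: "[:0, 1:] * u' = uev \<Phi> v" "of_mpoly v \<in> ?A" using u'(2) unfolding restr_def by blast
  obtain q where q: "of_mpoly q \<in> ?A" "q \<noteq> 0" "uev \<Phi> q = 0"
    by (rule vanishing_exists[of f g \<Phi>, OF fg])
      ((rule ind; assumption) | (rule that; (assumption | blast)))+
  have nt: "uev \<Phi> p \<noteq> [:0, 1:]" if p: "of_mpoly p \<in> ?A" for p
  proof
    assume eq: "uev \<Phi> p = [:0, 1:]"
    have vp: "poly_vars p \<subseteq> {..<n}" using vars_A[OF p] .
    then obtain c where c: "\<mu> dvd uev \<rho> p - [:c:]" using j(6)[of p] p by blast
    have "\<mu> dvd uev \<Phi> p - uev \<rho> p" using ev_cong_mod[OF \<Phi>(2) vp] .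
    from dvd_add[OF this c] have "\<mu> dvd [:- c, 1:]" by (simp add: eq)
    then have "degree \<mu> \<le> degree [:- c, 1:]" by (rule dvd_imp_degree_le) simp
    then show False using j(4) by simp
  qed
  show thesis
    by (rule that[of j \<Phi> u v q]) (use j \<Phi> nt u u' v q in auto)
qed

section \<open>Evaluation of polynomials over the base field\<close>

lemma rhom_map_poly:
  assumes "rhom h"
  shows "rhom (map_poly h)"
proof -
  interpret rhom h by fact
  show ?thesis
    by unfold_locales (auto intro!: poly_eqI simp: coeff_map_poly coeff_mult)
qed

definition pv :: "'a::field ratfun \<Rightarrow> 'a poly \<Rightarrow> 'a ratfun" where
  "pv y \<phi> = poly (map_poly K \<phi>) y"

lemma rhom_pv: "rhom (pv y)"
  unfolding pv_def by (rule rhom_compose[OF rhom_poly rhom_map_poly[OF rhom_K]])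

lemma pv_pCons [simp]: "pv y (pCons c \<phi>) = K c + y * pv y \<phi>"
  by (simp add: pv_def map_poly_pCons K.hom_zero)

lemma pv_0 [simp]: "pv y 0 = 0"
  by (simp add: pv_def)

lemma hom_pv:
  assumes "rhom h" "\<And>c. h (K c) = K c"
  shows "h (pv y \<phi>) = pv (h y) \<phi>"
proof -
  interpret rhom h by fact
  show ?thesis by (induction \<phi>) (auto simp: assms)
qed

lemma pv_in_subring: "is_subring A \<Longrightarrow> (\<And>c. K c \<in> A) \<Longrightarrow> y \<in> A \<Longrightarrow> pv y \<phi> \<in> A"
  by (induction \<phi>) (auto intro: is_subringD)

lemma pv_ev: "pv y (uev \<Phi> p) = ev K (\<lambda>i. pv y (\<Phi> i)) p"
  using hom_ev[OF rhom_pv[of y] rhom_const_poly, where \<theta> = \<Phi> and p = p] by simp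

lemma pv_bounded:
  assumes "is_subring A" "\<And>c. K c \<in> A" "x \<in> A" "x * y \<in> A" "degree \<phi> \<le> d"
  shows "x ^ d * pv y \<phi> \<in> A"
proof -
  have "x ^ d * pv y \<phi> = (\<Sum>i\<le>degree \<phi>. K (coeff \<phi> i) * x ^ (d - i) * (x * y) ^ i)"
  proof -
    have p: "poly (map_poly K \<phi>) y = (\<Sum>i\<le>degree \<phi>. K (coeff \<phi> i) * y ^ i)"
      by (induction \<phi>) (simp_all add: poly_altdef coeff_map_poly degree_map_poly K.hom_zero del: sum.atMost_Suc)
    have t: "x ^ d * (K (coeff \<phi> i) * y ^ i) = K (coeff \<phi> i) * x ^ (d - i) * (x * y) ^ i" if "i \<le> degree \<phi>" for i
    proof -
      have "x ^ d = x ^ (d - i) * x ^ i" using that assms(5) by (simp flip: power_add)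
      then show ?thesis by (simp add: power_mult_distrib mult_ac)
    qed
    show ?thesis unfolding pv_def p sum_distrib_left by (rule sum.cong[OF refl], rule t) simp
  qed
  also have "\<dots> \<in> A" by (intro is_subringD[OF assms(1)] assms)
  finally show ?thesis .
qed

section \<open>Transport along a homomorphism with one denominator\<close>

text \<open>\<open>y'\<close> is the image of \<open>y\<close> under the extension of \<open>h\<close> to fractions with denominator \<open>c ^ k\<close>.\<close>

definition Rel :: "(nat, 'a::field) mpoly \<Rightarrow> ((nat, 'a) mpoly \<Rightarrow> 'a ratfun) \<Rightarrow> 'a ratfun \<Rightarrow> 'a ratfun \<Rightarrow> bool" where
  "Rel c h y y' \<longleftrightarrow> (\<exists>k b. of_mpoly c ^ k * y = of_mpoly b \<and> h b = h c ^ k * y')"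

context
  fixes c :: "(nat, 'a::field) mpoly" and h :: "(nat, 'a) mpoly \<Rightarrow> 'a ratfun"
  assumes h: "rhom h"
begin

interpretation rhom h by (rule h)

lemma Rel_poly: "Rel c h (of_mpoly b) (h b)"
  unfolding Rel_def by (intro exI[of _ 0] exI[of _ b]) simp

lemma Rel_mult:
  assumes "Rel c h x x'" "Rel c h y y'"
  shows "Rel c h (x * y) (x' * y')"
proof -
  obtain k b l d where *: "of_mpoly c ^ k * x = of_mpoly b" "h b = h c ^ k * x'"
    "of_mpoly c ^ l * y = of_mpoly d" "h d = h c ^ l * y'" using assms by (auto simp: Rel_def)
  have "of_mpoly c ^ (k + l) * (x * y) = of_mpoly (b * d)" "h (b * d) = h c ^ (k + l) * (x' * y')"
    using * by (simp_all add: power_add mult_ac flip: *(1,3))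
  then show ?thesis unfolding Rel_def by blast
qed

lemma Rel_add:
  assumes "Rel c h x x'" "Rel c h y y'"
  shows "Rel c h (x + y) (x' + y')"
proof -
  obtain k b l d where *: "of_mpoly c ^ k * x = of_mpoly b" "h b = h c ^ k * x'"
    "of_mpoly c ^ l * y = of_mpoly d" "h d = h c ^ l * y'" using assms by (auto simp: Rel_def)
  have "of_mpoly c ^ (k + l) * (x + y) = of_mpoly (c ^ l * b + c ^ k * d)"
    "h (c ^ l * b + c ^ k * d) = h c ^ (k + l) * (x' + y')"
    using * by (simp_all add: power_add algebra_simps flip: *(1,3))
  then show ?thesis unfolding Rel_def by blast
qed

lemma Rel_inverse:
  assumes "c \<noteq> 0" "h c \<noteq> 0"
  shows "Rel c h (1 / of_mpoly c) (1 / h c)"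
  unfolding Rel_def using assms by (intro exI[of _ 1] exI[of _ 1]) simp

lemma Rel_power: "Rel c h x x' \<Longrightarrow> Rel c h (x ^ e) (x' ^ e)"
  using Rel_poly[of 1] by (induction e) (auto intro: Rel_mult)

context
  assumes hK: "\<And>a. h (cst a) = K a"
begin

lemma Rel_K: "Rel c h (K a) (K a)"
  using Rel_poly[of "cst a"] by (simp add: hK K_def)

lemma Rel_minus: "Rel c h x x' \<Longrightarrow> Rel c h (- x) (- x')"
  using Rel_mult[OF Rel_K[of "-1"]] by (fastforce simp: K.hom_uminus)

lemma Rel_diff: "Rel c h x x' \<Longrightarrow> Rel c h y y' \<Longrightarrow> Rel c h (x - y) (x' - y')"
  using Rel_add[OF _ Rel_minus] by fastforce

lemma Rel_pv: "Rel c h y y' \<Longrightarrow> Rel c h (pv y \<phi>) (pv y' \<phi>)"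
  by (induction \<phi>) (auto intro: Rel_add Rel_mult Rel_K simp: Rel_K[of 0, simplified])

lemma Rel_ev:
  assumes "\<And>i. Rel c h (\<theta> i) (\<theta>' i)"
  shows "Rel c h (ev K \<theta> p) (ev K \<theta>' p)"
proof -
  have "poly_vars p \<subseteq> UNIV" by simp
  then show ?thesis
    by (induction p rule: mpoly_induct)
      (auto simp: rhom.ev_cst[OF rhom_K] rhom.ev_var[OF rhom_K] rhom.ev_add[OF rhom_K] rhom.ev_mult[OF rhom_K]
        intro: assms Rel_K Rel_add Rel_mult)
qed

lemma Rel_0D: "Rel c h 0 y' \<Longrightarrow> h c \<noteq> 0 \<Longrightarrow> y' = 0"
  by (auto simp: Rel_def)

lemma Rel_polyD:
  assumes "Rel c h (of_mpoly b) y'" "h c \<noteq> 0"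
  shows "y' = h b"
proof -
  obtain k d where *: "of_mpoly c ^ k * of_mpoly b = of_mpoly d" "h d = h c ^ k * y'"
    using assms by (auto simp: Rel_def)
  then have "c ^ k * b = d" by (simp flip: of_mpoly.hom_power of_mpoly.hom_mult)
  then have "h c ^ k * h b = h c ^ k * y'" using *(2) by auto
  then show ?thesis using assms(2) by simp
qed

end

end

section \<open>The automorphism\<close>

text \<open>Injectivity makes every nonzero denominator admissible, so \<open>loc_ring h\<close> is
  the whole field.\<close>

lemma rhom_loc_hom:
  assumes h: "rhom h" and inj: "\<And>p. h p = 0 \<Longrightarrow> p = 0"
  shows "rhom (loc_hom h)"
proof
  have U: "x \<in> loc_ring h" for x
    using inj by (cases x rule: ratfun_cases) (auto simp: loc_ring_def)
  show "loc_hom h 1 = 1" using loc_hom_of_mpoly[OF h, of 1] rhom.hom_one[OF h] by simp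
  show "loc_hom h (x + y) = loc_hom h x + loc_hom h y" "loc_hom h (x * y) = loc_hom h x * loc_hom h y" for x y
    using loc_add_mult[OF h U U] by auto
qed

lemma rhom_divide:
  fixes h :: "'b::field \<Rightarrow> 'c::field"
  assumes "rhom h"
  shows "h (x / y) = h x / h y" "h x = 0 \<longleftrightarrow> x = 0"
proof -
  interpret rhom h by fact
  have nz: "h x \<noteq> 0" if "x \<noteq> 0" for x
  proof -
    have "h x * h (inverse x) = 1" using that by (simp flip: hom_mult)
    then show ?thesis by auto
  qed
  then show "h x = 0 \<longleftrightarrow> x = 0" by auto
  show "h (x / y) = h x / h y"
  proof (cases "y = 0")
    case False
    have "h (x / y) * h y = h x" using False by (simp flip: hom_mult)
    then show ?thesis using nz[OF False] by (simp add: field_simps)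
  qed simp
qed

text \<open>\<open>N\<close> remains a parameter: it can be fixed only after the poles of finitely
  many polynomials along the curve are known.\<close>

locale curve =
  fixes n j N :: nat and \<Phi> :: "nat \<Rightarrow> 'a::field_char_0 poly"
  assumes jn: "j < n" and \<Phi>j: "\<Phi> j = [:0, 1:]"
begin

abbreviation "X i \<equiv> (ratvar i :: 'a ratfun)"

text \<open>The relations 2 \<zeta> - \<tau> = 1/x_j and \<tau> - \<zeta> = z invert the
  substitution: \<open>it\<close> sends x_j to 1/s and z to x_j - z.\<close>

definition "\<tau> = 1 / X j + 2 * X n"
definition "\<zeta> = 1 / X j + X n"
definition "s = 2 * X n - X j"

definition "th i = (if i = j then \<tau> else if i = n then \<zeta> else if i < n then X i * X j ^ N + pv \<tau> (\<Phi> i) else X i)"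
definition "it i = (if i = j then 1 / s else if i = n then X j - X n
  else if i < n then s ^ N * (X i - pv (X j) (\<Phi> i)) else X i)"

definition "P = ev K th"
definition "Q = ev K it"

lemma rhom_P: "rhom P" and rhom_Q: "rhom Q"
  unfolding P_def Q_def by (rule rhom.rhom_ev[OF rhom_K])+

lemma P_cst [simp]: "P (cst a) = K a" and Q_cst [simp]: "Q (cst a) = K a"
  and P_var [simp]: "P (var i) = th i" and Q_var [simp]: "Q (var i) = it i"
  by (simp_all add: P_def Q_def rhom.ev_cst[OF rhom_K] rhom.ev_var[OF rhom_K])

lemma Xj0 [simp]: "X i \<noteq> 0"
proof -
  have "(var i :: (nat, 'a) mpoly) \<noteq> 0"
    using poly_vars_var[of i, where 'a = 'a] by (auto simp: poly_vars_def simp del: poly_vars_var)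
  then show ?thesis by (simp add: ratvar_eq)
qed

definition "sp = 2 * var n - (var j :: (nat, 'a) mpoly)"

lemma s_sp: "s = of_mpoly sp"
  by (simp add: s_def sp_def ratvar_eq)

lemma s0 [simp]: "s \<noteq> 0"
proof
  assume "s = 0"
  then have "sp = 0" by (simp add: s_sp)
  moreover have "ev (\<lambda>c. c) (\<lambda>i. if i = n then 1 else 0) sp = (2 :: 'a)"
    using jn by (simp add: sp_def rhom.hom_diff[OF rhom.rhom_ev[OF rhom_id]] rhom.hom_mult[OF rhom.rhom_ev[OF rhom_id]]
        rhom.hom_numeral[OF rhom.rhom_ev[OF rhom_id]] rhom.ev_var[OF rhom_id])
  ultimately show False by (simp add: rhom.ev_zero[OF rhom_id])
qed

lemma P_sp: "P sp = 1 / X j"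
  using jn rhom.hom_diff[OF rhom_P] rhom.hom_mult[OF rhom_P] rhom.hom_numeral[OF rhom_P]
  by (simp add: sp_def th_def \<tau>_def \<zeta>_def)

text \<open>Q undoes P, expressed before either is known to extend to fractions: \<open>Rel\<close>
  carries the denominators x_j^k explicitly. The injectivity of P, which the extension requires,
  follows.\<close>

lemma Rel_PQ: "Rel (var j) Q (P p) (of_mpoly p)"
proof -
  note R = Rel_poly[OF rhom_Q] Rel_K[OF rhom_Q Q_cst] Rel_add[OF rhom_Q] Rel_mult[OF rhom_Q] Rel_diff[OF rhom_Q Q_cst]
  have v: "Rel (var j) Q (X i) (it i)" for i using R(1)[of "var j" "var i"] by (simp add: ratvar_eq)
  have inv: "Rel (var j) Q (1 / X j) s"
    using Rel_inverse[OF rhom_Q, of "var j"] Xj0[of j] by (simp add: ratvar_eq it_def)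
  have two: "Rel (var j) Q 2 2" using R(2)[of "var j" 2] by (simp add: K.hom_numeral)
  have vn: "Rel (var j) Q (X n) (X j - X n)" using v[of n] jn by (simp add: it_def)
  have t: "Rel (var j) Q \<tau> (X j)"
    using R(3)[OF inv R(4)[OF two vn]] by (simp add: \<tau>_def s_def algebra_simps)
  have z: "Rel (var j) Q \<zeta> (X n)"
    using R(3)[OF inv vn] by (simp add: \<zeta>_def s_def algebra_simps)
  have "Rel (var j) Q (th i) (X i)" for i
  proof -
    consider "i = j" | "i = n" "i \<noteq> j" | "i < n" "i \<noteq> j" | "i > n" using jn by linarith
    then show ?thesis
    proof cases
      case 3
      have "Rel (var j) Q (X i * X j ^ N + pv \<tau> (\<Phi> i)) (it i * it j ^ N + pv (X j) (\<Phi> i))"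
        by (intro R v Rel_power[OF rhom_Q] Rel_pv[OF rhom_Q Q_cst] t)
      also have "it i * it j ^ N + pv (X j) (\<Phi> i) = X i"
        using 3 by (simp add: it_def power_divide)
      finally show ?thesis using 3 by (simp add: th_def)
    qed (use t z v[of i] jn in \<open>auto simp: th_def it_def\<close>)
  qed
  then show ?thesis
    unfolding P_def of_mpoly_ev by (rule Rel_ev[OF rhom_Q Q_cst])
qed

lemma Rel_QP: "Rel sp P (Q p) (of_mpoly p)"
proof -
  note R = Rel_poly[OF rhom_P] Rel_K[OF rhom_P P_cst] Rel_add[OF rhom_P] Rel_mult[OF rhom_P] Rel_diff[OF rhom_P P_cst]
  have v: "Rel sp P (X i) (th i)" for i using R(1)[of sp "var i"] by (simp add: ratvar_eq)
  have inv: "Rel sp P (1 / s) (X j)"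
    using Rel_inverse[OF rhom_P, of sp] s0 by (simp add: s_sp P_sp)
  have s: "Rel sp P s (1 / X j)" using R(1)[of sp sp] by (simp add: s_sp P_sp)
  have vj: "Rel sp P (X j) \<tau>" and vn: "Rel sp P (X n) \<zeta>" using v[of j] v[of n] jn by (simp_all add: th_def)
  have "Rel sp P (it i) (X i)" for i
  proof -
    consider "i = j" | "i = n" "i \<noteq> j" | "i < n" "i \<noteq> j" | "i > n" using jn by linarith
    then show ?thesis
    proof cases
      case 1
      then show ?thesis using inv by (simp add: it_def)
    next
      case 2
      then show ?thesis using R(5)[OF vj vn] by (simp add: it_def \<tau>_def \<zeta>_def)
    next
      case 3
      have "Rel sp P (s ^ N * (X i - pv (X j) (\<Phi> i))) ((1 / X j) ^ N * (th i - pv \<tau> (\<Phi> i)))"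
        by (intro R v Rel_power[OF rhom_P] Rel_pv[OF rhom_P P_cst] vj s)
      also have "(1 / X j) ^ N * (th i - pv \<tau> (\<Phi> i)) = X i"
        using 3 by (simp add: th_def power_divide)
      finally show ?thesis using 3 by (simp add: it_def)
    qed (use v[of i] jn in \<open>auto simp: th_def it_def\<close>)
  qed
  then show ?thesis
    unfolding Q_def of_mpoly_ev by (rule Rel_ev[OF rhom_P P_cst])
qed

lemma P_inj: "P p = 0 \<Longrightarrow> p = 0"
  using Rel_PQ[of p] Rel_0D[OF rhom_Q Q_cst, of "var j" "of_mpoly p"] by (simp add: it_def)

lemma Q_inj: "Q p = 0 \<Longrightarrow> p = 0"
  using Rel_QP[of p] Rel_0D[OF rhom_P P_cst, of sp "of_mpoly p"] by (simp add: P_sp)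

definition "\<sigma> = loc_hom P"
definition "\<sigma>' = loc_hom Q"

lemma rhom_\<sigma>: "rhom \<sigma>" and rhom_\<sigma>': "rhom \<sigma>'"
  unfolding \<sigma>_def \<sigma>'_def by (intro rhom_loc_hom rhom_P rhom_Q P_inj Q_inj; assumption)+

lemma \<sigma>_of_mpoly: "\<sigma> (of_mpoly p) = P p" and \<sigma>'_of_mpoly: "\<sigma>' (of_mpoly p) = Q p"
  unfolding \<sigma>_def \<sigma>'_def by (simp_all add: loc_hom_of_mpoly rhom_P rhom_Q)

lemma \<sigma>_K [simp]: "\<sigma> (K a) = K a" and \<sigma>'_K [simp]: "\<sigma>' (K a) = K a"
  and \<sigma>_X: "\<sigma> (X i) = th i" and \<sigma>'_X: "\<sigma>' (X i) = it i"
  unfolding K_def ratvar_eq \<sigma>_of_mpoly \<sigma>'_of_mpoly by (simp_all add: K_def)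

interpretation \<sigma>: rhom \<sigma> by (rule rhom_\<sigma>)
interpretation \<sigma>': rhom \<sigma>' by (rule rhom_\<sigma>')

lemma \<sigma>_s: "\<sigma> s = 1 / X j"
  by (simp add: s_sp \<sigma>_of_mpoly P_sp)

lemma \<sigma>'_\<tau>: "\<sigma>' \<tau> = X j" and \<sigma>'_\<zeta>: "\<sigma>' \<zeta> = X n"
  using jn by (simp_all add: \<tau>_def \<zeta>_def rhom_divide[OF rhom_\<sigma>'] \<sigma>'_X it_def s_def)

lemma \<sigma>_\<sigma>'_X: "\<sigma> (\<sigma>' (X i)) = X i"
proof -
  consider "i = j" | "i = n" "i \<noteq> j" | "i < n" "i \<noteq> j" | "i > n" using jn by linarith
  then show ?thesis
  proof cases
    case 1
    then show ?thesis by (simp add: \<sigma>'_X it_def rhom_divide[OF rhom_\<sigma>] \<sigma>_s)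
  next
    case 2
    then show ?thesis using jn by (simp add: \<sigma>'_X it_def \<sigma>_X th_def \<tau>_def \<zeta>_def)
  next
    case 3
    then show ?thesis
      by (simp add: \<sigma>'_X it_def \<sigma>_X \<sigma>_s hom_pv[OF rhom_\<sigma>]) (simp add: th_def power_divide)
  next
    case 4
    then show ?thesis using jn by (simp add: \<sigma>'_X it_def \<sigma>_X th_def)
  qed
qed

lemma \<sigma>'_\<sigma>_X: "\<sigma>' (\<sigma> (X i)) = X i"
proof -
  consider "i = j" | "i = n" "i \<noteq> j" | "i < n" "i \<noteq> j" | "i > n" using jn by linarith
  then show ?thesis
  proof cases
    case 3
    then show ?thesis
      by (simp add: \<sigma>_X th_def hom_pv[OF rhom_\<sigma>'] \<sigma>'_\<tau>) (simp add: \<sigma>'_X it_def power_divide)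
  qed (use jn in \<open>auto simp: \<sigma>_X th_def \<sigma>'_\<tau> \<sigma>'_\<zeta> \<sigma>'_X it_def\<close>)
qed

lemma hom_fixes_all:
  assumes h: "rhom h" and "\<And>a. h (K a) = K a" "\<And>i. h (X i) = X i"
  shows "h y = y"
proof -
  have "h (of_mpoly p) = of_mpoly p" for p
    by (rule rhom_agree[OF rhom_compose[OF h rhom_of_mpoly] rhom_of_mpoly, of p UNIV])
      (use assms in \<open>auto simp flip: K_def ratvar_eq\<close>)
  then show ?thesis
    by (cases y rule: ratfun_cases) (simp add: rhom_divide[OF h])
qed

lemma \<sigma>_\<sigma>' [simp]: "\<sigma> (\<sigma>' y) = y"
  by (rule hom_fixes_all[OF rhom_compose[OF rhom_\<sigma> rhom_\<sigma>']]) (auto simp: \<sigma>_\<sigma>'_X)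

lemma \<sigma>'_\<sigma> [simp]: "\<sigma>' (\<sigma> y) = y"
  by (rule hom_fixes_all[OF rhom_compose[OF rhom_\<sigma>' rhom_\<sigma>]]) (auto simp: \<sigma>'_\<sigma>_X)

lemma hom_rat_field:
  assumes h: "rhom h" "\<And>a. h (K a) = K a" "\<And>i. i < m \<Longrightarrow> h (X i) \<in> rat_field m" and y: "y \<in> rat_field m"
  shows "h y \<in> rat_field m"
proof -
  note sf = is_subfieldD[OF is_subfield_rat_field[of m]]
  have "h a \<in> rat_field m" if "a \<in> poly_ring m" for a
  proof -
    from that obtain p where p: "a = of_mpoly p" "poly_vars p \<subseteq> {..<m}" by (auto simp: poly_ring_def)
    have "h a = ev (\<lambda>c. h (K c)) (\<lambda>i. h (X i)) p" unfolding p of_mpoly_ev by (rule hom_ev[OF h(1) rhom_K])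
    also have "\<dots> = ev K (\<lambda>i. h (X i)) p" by (simp add: h)
    also have "\<dots> \<in> rat_field m"
      using p h(3) poly_ring_subset_rat_field[of m] by (intro ev_in_subring[OF sf(1) rhom_K p(2)]) auto
    finally show ?thesis .
  qed
  moreover obtain a b where "y = a / b" "a \<in> poly_ring m" "b \<in> poly_ring m"
    using y by (auto simp: rat_field_def frac_field_def)
  ultimately show ?thesis by (simp add: rhom_divide[OF h(1)] sf(3))
qed

lemma \<sigma>_field_aut: "\<sigma> \<in> field_auts const_field (rat_field (Suc n))"
proof -
  note sf = is_subfieldD[OF is_subfield_rat_field[of "Suc n"]]
  note sr = is_subringD[OF sf(1)]
  have K: "K a \<in> rat_field (Suc n)" for a using poly_ring_subset_rat_field[of "Suc n"] by auto
  have two: "2 \<in> rat_field (Suc n)" using K[of 2] by (simp add: K.hom_numeral)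
  have \<tau>: "\<tau> \<in> rat_field (Suc n)" "\<zeta> \<in> rat_field (Suc n)" "s \<in> rat_field (Suc n)"
    unfolding \<tau>_def \<zeta>_def s_def using jn by (intro sr(2,3,5,6) sf(3) two ratvar_in_rat_field; simp)+
  have X: "X i \<in> rat_field (Suc n)" if "i < Suc n" for i using that by simp
  have p: "pv y (\<Phi> i) \<in> rat_field (Suc n)" if "y \<in> rat_field (Suc n)" for y i
    by (intro pv_in_subring sf(1) K that)
  have thR: "th i \<in> rat_field (Suc n)" if "i < Suc n" for i
  proof -
    have "X i * X j ^ N + pv \<tau> (\<Phi> i) \<in> rat_field (Suc n)"
      by (intro sr(3,5,7) p \<tau> X that) (use jn in simp)
    then show ?thesis using that \<tau> X by (simp add: th_def)
  qed
  have itR: "it i \<in> rat_field (Suc n)" if "i < Suc n" for i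
  proof -
    have "s ^ N * (X i - pv (X j) (\<Phi> i)) \<in> rat_field (Suc n)"
      by (intro sr(5,6,7) p \<tau> X that) (use jn in simp)
    moreover have "1 / s \<in> rat_field (Suc n)" by (intro sf(3) sr(2) \<tau>)
    moreover have "X j - X n \<in> rat_field (Suc n)" by (intro sr(6) X) (use jn in simp_all)
    ultimately show ?thesis using that X by (simp add: it_def)
  qed
  have \<sigma>R: "\<sigma> y \<in> rat_field (Suc n)" if "y \<in> rat_field (Suc n)" for y
    by (rule hom_rat_field[OF rhom_\<sigma> \<sigma>_K _ that]) (simp add: \<sigma>_X thR)
  have \<sigma>'R: "\<sigma>' y \<in> rat_field (Suc n)" if "y \<in> rat_field (Suc n)" for y
    by (rule hom_rat_field[OF rhom_\<sigma>' \<sigma>'_K _ that]) (simp add: \<sigma>'_X itR)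
  have "bij_betw \<sigma> (rat_field (Suc n)) (rat_field (Suc n))"
    by (rule bij_betw_byWitness[where f' = \<sigma>']) (use \<sigma>R \<sigma>'R in \<open>simp_all add: image_subset_iff\<close>)
  then show ?thesis by (auto simp: field_auts_def const_field_eq)
qed

end

section \<open>Contraction to the polynomial ring\<close>

text \<open>After denominators are cleared, the relation holds between formal polynomials; \<psi>,
  which sends x_n to an indeterminate and keeps the other variables, turns it into q f = 0.\<close>

lemma ratvar_transcendental:
  fixes f :: "'a::field ratfun poly"
  assumes f: "f \<in> coeffs_in (rat_field n)" "poly f (ratvar n) = 0"
  shows "f = 0"
proof -
  have "coeff f ` {..degree f} \<subseteq> rat_field n" using f by (auto dest: coeffs_inD)
  then obtain q where q: "q \<in> poly_ring n" "q \<noteq> 0" "\<And>i. i \<le> degree f \<Longrightarrow> q * coeff f i \<in> poly_ring n"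
    using common_denominator[of "coeff f ` {..degree f}" n] by auto
  define g where "g = smult q f"
  have dg: "degree g = degree f" using q by (simp add: g_def)
  have "\<forall>i. \<exists>p. i \<le> degree f \<longrightarrow> coeff g i = of_mpoly p \<and> poly_vars p \<subseteq> {..<n}"
    using q(3) by (auto simp: g_def poly_ring_def)
  then obtain p where p: "\<And>i. i \<le> degree f \<Longrightarrow> coeff g i = of_mpoly (p i)" "\<And>i. i \<le> degree f \<Longrightarrow> poly_vars (p i) \<subseteq> {..<n}"
    by metis
  have hK: "rhom (\<lambda>c :: 'a. [:K c:])" using rhom_compose[OF rhom_const_poly rhom_K] .
  define \<psi> where "\<psi> = ev (\<lambda>c :: 'a. [:K c:]) (\<lambda>i. if i = n then [:0, 1:] else [:ratvar i:])"
  interpret \<psi>: rhom \<psi> unfolding \<psi>_def by (rule rhom.rhom_ev[OF hK])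
  have \<psi>p: "\<psi> (p i) = [:coeff g i:]" if "i \<le> degree f" for i
  proof -
    have "\<psi> (p i) = ev (\<lambda>c. [:K c:]) (\<lambda>i. [:ratvar i:]) (p i)"
      unfolding \<psi>_def by (rule ev_agree[OF hK p(2)[OF that]]) auto
    also have "\<dots> = [:of_mpoly (p i):]"
      unfolding of_mpoly_ev by (rule hom_ev[OF rhom_const_poly rhom_K, symmetric])
    finally show ?thesis by (simp add: p that)
  qed
  have "of_mpoly (\<Sum>i\<le>degree f. p i * var n ^ i) = (\<Sum>i\<le>degree f. coeff g i * ratvar n ^ i)"
    by (simp add: p ratvar_eq)
  also have "\<dots> = poly g (ratvar n)" by (simp add: poly_altdef dg)
  also have "\<dots> = 0" using f by (simp add: g_def)
  finally have "(\<Sum>i\<le>degree f. p i * var n ^ i) = 0" by (simp only: of_mpoly_eq_0_iff)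
  then have "0 = \<psi> (\<Sum>i\<le>degree f. p i * var n ^ i)" by simp
  also have "\<dots> = (\<Sum>i\<le>degree g. monom (coeff g i) i)"
    unfolding \<psi>.hom_sum dg by (rule sum.cong) (simp_all add: \<psi>p monom_altdef, simp_all add: \<psi>_def rhom.ev_var[OF hK])
  also have "\<dots> = g" by (rule poly_as_sum_of_monoms)
  finally show ?thesis using q by (simp add: g_def)
qed

lemma poly_ring_Suc:
  assumes "y \<in> poly_ring (Suc n)"
  obtains f where "f \<in> coeffs_in (poly_ring n)" "y = poly f (ratvar n)"
proof -
  note c = is_subring_coeffs_in[OF is_subring_poly_ring[of n]]
  obtain p where p: "y = of_mpoly p" "poly_vars p \<subseteq> {..<Suc n}" using assms by (auto simp: poly_ring_def)
  have "\<exists>f\<in>coeffs_in (poly_ring n). of_mpoly p = poly f (ratvar n)"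
    using p(2)
  proof (induction p rule: mpoly_induct)
    case (cst a)
    have "monom (K a) 0 \<in> coeffs_in (poly_ring n)" by (intro c) simp
    then show ?case by (intro bexI[of _ "monom (K a) 0"]) (simp_all add: K_def poly_monom)
  next
    case (var i)
    show ?case
    proof (cases "i = n")
      case True
      have "monom 1 1 \<in> coeffs_in (poly_ring n)" by (intro c poly_ring_closed)
      then show ?thesis using True by (intro bexI[of _ "monom 1 1"]) (simp_all add: ratvar_eq poly_monom)
    next
      case False
      then have "monom (ratvar i) 0 \<in> coeffs_in (poly_ring n)" using var by (intro c) simp
      then show ?thesis by (intro bexI[of _ "monom (ratvar i) 0"]) (simp_all add: ratvar_eq poly_monom)
    qed
  next
    case (add p q)
    then obtain f g where "f \<in> coeffs_in (poly_ring n)" "of_mpoly p = poly f (ratvar n)"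
      "g \<in> coeffs_in (poly_ring n)" "of_mpoly q = poly g (ratvar n)" by auto
    then show ?case by (intro bexI[of _ "f + g"]) (simp_all add: c)
  next
    case (mult p q)
    then obtain f g where "f \<in> coeffs_in (poly_ring n)" "of_mpoly p = poly f (ratvar n)"
      "g \<in> coeffs_in (poly_ring n)" "of_mpoly q = poly g (ratvar n)" by auto
    then show ?case by (intro bexI[of _ "f * g"]) (simp_all add: c)
  qed
  with p(1) that show thesis by auto
qed

text \<open>The linear factor is prime: at each step it splits off from \<open>t\<close> or from
  \<open>R\<close>.\<close>

lemma linear_power_divisor:
  fixes t R :: "'b::field poly"
  assumes "t * R = [:- r, 1:] ^ k"
  shows "\<exists>i c. t = smult c ([:- r, 1:] ^ i)"
  using assms
proof (induction k arbitrary: t R)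
  case 0
  then have "t dvd 1" by (metis dvd_triv_left power_0)
  then obtain c where "t = [:c:]" by (auto simp: is_unit_poly_iff)
  then show ?case by (intro exI[of _ 0] exI[of _ c]) simp
next
  case (Suc k)
  let ?l = "[:- r, 1:]"
  show ?case
  proof (cases "poly t r = 0")
    case True
    then obtain t' where t': "t = ?l * t'" by (auto simp: poly_eq_0_iff_dvd)
    have "?l * (t' * R) = ?l * ?l ^ k" using Suc.prems by (simp only: t' power_Suc mult.assoc)
    then have "t' * R = ?l ^ k" by (subst (asm) mult_left_cancel) auto
    from Suc.IH[OF this] obtain i c where "t' = smult c (?l ^ i)" by auto
    then have "t = smult c (?l ^ Suc i)" unfolding t' by (simp only: power_Suc mult_smult_right)
    then show ?thesis by blast
  next
    case False
    have "poly (t * R) r = 0" by (simp only: Suc.prems poly_power poly_mult) simp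
    then have "poly R r = 0" using False by simp
    then obtain R' where R': "R = ?l * R'" by (auto simp: poly_eq_0_iff_dvd)
    have "?l * (t * R') = ?l * ?l ^ k" using Suc.prems by (simp only: R' power_Suc mult.left_commute)
    then have "t * R' = ?l ^ k" by (subst (asm) mult_left_cancel) auto
    from Suc.IH[OF this] show ?thesis .
  qed
qed

context curve
begin

lemma s_in_poly_ring: "s \<in> poly_ring (Suc n)"
proof -
  have "K 2 * X n - X j \<in> poly_ring (Suc n)"
    by (intro poly_ring_closed(5,6) K_in_poly_ring ratvar_in_poly_ring) (use jn in auto)
  then show ?thesis by (simp add: s_def rhom.hom_numeral[OF rhom_K])
qed

lemma \<sigma>'_denominator:
  assumes "poly_vars p \<subseteq> {..<Suc n}"
  shows "\<exists>k. s ^ k * Q p \<in> poly_ring (Suc n)"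
  using assms
proof (induction p rule: mpoly_induct)
  case (cst c)
  show ?case by (intro exI[of _ 0]) simp
next
  case (var i)
  show ?case
  proof (cases "i = j")
    case True
    then show ?thesis by (intro exI[of _ 1]) (simp add: it_def poly_ring_closed)
  next
    case False
    have "s ^ N * (X i - pv (X j) (\<Phi> i)) \<in> poly_ring (Suc n)" "X j - X n \<in> poly_ring (Suc n)"
      using var jn by (auto intro!: poly_ring_closed(5,6,7) s_in_poly_ring pv_in_subring is_subring_poly_ring)
    then show ?thesis using var False by (intro exI[of _ 0]) (simp add: it_def)
  qed
next
  case (add p q)
  then obtain k l where "s ^ k * Q p \<in> poly_ring (Suc n)" "s ^ l * Q q \<in> poly_ring (Suc n)" by auto
  note this[THEN poly_ring_closed(5)[OF poly_ring_closed(7)[OF s_in_poly_ring]]]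
  from poly_ring_closed(3)[OF this(1)[of l] this(2)[of k]]
  have "s ^ l * (s ^ k * Q p) + s ^ k * (s ^ l * Q q) \<in> poly_ring (Suc n)" .
  then show ?case
    by (intro exI[of _ "k + l"]) (simp add: rhom.hom_add[OF rhom_Q] power_add algebra_simps)
next
  case (mult p q)
  then obtain k l where "s ^ k * Q p \<in> poly_ring (Suc n)" "s ^ l * Q q \<in> poly_ring (Suc n)" by auto
  then have "(s ^ k * Q p) * (s ^ l * Q q) \<in> poly_ring (Suc n)" by (rule poly_ring_closed(5))
  then show ?case
    by (intro exI[of _ "k + l"]) (simp add: rhom.hom_mult[OF rhom_Q] power_add mult_ac)
qed

text \<open>Write F = f'/t in lowest terms over M. As s^k F is a polynomial, t divides a power of 2z
  - x_j, so t is a constant times (z - x_j/2)^i. Its coefficients lie in M, and for i > 0 the second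
  one would give x_j \<in> M. Hence F \<in> M[z]; its coefficients are polynomials since 2z - x_j
  has a constant leading coefficient in z.\<close>

lemma contraction:
  assumes M: "is_subfield M" "M \<subseteq> rat_field n" "X j \<notin> M"
    and F: "F \<in> adjoin M (X n)" "\<sigma> F \<in> poly_ring (Suc n)"
  obtains f where "f \<in> coeffs_in (M \<inter> poly_ring n)" "F = poly f (X n)"
proof -
  have MA: "is_subring M" using M by (intro is_subfieldD)
  note cM = is_subring_coeffs_in[OF MA]
  obtain a where a: "\<sigma> F = of_mpoly a" "poly_vars a \<subseteq> {..<Suc n}" using F(2) by (auto simp: poly_ring_def)
  have "F = Q a" using arg_cong[OF a(1), of \<sigma>'] by (simp add: \<sigma>'_of_mpoly)
  then obtain k where k: "s ^ k * F \<in> poly_ring (Suc n)" using \<sigma>'_denominator[OF a(2)] by auto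
  then obtain C where C: "C \<in> coeffs_in (poly_ring n)" "s ^ k * F = poly C (X n)" by (rule poly_ring_Suc)
  obtain f g where fg: "F = poly f (X n) / poly g (X n)" "f \<in> coeffs_in M" "g \<in> coeffs_in M" "poly g (X n) \<noteq> 0"
    using F(1) by (auto simp: adjoin_eq[OF M(1)])
  have g0: "g \<noteq> 0" using fg by auto
  obtain d u v f' t where d: "lead_coeff d = 1" "d = u * f + v * g" "f = f' * d" "g = t * d"
    "d \<in> coeffs_in M" "u \<in> coeffs_in M" "v \<in> coeffs_in M" "f' \<in> coeffs_in M" "t \<in> coeffs_in M"
    by (rule coeffs_in_bezout[OF M(1) fg(2,3) g0])
  have d0: "d \<noteq> 0" using d(1) by auto
  have "d * 1 = d * (u * f' + v * t)"
    using d(2) unfolding d(3,4) by (simp add: algebra_simps)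
  then have bez: "u * f' + v * t = 1" using d0 by (subst (asm) mult_left_cancel) auto
  have tz: "poly t (X n) \<noteq> 0" "poly d (X n) \<noteq> 0" using fg(4) unfolding d(4) by auto
  have Ft: "poly t (X n) * F = poly f' (X n)"
    unfolding fg(1) unfolding d(3,4) using tz by simp
  define S where "S = [:- X j, 2:]"
  have S: "S \<in> coeffs_in (poly_ring n)"
    using jn poly_ring_closed(10)[of 2 n]
    unfolding S_def by (intro is_subring_coeffs_in[OF is_subring_poly_ring] poly_ring_closed(4)) simp_all
  have pS: "poly S (X n) = s" by (simp add: S_def s_def algebra_simps)
  have up: "coeffs_in (poly_ring n) \<subseteq> coeffs_in (rat_field n)" "coeffs_in M \<subseteq> coeffs_in (rat_field n)"
    using M(2) poly_ring_subset_rat_field[of n] by (auto intro!: coeffs_in_mono)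
  note cR = is_subring_coeffs_in[OF is_subfieldD(1)[OF is_subfield_rat_field[of n]]]
  have "S ^ k * f' - C * t = 0"
  proof (rule ratvar_transcendental)
    show "S ^ k * f' - C * t \<in> coeffs_in (rat_field n)"
      using up S C(1) d(8,9) by (intro cR) auto
    have "poly (S ^ k * f') (X n) = s ^ k * (poly t (X n) * F)" by (simp add: pS Ft)
    also have "\<dots> = poly (C * t) (X n)" using C(2) by (simp add: mult_ac)
    finally show "poly (S ^ k * f' - C * t) (X n) = 0" by simp
  qed
  then have eq: "S ^ k * f' = C * t" by simp
  define r where "r = X j / 2"
  have Sr: "S = smult 2 [:- r, 1:]" by (simp add: S_def r_def)
  \<comment> \<open>\<open>t\<close> divides \<open>S ^ k * f'\<close> and is coprime to
    \<open>f'\<close>, so it divides \<open>S ^ k\<close>.\<close>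
  have "S ^ k = S ^ k * (u * f' + v * t)" by (simp add: bez)
  also have "\<dots> = u * (S ^ k * f') + S ^ k * v * t" by (simp add: algebra_simps)
  also have "\<dots> = t * (u * C + S ^ k * v)" unfolding eq by (simp add: algebra_simps)
  finally have "smult (2 ^ k) ([:- r, 1:] ^ k) = t * (u * C + S ^ k * v)"
    unfolding Sr smult_power .
  then have "t * smult (inverse (2 ^ k)) (u * C + S ^ k * v) = [:- r, 1:] ^ k"
    by (simp only: mult_smult_right flip: \<open>smult (2 ^ k) ([:- r, 1:] ^ k) = _\<close>) simp
  from linear_power_divisor[OF this] obtain i c where t: "t = smult c ([:- r, 1:] ^ i)" by auto
  have c0: "c \<noteq> 0" using t tz by auto
  have pw: "monicp ([:- r, 1:] ^ i)" "degree ([:- r, 1:] ^ i) = i" "sec ([:- r, 1:] ^ i) = of_nat i * - r"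
    using monicp_power[OF monicp_pCons[of "- r"], of i] by (simp_all add: sec_pCons)
  have ct: "coeff t i = c" unfolding t using monicpD(1)[OF pw(1)] pw(2) by simp
  have i0: "i = 0"
  proof (rule ccontr)
    assume "i \<noteq> 0"
    then have "coeff t (i - 1) = c * (of_nat i * - r)"
      unfolding t using pw(3) pw(2) by (simp add: sec_eq)
    then have "X j = - (of_nat 2 * coeff t (i - 1) / (of_nat i * coeff t i))"
      using \<open>i \<noteq> 0\<close> c0 by (simp add: ct r_def field_simps)
    also have "\<dots> \<in> M"
      using coeffs_inD[OF d(9)] by (intro is_subringD(4,5,10)[OF MA] is_subfieldD(3)[OF M(1)])
    finally show False using M(3) by simp
  qed
  have tc: "t = [:c:]" using t i0 by simp
  have cM': "c \<in> M" using coeffs_inD[OF d(9), of 0] tc by simp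
  define f1 where "f1 = smult (inverse c) f'"
  have f1: "f1 \<in> coeffs_in M" unfolding f1_def using cM' by (intro cM is_subfieldD(2)[OF M(1)] d)
  have F1: "F = poly f1 (X n)" using Ft c0 by (simp add: f1_def tc field_simps)
  have "S ^ k * f1 = C"
    unfolding f1_def mult_smult_right eq tc using c0 by simp
  then have "f1 * S ^ k \<in> coeffs_in (poly_ring n)" using C(1) by (simp add: mult.commute)
  moreover have "inverse (lead_coeff (S ^ k)) \<in> poly_ring n"
  proof -
    have "lead_coeff (S ^ k) = K (2 ^ k)"
      unfolding lead_coeff_power by (simp add: S_def rhom.hom_power[OF rhom_K] rhom.hom_numeral[OF rhom_K])
    moreover have "inverse (K (2 ^ k)) = K (inverse (2 ^ k) :: 'a)"
    proof (rule inverse_unique)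
      have "K (2 ^ k) * K (inverse (2 ^ k) :: 'a) = K 1"
        unfolding K.hom_mult[symmetric] by (subst right_inverse) simp_all
      then show "K (2 ^ k) * K (inverse (2 ^ k) :: 'a) = 1" by simp
    qed
    ultimately show ?thesis by simp
  qed
  moreover have "S ^ k \<in> coeffs_in (poly_ring n)" using S by (intro is_subring_coeffs_in[OF is_subring_poly_ring])
  moreover have "S ^ k \<noteq> 0" by (simp add: S_def)
  ultimately have "f1 \<in> coeffs_in (poly_ring n)"
    using coeffs_in_divisor[OF is_subring_poly_ring, where g = "S ^ k" and q = f1] by blast
  with f1 have "f1 \<in> coeffs_in (M \<inter> poly_ring n)" by (auto simp: coeffs_in_def)
  with F1 that show thesis by blast
qed

end

section \<open>Restriction to the curve\<close>

lemma coeff_pcompose_linear: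
  fixes f :: "'b::comm_ring_1 poly"
  shows "coeff (pcompose f [:a, 1:]) k = (\<Sum>i\<le>degree f. coeff f i * (if k \<le> i then of_nat (i choose k) * a ^ (i - k) else 0))"
proof -
  have "pcompose f [:a, 1:] = (\<Sum>i\<le>degree f. smult (coeff f i) ([:a, 1:] ^ i))"
    using pcompose_altdef[of f "[:a, 1:]"] by (simp add: poly_altdef coeff_map_poly degree_map_poly)
  moreover have "coeff ([:a, 1:] ^ i) k = (if k \<le> i then of_nat (i choose k) * a ^ (i - k) else 0)" for i
  proof (cases "k \<le> i")
    case False
    have "degree ([:a, 1:] ^ i) \<le> degree [:a, 1:] * i" by (rule degree_power_le)
    then have "degree ([:a, 1:] ^ i) < k" using False by simp
    then show ?thesis using False by (simp add: coeff_eq_0)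
  qed (simp add: coeff_linear_poly_power)
  ultimately show ?thesis by (simp add: coeff_sum)
qed

text \<open>G(z) = f(t + z) has constant values at all z = -a, a in the infinite field k, so its
  coefficients are constants. If r = deg f were positive, the coefficient f_(r-1) + r f_r t of
  z^(r-1), with f_r a nonzero constant, would put t into V.\<close>

lemma transcendental_values:
  fixes f :: "'a::field_char_0 poly poly"
  assumes V: "0 \<in> V" "\<And>a b. a \<in> V \<Longrightarrow> b \<in> V \<Longrightarrow> a + b \<in> V" "\<And>c a. a \<in> V \<Longrightarrow> smult c a \<in> V"
    and V1: "1 \<in> V" "[:0, 1:] \<notin> V" and f: "\<And>i. coeff f i \<in> V"
    and c: "\<And>a. degree (poly f [:- a, 1:]) = 0"
  shows "\<exists>c. f = [:[:c:]:]"
proof -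
  define G where "G = pcompose f [:[:0, 1:], 1:]"
  have Gv: "poly G [:- a:] = poly f [:- a, 1:]" for a by (simp add: G_def poly_pcompose)
  have Gc: "degree (coeff G k) = 0" for k
  proof (rule ccontr)
    define m where "m = degree (coeff G k)"
    assume "degree (coeff G k) \<noteq> 0"
    then have m: "m > 0" "coeff (coeff G k) m \<noteq> 0" by (auto simp: m_def)
    \<comment> \<open>The coefficient of t^m, taken in every coefficient of \<open>G\<close>: a
      polynomial over k that vanishes everywhere.\<close>
    define H where "H = map_poly (\<lambda>g. coeff g m) G"
    have ce: "coeff (poly F [:y:]) m = poly (map_poly (\<lambda>g. coeff g m) F) y" for F :: "'a poly poly" and y
    proof (induction F)
      case (pCons b F)
      then show ?case by (simp add: map_poly_pCons)
    qed simp
    have "poly H y = 0" for y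
    proof -
      have "degree (poly G [:y:]) = 0" using Gv[of "- y"] c[of "- y"] by simp
      then show ?thesis using m(1) unfolding H_def ce[symmetric] by (intro coeff_eq_0) simp
    qed
    then have "H = 0" using poly_roots_finite[of H] infinite_UNIV_char_0[where 'a = 'a] by auto
    moreover have "coeff H k \<noteq> 0" using m(2) by (simp add: H_def coeff_map_poly)
    ultimately show False by simp
  qed
  have c0: "\<exists>c. coeff G k = [:c:]" for k using Gc[of k] by (metis degree_eq_zeroE)
  have V_const: "[:c:] \<in> V" for c using V(3)[OF V1(1), of c] by simp
  define r where "r = degree f"
  have top: "coeff G r = coeff f r"
    unfolding G_def coeff_pcompose_linear r_def[symmetric] by (subst sum.remove[of _ r]) (auto intro!: sum.neutral)
  have "r = 0"
  proof (rule ccontr)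
    assume "r \<noteq> 0"
    then obtain l where l: "r = Suc l" by (cases r) auto
    obtain c where c: "coeff f r = [:c:]" using c0[of r] top by auto
    have cnz: "c \<noteq> 0" using c \<open>r \<noteq> 0\<close> by (auto simp: r_def)
    obtain e where e: "coeff G l = [:e:]" using c0 by auto
    have "coeff G l = coeff f l + coeff f r * (of_nat r * [:0, 1:])"
      unfolding G_def coeff_pcompose_linear r_def[symmetric]
      by (subst sum.remove[of _ r], simp, simp, subst sum.remove[of _ l])
        (auto simp: l intro!: sum.neutral)
    then have "smult (of_nat r * c) [:0, 1:] = [:e:] + smult (-1) (coeff f l)"
      unfolding c e by (simp add: of_nat_poly algebra_simps)
    also have "\<dots> \<in> V" by (intro V V_const f)
    finally have "smult (inverse (of_nat r * c)) (smult (of_nat r * c) [:0, 1:]) \<in> V" by (rule V)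
    moreover have "smult (inverse (of_nat r * c)) (smult (of_nat r * c) [:0, 1:]) = [:0, 1:]"
    proof -
      have "of_nat r * c \<noteq> 0" using cnz \<open>r \<noteq> 0\<close> by simp
      then show ?thesis by (simp only: smult_smult) (subst left_inverse, simp_all)
    qed
    ultimately show False using V1 by metis
  qed
  then have "degree f = 0" by (simp add: r_def)
  then obtain g where g: "f = [:g:]" by (metis degree_eq_zeroE)
  have "degree g = 0" using c[of 0] by (simp add: g)
  then obtain b where "g = [:b:]" by (metis degree_eq_zeroE)
  with g show ?thesis by blast
qed

lemma pv_ratvar_0D:
  assumes "pv (ratvar j) \<phi> = 0"
  shows "\<phi> = 0"
proof -
  have "\<exists>p. of_mpoly p = pv (ratvar j) \<phi> \<and> uev (\<lambda>_. [:0, 1:]) p = \<phi>"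
  proof (induction \<phi>)
    case 0
    show ?case by (intro exI[of _ 0]) (simp add: rhom.ev_zero[OF rhom_const_poly])
  next
    case (pCons c \<phi>)
    then obtain p where "of_mpoly p = pv (ratvar j) \<phi>" "uev (\<lambda>_. [:0, 1:]) p = \<phi>" by auto
    then show ?case
      by (intro exI[of _ "cst c + var j * p"])
        (simp add: K_def ratvar_eq rhom.ev_add[OF rhom_const_poly] rhom.ev_mult[OF rhom_const_poly]
          rhom.ev_cst[OF rhom_const_poly] rhom.ev_var[OF rhom_const_poly])
  qed
  with assms show ?thesis by (auto simp: rhom.ev_zero[OF rhom_const_poly])
qed

lemma pv_pcompose: "pv y (pcompose \<phi> \<psi>) = pv (pv y \<psi>) \<phi>"
proof -
  interpret rhom "pv y" by (rule rhom_pv)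
  show ?thesis by (induction \<phi>) (simp_all add: pcompose_pCons hom_add hom_mult)
qed

lemma pv_reflect_poly:
  assumes "y \<noteq> 0"
  shows "pv y (reflect_poly \<phi>) = y ^ degree \<phi> * pv (1 / y) \<phi>"
proof -
  have d: "degree (map_poly K \<phi>) = degree \<phi>" by (rule degree_map_poly) (simp add: K_eq_0_iff)
  have "map_poly K (reflect_poly \<phi>) = reflect_poly (map_poly K \<phi>)"
    by (rule poly_eqI) (simp add: coeff_map_poly coeff_reflect_poly d K.hom_zero)
  then show ?thesis using assms
    unfolding pv_def by (simp add: poly_reflect_poly_nz d inverse_eq_divide)
qed

text \<open>Multiply by the power of x_j of exponent deg \<phi> and put x_j = 0: the left side gives
  the leading coefficient of \<phi>, the right side 0 if the degree is positive.\<close>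

lemma no_pole_constant:
  assumes "pv (1 / ratvar j) \<phi> = pv (ratvar j) \<psi>"
  shows "degree \<phi> = 0"
proof (rule ccontr)
  assume d: "degree \<phi> \<noteq> 0"
  interpret p: rhom "pv (ratvar j :: 'a ratfun)" by (rule rhom_pv)
  have nz: "ratvar j \<noteq> (0 :: 'a ratfun)"
    using pv_ratvar_0D[of j "[:0, 1:]"] by auto
  have m: "pv (ratvar j) (monom 1 k) = (ratvar j :: 'a ratfun) ^ k" for k
    by (simp add: monom_altdef p.hom_power)
  have "pv (ratvar j) (reflect_poly \<phi> - monom 1 (degree \<phi>) * \<psi>) = 0"
    by (simp add: p.hom_diff p.hom_mult m pv_reflect_poly[OF nz] assms)
  then have "reflect_poly \<phi> = monom 1 (degree \<phi>) * \<psi>" using pv_ratvar_0D by fastforce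
  then have "coeff (reflect_poly \<phi>) 0 = coeff (monom 1 (degree \<phi>) * \<psi>) 0" by simp
  then have "lead_coeff \<phi> = 0" using d by (simp add: coeff_mult)
  with d show False by auto
qed

text \<open>Restriction to the curve, with z left free. The parameter t is realised as x_j, so that
  the restrictions stay in the same field and \<sigma> applies to them.\<close>

definition rs :: "nat \<Rightarrow> (nat \<Rightarrow> 'a::field poly) \<Rightarrow> nat \<Rightarrow> (nat, 'a) mpoly \<Rightarrow> 'a ratfun" where
  "rs j \<Phi> n = ev K (\<lambda>i. if i < n then pv (ratvar j) (\<Phi> i) else ratvar i)"

lemma rhom_rs: "rhom (rs j \<Phi> n)"
  unfolding rs_def by (rule rhom.rhom_ev[OF rhom_K])

lemma rs_cst [simp]: "rs j \<Phi> n (cst c) = K c"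
  unfolding rs_def by (rule rhom.ev_cst[OF rhom_K])

lemma rs_curve: "poly_vars p \<subseteq> {..<n} \<Longrightarrow> rs j \<Phi> n p = pv (ratvar j) (uev \<Phi> p)"
  unfolding rs_def pv_ev by (rule ev_agree[OF rhom_K]) auto

lemma coeffs_in_poly_ringE:
  assumes "f \<in> coeffs_in (poly_ring n)"
  obtains p where "\<And>i. coeff f i = of_mpoly (p i)" "\<And>i. poly_vars (p i) \<subseteq> {..<n}"
    "poly f (ratvar n) = of_mpoly (\<Sum>i\<le>degree f. p i * var n ^ i)"
    "poly_vars (\<Sum>i\<le>degree f. p i * var n ^ i) \<subseteq> {..<Suc n}"
    "\<And>j \<Phi>. rs j \<Phi> n (\<Sum>i\<le>degree f. p i * var n ^ i) = (\<Sum>i\<le>degree f. pv (ratvar j) (uev \<Phi> (p i)) * ratvar n ^ i)"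
proof -
  have "\<forall>i. \<exists>q. coeff f i = of_mpoly q \<and> poly_vars q \<subseteq> {..<n}"
    using coeffs_inD[OF assms] by (auto simp: poly_ring_def)
  then obtain p where p: "\<And>i. coeff f i = of_mpoly (p i)" "\<And>i. poly_vars (p i) \<subseteq> {..<n}" by metis
  define S where "S = (\<Sum>i\<le>degree f. p i * var n ^ i)"
  have pf: "poly f (ratvar n) = of_mpoly S" unfolding S_def by (simp add: poly_altdef p ratvar_eq)
  have "poly f (ratvar n) \<in> poly_ring (Suc n)"
    by (intro poly_in_subring[OF is_subring_poly_ring] ratvar_in_poly_ring)
      (use assms coeffs_in_mono[OF poly_ring_mono[of n "Suc n"]] in auto)
  then have vS: "poly_vars S \<subseteq> {..<Suc n}" unfolding pf by (auto simp: poly_ring_def)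
  have "rs j \<Phi> n S = (\<Sum>i\<le>degree f. pv (ratvar j) (uev \<Phi> (p i)) * ratvar n ^ i)" for j \<Phi>
  proof -
    interpret rhom "rs j \<Phi> n" by (rule rhom_rs)
    have "rs j \<Phi> n (var n) = ratvar n" unfolding rs_def by (simp add: rhom.ev_var[OF rhom_K])
    then show ?thesis unfolding S_def by (simp add: hom_sum hom_mult hom_power rs_curve[OF p(2)])
  qed
  with p pf vS that show thesis unfolding S_def by blast
qed

context curve
begin

text \<open>In \<sigma>(F) put z = a and x_i = 0 for the other i \<noteq> j. With T = 1/x_j + 2a
  this gives F on the curve at t = T with z = T - a, a polynomial in 1/x_j. It is also a polynomial
  in x_j, hence constant for every a, and \<open>transcendental_values\<close> applies to the
  restricted coefficients.\<close>

lemma upper_bound: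
  assumes A: "is_subring A" "\<And>c. K c \<in> A" "A \<subseteq> poly_ring n"
    and t: "\<And>p. of_mpoly p \<in> A \<Longrightarrow> uev \<Phi> p \<noteq> [:0, 1:]"
    and f: "f \<in> coeffs_in A" "poly f (X n) = of_mpoly q" and F: "P q \<in> poly_ring (Suc n)"
  shows "rs j \<Phi> n q \<in> range K"
proof -
  have "f \<in> coeffs_in (poly_ring n)" using f(1) coeffs_in_mono[OF A(3)] by auto
  then obtain p where p: "\<And>i. coeff f i = of_mpoly (p i)" "\<And>i. poly_vars (p i) \<subseteq> {..<n}"
    "poly f (ratvar n) = of_mpoly (\<Sum>i\<le>degree f. p i * var n ^ i)"
    "\<And>j \<Phi>. rs j \<Phi> n (\<Sum>i\<le>degree f. p i * var n ^ i) = (\<Sum>i\<le>degree f. pv (ratvar j) (uev \<Phi> (p i)) * ratvar n ^ i)"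
    by (rule coeffs_in_poly_ringE) blast
  have q: "q = (\<Sum>i\<le>degree f. p i * var n ^ i)" using p(3) unfolding f(2) by (simp only: of_mpoly_eq_iff)
  define e where "e = ev (\<lambda>c :: 'a. [:c:]) \<Phi>"
  interpret e: rhom e unfolding e_def by (rule rhom.rhom_ev[OF rhom_const_poly])
  define fb where "fb = (\<Sum>i\<le>degree f. monom (e (p i)) i)"
  have fb: "coeff fb i = (if i \<le> degree f then e (p i) else 0)" for i
    unfolding fb_def by (simp add: coeff_sum)
  obtain b where b: "P q = of_mpoly b" "poly_vars b \<subseteq> {..<Suc n}" using F by (auto simp: poly_ring_def)
  have "\<exists>c. fb = [:[:c:]:]"
  proof (rule transcendental_values[where V = "{e p | p. of_mpoly p \<in> A}"])
    note Ac = is_subringD[OF A(1)]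
    have ec: "e (cst c) = [:c:]" for c unfolding e_def by (rule rhom.ev_cst[OF rhom_const_poly])
    have "e 0 = 0" "e 1 = 1" by simp_all
    then show "0 \<in> {e p | p. of_mpoly p \<in> A}" "1 \<in> {e p | p. of_mpoly p \<in> A}"
      using Ac(1,2) by (metis (mono_tags, lifting) mem_Collect_eq of_mpoly.hom_zero of_mpoly.hom_one)+
    show "a + b \<in> {e p | p. of_mpoly p \<in> A}"
      if "a \<in> {e p | p. of_mpoly p \<in> A}" "b \<in> {e p | p. of_mpoly p \<in> A}" for a b
      using that Ac(3) by (auto simp flip: e.hom_add)
    show "smult c a \<in> {e p | p. of_mpoly p \<in> A}" if "a \<in> {e p | p. of_mpoly p \<in> A}" for c a
    proof -
      from that obtain p where "a = e p" "of_mpoly p \<in> A" by auto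
      then have "smult c a = e (cst c * p)" "of_mpoly (cst c * p) \<in> A"
        using Ac(5)[OF A(2)[of c]] by (simp_all add: e.hom_mult ec K_def)
      then show ?thesis by blast
    qed
    show "[:0, 1:] \<notin> {e p | p. of_mpoly p \<in> A}" using t by (auto simp: e_def dest!: sym[of "[:0, 1:]"])
    show "coeff fb i \<in> {e p | p. of_mpoly p \<in> A}" for i
      using coeffs_inD[OF f(1), of i] \<open>0 \<in> {e p | p. of_mpoly p \<in> A}\<close> unfolding fb p(1) by auto
    fix a :: 'a
    define h where "h = ev K (\<lambda>i. if i = j then X j else if i = n then K a else 0)"
    have rh: "rhom h" unfolding h_def by (rule rhom.rhom_ev[OF rhom_K])
    have hK: "h (cst c) = K c" for c unfolding h_def by (rule rhom.ev_cst[OF rhom_K])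
    have hv: "h (var i) = (if i = j then X j else if i = n then K a else 0)" for i
      unfolding h_def by (rule rhom.ev_var[OF rhom_K])
    note R = Rel_poly[OF rh] Rel_K[OF rh hK] Rel_add[OF rh] Rel_mult[OF rh] Rel_diff[OF rh hK]
    have v: "Rel (var j) h (X i) (h (var i))" for i using R(1)[of "var j" "var i"] by (simp add: ratvar_eq)
    have inv: "Rel (var j) h (1 / X j) (1 / X j)"
      using Rel_inverse[OF rh, of "var j"] Xj0[of j] by (simp add: ratvar_eq hv)
    have two: "Rel (var j) h 2 2" using R(2)[of "var j" 2] by (simp add: K.hom_numeral)
    have vn: "Rel (var j) h (X n) (K a)" using v[of n] jn by (simp add: hv)
    define T where "T = 1 / X j + 2 * K a"
    have \<tau>: "Rel (var j) h \<tau> T" unfolding \<tau>_def T_def by (intro R inv two vn)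
    have \<zeta>: "Rel (var j) h \<zeta> (pv T [:- a, 1:])"
      using R(3)[OF inv vn] by (simp add: \<zeta>_def T_def K.hom_uminus add.commute)
    have th: "Rel (var j) h (th i) (if i = n then pv T [:- a, 1:] else if i < n then pv T (\<Phi> i) else 0)" for i
    proof -
      consider "i = j" | "i = n" "i \<noteq> j" | "i < n" "i \<noteq> j" | "i > n" using jn by linarith
      then show ?thesis
      proof cases
        case 3
        have "Rel (var j) h (X i * X j ^ N + pv \<tau> (\<Phi> i)) (h (var i) * h (var j) ^ N + pv T (\<Phi> i))"
          by (intro R v Rel_power[OF rh] Rel_pv[OF rh hK] \<tau>)
        then show ?thesis using 3 by (simp add: th_def hv)
      qed (use \<tau> \<zeta> v[of i] jn in \<open>auto simp: th_def hv \<Phi>j\<close>)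
    qed
    define th' where "th' i = (if i = n then pv T [:- a, 1:] else if i < n then pv T (\<Phi> i) else 0)" for i
    have "Rel (var j) h (P q) (ev K th' q)"
      unfolding P_def th'_def by (rule Rel_ev[OF rh hK th])
    then have "ev K th' q = h b"
      unfolding b(1) by (rule Rel_polyD[OF rh hK]) (simp add: hv)
    moreover have "ev K th' q = pv T (poly fb [:- a, 1:])"
    proof -
      interpret E: rhom "ev K th'" by (rule rhom.rhom_ev[OF rhom_K])
      interpret T: rhom "pv T" by (rule rhom_pv)
      have vn: "ev K th' (var n) = pv T [:- a, 1:]" by (simp add: rhom.ev_var[OF rhom_K] th'_def)
      have pi: "ev K th' (p i) = pv T (e (p i))" for i
        unfolding e_def pv_ev by (rule ev_agree[OF rhom_K p(2)]) (auto simp: th'_def)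
      have "poly fb [:- a, 1:] = (\<Sum>i\<le>degree f. e (p i) * [:- a, 1:] ^ i)"
        unfolding fb_def by (simp add: poly_sum poly_monom)
      then show ?thesis
        unfolding q by (simp only: E.hom_sum E.hom_mult E.hom_power vn pi T.hom_sum T.hom_mult T.hom_power)
    qed
    moreover have "h b = pv (X j) (uev (\<lambda>i. if i = j then [:0, 1:] else if i = n then [:a:] else 0) b)"
      unfolding h_def pv_ev by (rule ev_agree[OF rhom_K, of _ UNIV]) auto
    \<comment> \<open>T is linear in 1/x_j, so expressing it in this way does not change the
      degree.\<close>
    moreover have "T = pv (1 / X j) [:2 * a, 1:]" by (simp add: T_def K.hom_mult K.hom_numeral)
    ultimately have "degree (pcompose (poly fb [:- a, 1:]) [:2 * a, 1:]) = 0"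
      by (intro no_pole_constant) (simp only: pv_pcompose)
    then show "degree (poly fb [:- a, 1:]) = 0" by (simp add: degree_pcompose)
  qed
  then obtain c where c: "fb = [:[:c:]:]" by auto
  have "rs j \<Phi> n q = (\<Sum>i\<le>degree f. pv (X j) (coeff fb i) * X n ^ i)"
    unfolding q p(4) fb e_def by simp
  also have "\<dots> = K c"
    unfolding c by (subst sum.remove[of _ 0]) (auto intro!: sum.neutral simp: coeff_pCons split: nat.splits)
  finally show ?thesis by simp
qed

end

section \<open>Approximation along the curve\<close>

context curve
begin

text \<open>\<sigma> with the perturbations x_i x_j^N removed. It is \<sigma> after restriction to
  the curve and does not depend on \<open>N\<close>.\<close>

definition "th0 i = (if i = n then \<zeta> else if i < n then pv \<tau> (\<Phi> i) else X i)"

lemma \<sigma>_rs: "\<sigma> (rs j \<Phi> n p) = ev K th0 p"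
proof -
  have "\<sigma> (rs j \<Phi> n p) = ev (\<lambda>c. \<sigma> (K c)) (\<lambda>i. \<sigma> (if i < n then pv (X j) (\<Phi> i) else X i)) p"
    unfolding rs_def by (rule hom_ev[OF rhom_\<sigma> rhom_K])
  also have "(\<lambda>i. \<sigma> (if i < n then pv (X j) (\<Phi> i) else X i)) = th0"
    using jn by (auto simp: fun_eq_iff th0_def hom_pv[OF rhom_\<sigma>] \<sigma>_X th_def)
  finally show ?thesis by simp
qed

lemma th0_curve: "poly_vars p \<subseteq> {..<n} \<Longrightarrow> ev K th0 p = pv \<tau> (uev \<Phi> p)"
  unfolding pv_ev by (rule ev_agree[OF rhom_K]) (auto simp: th0_def)

lemma X_\<tau>: "X j * \<tau> = 1 + 2 * X n * X j" and X_\<zeta>: "X j * \<zeta> = 1 + X n * X j"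
  by (simp_all add: \<tau>_def \<zeta>_def field_simps)

lemma X_\<tau>_in: "X j * \<tau> \<in> poly_ring (Suc n)" and X_\<zeta>_in: "X j * \<zeta> \<in> poly_ring (Suc n)"
proof -
  have "1 + K 2 * X n * X j \<in> poly_ring (Suc n)" "1 + X n * X j \<in> poly_ring (Suc n)"
    using jn by (intro poly_ring_closed(2,3,5) K_in_poly_ring ratvar_in_poly_ring; simp)+
  then show "X j * \<tau> \<in> poly_ring (Suc n)" "X j * \<zeta> \<in> poly_ring (Suc n)"
    by (simp_all add: X_\<tau> X_\<zeta> K.hom_numeral)
qed

end

text \<open>The point is that \<open>c\<close> precedes \<open>N\<close>: it bounds the poles of the
  unperturbed images, while every error term contains a factor x_j^N. For this order of quantifiers
  the statement has to stand outside the locale.\<close>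

lemma approximation:
  fixes \<Phi> :: "nat \<Rightarrow> 'a::field_char_0 poly"
  assumes j: "j < n" "\<Phi> j = [:0, 1:]" and p: "poly_vars p \<subseteq> {..<Suc n}"
  shows "\<exists>c. \<forall>N. ratvar j ^ c * ev K (curve.th0 n j \<Phi>) p \<in> poly_ring (Suc n) \<and>
    (\<exists>r\<in>poly_ring (Suc n). ratvar j ^ c * (curve.P n j N \<Phi> p - ev K (curve.th0 n j \<Phi>) p) = ratvar j ^ N * r)"
  using p
proof (induction p rule: mpoly_induct)
  case (cst a)
  show ?case
  proof (intro exI[of _ 0] allI)
    fix N
    interpret curve n j N \<Phi> using j by unfold_locales
    show "X j ^ 0 * ev K th0 (cst a) \<in> poly_ring (Suc n) \<and>
        (\<exists>r\<in>poly_ring (Suc n). X j ^ 0 * (P (cst a) - ev K th0 (cst a)) = X j ^ N * r)"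
      by (auto simp: rhom.ev_cst[OF rhom_K] intro!: bexI[of _ 0] poly_ring_closed(1))
  qed
next
  case (var i)
  show ?case
  proof (intro exI[of _ "Suc (degree (\<Phi> i))"] allI)
    fix N
    interpret curve n j N \<Phi> using j by unfold_locales
    let ?c = "Suc (degree (\<Phi> i))"
    note c = poly_ring_closed
    have Xj: "X j \<in> poly_ring (Suc n)" and Xi: "X i \<in> poly_ring (Suc n)" using jn var by auto
    have "X j ^ ?c * pv \<tau> (\<Phi> i) \<in> poly_ring (Suc n)"
      by (intro pv_bounded is_subring_poly_ring X_\<tau>_in Xj) auto
    moreover have "X j ^ degree (\<Phi> i) * (X j * \<zeta>) \<in> poly_ring (Suc n)"
      by (intro c(5) c(7) X_\<zeta>_in Xj)
    ultimately have th0: "X j ^ ?c * th0 i \<in> poly_ring (Suc n)"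
      using var by (auto simp: th0_def mult_ac)
    \<comment> \<open>The images of x_j and z carry no perturbation.\<close>
    define y where "y = (if i = j \<or> i = n then 0 else X i)"
    have y: "X j ^ ?c * y \<in> poly_ring (Suc n)" unfolding y_def
      by (cases "i = j \<or> i = n") (simp_all only: if_True if_False mult_zero_right c(1) c(5)[OF c(7)[OF Xj] Xi])
    have "th i - th0 i = X j ^ N * y"
      using var jn \<Phi>j by (auto simp: th_def th0_def y_def)
    then have "X j ^ ?c * (P (var i) - ev K th0 (var i)) = X j ^ N * (X j ^ ?c * y)"
      unfolding P_var rhom.ev_var[OF rhom_K] by (simp only: mult.left_commute)
    with y th0 show "X j ^ ?c * ev K th0 (var i) \<in> poly_ring (Suc n) \<and>
        (\<exists>r\<in>poly_ring (Suc n). X j ^ ?c * (P (var i) - ev K th0 (var i)) = X j ^ N * r)"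
      unfolding rhom.ev_var[OF rhom_K] by blast
  qed
next
  case (add p q)
  then obtain c d where IH:
    "\<And>N. ratvar j ^ c * ev K (curve.th0 n j \<Phi>) p \<in> poly_ring (Suc n)"
    "\<And>N. \<exists>r\<in>poly_ring (Suc n). ratvar j ^ c * (curve.P n j N \<Phi> p - ev K (curve.th0 n j \<Phi>) p) = ratvar j ^ N * r"
    "\<And>N. ratvar j ^ d * ev K (curve.th0 n j \<Phi>) q \<in> poly_ring (Suc n)"
    "\<And>N. \<exists>r\<in>poly_ring (Suc n). ratvar j ^ d * (curve.P n j N \<Phi> q - ev K (curve.th0 n j \<Phi>) q) = ratvar j ^ N * r"
    by metis
  show ?case
  proof (intro exI[of _ "c + d"] allI)
    fix N
    interpret curve n j N \<Phi> using j by unfold_locales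
    interpret E: rhom "ev K th0" by (rule rhom.rhom_ev[OF rhom_K])
    note c = poly_ring_closed
    have Xj: "X j ^ k \<in> poly_ring (Suc n)" for k using jn by (intro c) auto
    obtain r1 r2 where r: "r1 \<in> poly_ring (Suc n)" "X j ^ c * (P p - ev K th0 p) = X j ^ N * r1"
      "r2 \<in> poly_ring (Suc n)" "X j ^ d * (P q - ev K th0 q) = X j ^ N * r2" using IH(2)[of N] IH(4)[of N] by auto
    have "X j ^ (c + d) * ev K th0 (p + q) = X j ^ d * (X j ^ c * ev K th0 p) + X j ^ c * (X j ^ d * ev K th0 q)"
      by (simp add: E.hom_add power_add algebra_simps)
    also have "\<dots> \<in> poly_ring (Suc n)" by (intro c(3) c(5)[OF Xj] IH)
    finally have *: "X j ^ (c + d) * ev K th0 (p + q) \<in> poly_ring (Suc n)" .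
    have "X j ^ (c + d) * (P (p + q) - ev K th0 (p + q)) =
        X j ^ d * (X j ^ c * (P p - ev K th0 p)) + X j ^ c * (X j ^ d * (P q - ev K th0 q))"
      by (simp add: E.hom_add rhom.hom_add[OF rhom_P] power_add algebra_simps)
    also have "\<dots> = X j ^ N * (X j ^ d * r1 + X j ^ c * r2)" unfolding r by (simp add: algebra_simps)
    finally have "X j ^ (c + d) * (P (p + q) - ev K th0 (p + q)) = X j ^ N * (X j ^ d * r1 + X j ^ c * r2)" .
    moreover have "X j ^ d * r1 + X j ^ c * r2 \<in> poly_ring (Suc n)" by (intro c(3) c(5)[OF Xj] r)
    ultimately show "X j ^ (c + d) * ev K th0 (p + q) \<in> poly_ring (Suc n) \<and>
        (\<exists>r\<in>poly_ring (Suc n). X j ^ (c + d) * (P (p + q) - ev K th0 (p + q)) = X j ^ N * r)" using * by blast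
  qed
next
  case (mult p q)
  then obtain c d where IH:
    "\<And>N. ratvar j ^ c * ev K (curve.th0 n j \<Phi>) p \<in> poly_ring (Suc n)"
    "\<And>N. \<exists>r\<in>poly_ring (Suc n). ratvar j ^ c * (curve.P n j N \<Phi> p - ev K (curve.th0 n j \<Phi>) p) = ratvar j ^ N * r"
    "\<And>N. ratvar j ^ d * ev K (curve.th0 n j \<Phi>) q \<in> poly_ring (Suc n)"
    "\<And>N. \<exists>r\<in>poly_ring (Suc n). ratvar j ^ d * (curve.P n j N \<Phi> q - ev K (curve.th0 n j \<Phi>) q) = ratvar j ^ N * r"
    by metis
  show ?case
  proof (intro exI[of _ "c + d"] allI)
    fix N
    interpret curve n j N \<Phi> using j by unfold_locales
    interpret E: rhom "ev K th0" by (rule rhom.rhom_ev[OF rhom_K])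
    note c = poly_ring_closed
    have Xj: "X j ^ k \<in> poly_ring (Suc n)" for k using jn by (intro c) auto
    obtain r1 r2 where r: "r1 \<in> poly_ring (Suc n)" "X j ^ c * (P p - ev K th0 p) = X j ^ N * r1"
      "r2 \<in> poly_ring (Suc n)" "X j ^ d * (P q - ev K th0 q) = X j ^ N * r2" using IH(2)[of N] IH(4)[of N] by auto
    have "X j ^ (c + d) * ev K th0 (p * q) = (X j ^ c * ev K th0 p) * (X j ^ d * ev K th0 q)"
      by (simp add: E.hom_mult power_add mult_ac)
    also have "\<dots> \<in> poly_ring (Suc n)" by (intro c(5)[OF IH(1) IH(3)])
    finally have *: "X j ^ (c + d) * ev K th0 (p * q) \<in> poly_ring (Suc n)" .
    have q: "X j ^ d * P q = X j ^ d * ev K th0 q + X j ^ N * r2" unfolding r(4)[symmetric] by (simp add: algebra_simps)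
    have "X j ^ (c + d) * (P (p * q) - ev K th0 (p * q)) =
        (X j ^ c * (P p - ev K th0 p)) * (X j ^ d * P q) + (X j ^ c * ev K th0 p) * (X j ^ d * (P q - ev K th0 q))"
      by (simp add: E.hom_mult rhom.hom_mult[OF rhom_P] power_add algebra_simps)
    also have "\<dots> = X j ^ N * (r1 * (X j ^ d * ev K th0 q + X j ^ N * r2) + (X j ^ c * ev K th0 p) * r2)"
      unfolding r q by (simp add: algebra_simps)
    finally have "X j ^ (c + d) * (P (p * q) - ev K th0 (p * q)) =
      X j ^ N * (r1 * (X j ^ d * ev K th0 q + X j ^ N * r2) + (X j ^ c * ev K th0 p) * r2)" .
    moreover have "r1 * (X j ^ d * ev K th0 q + X j ^ N * r2) + (X j ^ c * ev K th0 p) * r2 \<in> poly_ring (Suc n)"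
      by (intro c(3) c(5)[OF r(1)] c(5)[OF _ r(3)] Xj IH)
    ultimately show "X j ^ (c + d) * ev K th0 (p * q) \<in> poly_ring (Suc n) \<and>
        (\<exists>r\<in>poly_ring (Suc n). X j ^ (c + d) * (P (p * q) - ev K th0 (p * q)) = X j ^ N * r)" using * by blast
  qed
qed

text \<open>The divided difference of \<phi> obeys the same bound by x^d as the values of
  \<phi>.\<close>

lemma pv_difference:
  assumes A: "is_subring A" "\<And>c. K c \<in> A" "x \<in> A" "x * y \<in> A" "x * y' \<in> A"
  shows "degree \<phi> \<le> d \<Longrightarrow> \<exists>g. pv y \<phi> - pv y' \<phi> = (y - y') * g \<and> x ^ d * g \<in> A"
proof (induction \<phi> arbitrary: d)
  case 0
  show ?case using is_subringD(1)[OF A(1)] by (intro exI[of _ 0]) simp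
next
  case (pCons c \<phi>)
  show ?case
  proof (cases "\<phi> = 0")
    case True
    then show ?thesis using is_subringD(1)[OF A(1)] by (intro exI[of _ 0]) simp
  next
    case False
    then obtain e where e: "d = Suc e" "degree \<phi> \<le> e" using pCons.prems by (cases d) auto
    obtain g where g: "pv y \<phi> - pv y' \<phi> = (y - y') * g" "x ^ e * g \<in> A" using pCons.IH[OF e(2)] by auto
    have "pv y (pCons c \<phi>) - pv y' (pCons c \<phi>) = (y - y') * pv y \<phi> + y' * (pv y \<phi> - pv y' \<phi>)"
      by (simp add: algebra_simps)
    also have "\<dots> = (y - y') * (pv y \<phi> + y' * g)" unfolding g by (simp add: algebra_simps)
    finally have "pv y (pCons c \<phi>) - pv y' (pCons c \<phi>) = (y - y') * (pv y \<phi> + y' * g)" .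
    moreover have "x * (x ^ e * pv y \<phi>) + (x * y') * (x ^ e * g) \<in> A"
      by (intro is_subringD(3)[OF A(1)] is_subringD(5)[OF A(1) A(3)] is_subringD(5)[OF A(1) A(5)] g pv_bounded A e)
    then have "x ^ d * (pv y \<phi> + y' * g) \<in> A" by (simp add: e algebra_simps)
    ultimately show ?thesis by blast
  qed
qed

section \<open>The local ring of a coordinate hyperplane\<close>

text \<open>Reduction modulo x_j. Its localisation is the valuation ring, with uniformiser x_j, in
  which poles along x_j = 0 are measured.\<close>

definition hyp :: "nat \<Rightarrow> (nat, 'a::field) mpoly \<Rightarrow> 'a ratfun" where
  "hyp j = ev K (\<lambda>i. if i = j then 0 else ratvar i)"

lemma rhom_hyp: "rhom (hyp j)"
  unfolding hyp_def by (rule rhom.rhom_ev[OF rhom_K])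

lemma hyp_cst [simp]: "hyp j (cst c) = K c" and hyp_var [simp]: "hyp j (var i) = (if i = j then 0 else ratvar i)"
  unfolding hyp_def by (simp_all add: rhom.ev_cst[OF rhom_K] rhom.ev_var[OF rhom_K])

lemma hyp_remainder:
  assumes "poly_vars p \<subseteq> {..<m}" "j < m"
  shows "hyp j p \<in> poly_ring m \<and> (\<exists>r\<in>poly_ring m. of_mpoly p = hyp j p + ratvar j * r)"
  using assms(1)
proof (induction p rule: mpoly_induct)
  case (cst c)
  show ?case by (auto intro!: bexI[of _ 0] poly_ring_closed(1) simp flip: K_def)
next
  case (var i)
  show ?case using var poly_ring_closed(1,2)[of m]
    by (cases "i = j") (auto simp flip: ratvar_eq intro!: bexI[of _ "if i = j then 1 else 0"])
next
  case (add p q)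
  then obtain r r' where r: "r \<in> poly_ring m" "of_mpoly p = hyp j p + ratvar j * r"
    "r' \<in> poly_ring m" "of_mpoly q = hyp j q + ratvar j * r'" by blast
  have "of_mpoly (p + q) = hyp j (p + q) + ratvar j * (r + r')"
    unfolding of_mpoly.hom_add rhom.hom_add[OF rhom_hyp] r by (simp add: algebra_simps)
  then show ?case using add r(1,3) by (auto simp: rhom.hom_add[OF rhom_hyp] intro: poly_ring_closed)
next
  case (mult p q)
  then obtain r r' where r: "r \<in> poly_ring m" "of_mpoly p = hyp j p + ratvar j * r"
    "r' \<in> poly_ring m" "of_mpoly q = hyp j q + ratvar j * r'" by blast
  have "of_mpoly (p * q) = hyp j (p * q) + ratvar j * (hyp j p * r' + r * hyp j q + ratvar j * (r * r'))"
    unfolding of_mpoly.hom_mult rhom.hom_mult[OF rhom_hyp] r by (simp add: algebra_simps)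
  moreover have "hyp j p * r' + r * hyp j q + ratvar j * (r * r') \<in> poly_ring m"
    by (intro poly_ring_closed(3,5) r mult[THEN conjunct1] ratvar_in_poly_ring assms)
  ultimately show ?case using mult by (auto simp: rhom.hom_mult[OF rhom_hyp] intro: poly_ring_closed(5))
qed

text \<open>If x_j y' is a polynomial and y' has no pole, this polynomial vanishes at x_j = 0 and is
  divisible by x_j. Local bounds thus return to the polynomial ring.\<close>

lemma loc_ring_poly:
  assumes "y \<in> loc_ring (hyp j)" "ratvar j ^ k * y \<in> poly_ring m" "j < m"
  shows "y \<in> poly_ring m"
  using assms
proof (induction k arbitrary: y)
  case (Suc k)
  have O: "is_subring (loc_ring (hyp j))" by (rule is_subring_loc_ring[OF rhom_hyp])
  have nz: "ratvar j \<noteq> (0 :: 'a ratfun)" using pv_ratvar_0D[of j "[:0, 1:]"] by auto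
  define y' where "y' = ratvar j ^ k * y"
  obtain p where p: "ratvar j * y' = of_mpoly p" "poly_vars p \<subseteq> {..<m}"
    using Suc.prems(2) by (auto simp: poly_ring_def y'_def mult.assoc)
  have "ratvar j ^ k \<in> loc_ring (hyp j)"
    unfolding ratvar_eq of_mpoly.hom_power[symmetric] by (rule of_mpoly_in_loc_ring[OF rhom_hyp])
  then have "y' \<in> loc_ring (hyp j)" unfolding y'_def by (intro is_subringD(5)[OF O] Suc.prems)
  then obtain a b where ab: "y' = of_mpoly a / of_mpoly b" "hyp j b \<noteq> 0" by (auto simp: loc_ring_def)
  have "b \<noteq> 0" using ab(2) by (auto simp: rhom.hom_zero[OF rhom_hyp])
  then have "of_mpoly p * of_mpoly b = of_mpoly (var j) * of_mpoly a"
    using p(1) ab(1) by (simp add: ratvar_eq field_simps)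
  then have "p * b = var j * a" by (simp only: of_mpoly_eq_iff flip: of_mpoly.hom_mult)
  from arg_cong[OF this, of "hyp j"] have "hyp j p = 0"
    using ab(2) by (simp add: rhom.hom_mult[OF rhom_hyp])
  then obtain r where "r \<in> poly_ring m" "of_mpoly p = ratvar j * r"
    using hyp_remainder[OF p(2) \<open>j < m\<close>] by auto
  then have "y' \<in> poly_ring m" using p(1) nz by simp
  then have "ratvar j ^ k * y \<in> poly_ring m" unfolding y'_def .
  from Suc.IH[OF Suc.prems(1) this Suc.prems(3)] show ?case .
qed simp

lemma loc_ring_unit:
  assumes h: "rhom h" and "y \<in> loc_ring h" "loc_hom h y \<noteq> 0"
  shows "1 / y \<in> loc_ring h"
proof -
  obtain p q where pq: "y = of_mpoly p / of_mpoly q" "h q \<noteq> 0" using assms(2) by (auto simp: loc_ring_def)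
  then have "h p \<noteq> 0" using assms(3) by (simp add: loc_hom_frac[OF h])
  then show ?thesis using loc_ringI[OF h, of p q] pq(1) by simp
qed

context curve
begin

text \<open>x_j \<tau> is 1 modulo x_j, so only the term of degree d survives.\<close>

lemma leading_pole:
  assumes "degree \<phi> \<le> d"
  shows "\<exists>g. X j ^ d * pv \<tau> \<phi> = of_mpoly g \<and> hyp j g = K (coeff \<phi> d)"
  using assms
proof (induction \<phi> arbitrary: d)
  case 0
  show ?case by (intro exI[of _ 0]) (simp add: rhom.hom_zero[OF rhom_hyp])
next
  case (pCons c \<phi>)
  show ?case
  proof (cases d)
    case 0
    then have "\<phi> = 0" using pCons.prems by (auto split: if_splits)
    then show ?thesis using 0 by (intro exI[of _ "cst c"]) (simp add: K_def)
  next
    case (Suc e)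
    then have "degree \<phi> \<le> e" using pCons.prems by (cases "\<phi> = 0") auto
    then obtain g where g: "X j ^ e * pv \<tau> \<phi> = of_mpoly g" "hyp j g = K (coeff \<phi> e)" using pCons.IH by auto
    have "X j ^ d * pv \<tau> (pCons c \<phi>) = X j ^ d * K c + (X j * \<tau>) * (X j ^ e * pv \<tau> \<phi>)"
      by (simp add: Suc algebra_simps)
    also have "\<dots> = of_mpoly (var j ^ d * cst c + (1 + 2 * var n * var j) * g)"
      unfolding g X_\<tau> by (simp add: ratvar_eq K_def)
    finally show ?thesis
      by (intro exI conjI) (assumption, simp add: rhom.hom_add[OF rhom_hyp] rhom.hom_mult[OF rhom_hyp]
        rhom.hom_power[OF rhom_hyp] rhom.hom_one[OF rhom_hyp] g Suc)
  qed
qed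

text \<open>\<open>U\<close> and \<open>V\<close> are the images of u and v, and V/U approximates
  \<tau>. As \<open>U\<close> has a pole of order exactly d, dividing by it gains d: V/U - \<tau> is
  divisible by x_j^(d + d * d). Applying \<phi> loses at most d again, which leaves x_j^(d * d) for
  U - \<phi>(V/U).\<close>

lemma local_coordinates:
  assumes \<phi>: "lead_coeff \<phi> = 1" "degree \<phi> = d" "d \<ge> 1"
    and r: "r1 \<in> loc_ring (hyp j)" "r2 \<in> loc_ring (hyp j)"
      "U - pv \<tau> \<phi> = X j ^ (d * d + 1) * r1" "V - \<tau> * pv \<tau> \<phi> = X j ^ (d * d + 1) * r2"
  shows "U \<noteq> 0" "X j ^ d * U \<in> loc_ring (hyp j)" "X j * (V / U) \<in> loc_ring (hyp j)" "\<zeta> - V / U \<in> loc_ring (hyp j)"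
    "\<exists>w\<in>loc_ring (hyp j). U - pv (V / U) \<phi> = X j ^ (d * d) * w"
proof -
  let ?O = "loc_ring (hyp j :: (nat, 'a) mpoly \<Rightarrow> _)"
  note h = rhom_hyp
  note O = is_subring_loc_ring[OF h]
  note c = is_subringD[OF O]
  have pO: "of_mpoly p \<in> ?O" for p by (rule of_mpoly_in_loc_ring[OF h])
  have XO: "X i \<in> ?O" for i unfolding ratvar_eq by (rule pO)
  have KO: "K a \<in> ?O" for a unfolding K_def by (rule pO)
  have Xp: "X j ^ k \<in> ?O" for k by (rule c(7)[OF XO])
  have \<tau>O: "X j * \<tau> \<in> ?O" using X_\<tau>_in pO by (auto simp: poly_ring_def)
  obtain g where g: "X j ^ d * pv \<tau> \<phi> = of_mpoly g" "hyp j g = 1"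
    using leading_pole[of \<phi> d] \<phi> by auto
  have U: "U = pv \<tau> \<phi> + X j ^ (d * d + 1) * r1" unfolding r(3)[symmetric] by simp
  define W where "W = X j ^ d * U"
  have W: "W = of_mpoly g + of_mpoly (var j ^ (d + d * d + 1)) * r1"
    unfolding W_def U distrib_left g by (simp add: ratvar_eq power_add)
  have W': "of_mpoly (var j ^ (d + d * d + 1)) * r1 \<in> ?O" by (rule c(5)[OF pO r(1)])
  show WO: "X j ^ d * U \<in> ?O" unfolding W_def[symmetric] W by (rule c(3)[OF pO W'])
  have "loc_hom (hyp j) W = hyp j g + hyp j (var j ^ (d + d * d + 1)) * loc_hom (hyp j) r1"
    unfolding W by (simp only: loc_add_mult(3)[OF h pO W'] loc_add_mult(4)[OF h pO r(1)] loc_hom_of_mpoly[OF h])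
  also have "\<dots> = 1" unfolding g by (simp add: rhom.hom_power[OF h] rhom.hom_mult[OF h])
  finally have W1: "loc_hom (hyp j) W = 1" .
  have iW: "1 / W \<in> ?O" using loc_ring_unit[OF h WO[folded W_def]] W1 by simp
  have W0: "W \<noteq> 0" using W1 loc_hom_of_mpoly[OF h, of j "0 :: (nat, 'a) mpoly"] by (auto simp: rhom.hom_zero[OF h])
  then show U0: "U \<noteq> 0" by (auto simp: W_def)
  define b where "b = V / U"
  define m where "m = (X j * r2 - X j * \<tau> * r1) * (1 / W)"
  have mO: "m \<in> ?O" unfolding m_def by (intro c(5)[OF _ iW] c(6) c(5)[OF XO r(2)] c(5)[OF \<tau>O r(1)])
  \<comment> \<open>The simple pole of \<tau> uses up the extra 1 in the exponent
    \<open>d * d + 1\<close>.\<close>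
  have "V - \<tau> * U = (V - \<tau> * pv \<tau> \<phi>) - \<tau> * (U - pv \<tau> \<phi>)" by (simp add: algebra_simps)
  also have "\<dots> = X j ^ (d * d) * (X j * r2 - X j * \<tau> * r1)" unfolding r by (simp add: algebra_simps)
  finally have VU: "V - \<tau> * U = X j ^ (d * d) * (X j * r2 - X j * \<tau> * r1)" .
  have b\<tau>: "b - \<tau> = X j ^ d * X j ^ (d * d) * m"
  proof -
    have "b - \<tau> = (V - \<tau> * U) / U" using U0 by (simp add: b_def field_simps)
    also have "\<dots> = X j ^ d * (V - \<tau> * U) / W" using U0 by (simp add: W_def)
    finally show ?thesis by (simp add: VU m_def)
  qed
  have bm: "b = \<tau> + X j ^ d * X j ^ (d * d) * m" unfolding b\<tau>[symmetric] by simp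
  have "X j * \<tau> + X j * (X j ^ d * X j ^ (d * d) * m) \<in> ?O"
    by (intro c(3)[OF \<tau>O] c(5)[OF XO] c(5)[OF _ mO] c(5)[OF Xp Xp])
  then show bO: "X j * (V / U) \<in> ?O" unfolding b_def[symmetric] bm by (simp add: distrib_left)
  have "- X n - X j ^ d * X j ^ (d * d) * m \<in> ?O"
    by (intro c(6) c(4) XO c(5)[OF _ mO] c(5)[OF Xp Xp])
  then show "\<zeta> - V / U \<in> ?O" unfolding b_def[symmetric] bm by (simp add: \<tau>_def \<zeta>_def algebra_simps)
  obtain e where e: "pv b \<phi> - pv \<tau> \<phi> = (b - \<tau>) * e" "X j ^ d * e \<in> ?O"
    using pv_difference[OF O KO XO bO[folded b_def] \<tau>O, of \<phi> d] \<phi> by auto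
  have "U - pv b \<phi> = (U - pv \<tau> \<phi>) - (pv b \<phi> - pv \<tau> \<phi>)" by simp
  also have "\<dots> = X j ^ (d * d) * (X j * r1 - m * (X j ^ d * e))" unfolding r e b\<tau> by (simp add: algebra_simps)
  finally show "\<exists>w\<in>?O. U - pv (V / U) \<phi> = X j ^ (d * d) * w"
    unfolding b_def[symmetric] using c(6)[OF c(5)[OF XO r(1)] c(5)[OF mO e(2)]] by blast
qed

end

section \<open>Bounding poles\<close>

interpretation KV: vector_space "\<lambda>c (y :: 'a::field ratfun). K c * y"
  by unfold_locales (simp_all add: algebra_simps K.hom_add K.hom_mult)

lemma pv_sum: "pv b g = (\<Sum>k\<le>degree g. K (coeff g k) * b ^ k)"
proof -
  have "degree (map_poly K g) = degree g" by (rule degree_map_poly) (simp add: K_eq_0_iff)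
  then show ?thesis unfolding pv_def by (simp add: poly_altdef coeff_map_poly K.hom_zero)
qed

text \<open>The local situation in the abstract: \<pi> is x_j, \<open>U\<close> the image of u,
  \<open>b\<close> the quotient of the images of v and u, and \<open>Z\<close> = \<zeta> - b. All
  that matters are the pole bounds and the relation U = \<phi>(b) up to \<pi>^(d * d).\<close>

locale pole_bound =
  fixes R :: "'a::field ratfun set" and \<pi> U b Z w :: "'a ratfun" and \<phi> :: "'a poly" and d :: nat
  assumes R: "is_subring R" and KR: "K c \<in> R" and \<pi>R: "\<pi> \<in> R"
    and UR: "\<pi> ^ d * U \<in> R" and bR: "\<pi> * b \<in> R" and ZR: "Z \<in> R" and wR: "w \<in> R"
    and \<delta>: "U - pv b \<phi> = \<pi> ^ (d * d) * w" and \<phi>: "lead_coeff \<phi> = 1" "degree \<phi> = d" "d \<ge> 1"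
begin

definition "mo i k = U ^ i * b ^ k"
text \<open>For k \<le> i the monomial is the image of u^(i-k) v^k, so \<open>V\<close> consists of
  images of elements of A.\<close>

definition "V = KV.span {mo i k | i k. k \<le> i}"
definition "W = {y. \<pi> ^ (d * (d + 1)) * y \<in> R}"
definition "C = KV.span {mo i k | i k. True}"
definition "VW = {v + y | v y. v \<in> V \<and> y \<in> W}"

lemmas r = is_subringD[OF R]

lemma \<pi>_power: "\<pi> ^ e \<in> R"
  by (rule r(7)[OF \<pi>R])

lemma mo_pole:
  assumes "d * i + k \<le> e"
  shows "\<pi> ^ e * mo i k \<in> R"
proof -
  have "\<pi> ^ e = \<pi> ^ (e - (d * i + k)) * ((\<pi> ^ d) ^ i * \<pi> ^ k)"
    using assms by (simp flip: power_add power_mult)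
  then have "\<pi> ^ e * mo i k = \<pi> ^ (e - (d * i + k)) * ((\<pi> ^ d * U) ^ i * (\<pi> * b) ^ k)"
    unfolding mo_def power_mult_distrib by (simp only: mult_ac)
  also have "\<dots> \<in> R" by (intro r(5)[OF \<pi>_power] r(5) r(7)[OF UR] r(7)[OF bR])
  finally show ?thesis .
qed

lemma subspace_W: "KV.subspace W"
proof (rule KV.subspaceI)
  show "0 \<in> W" using r(1) by (simp add: W_def)
  show "x + y \<in> W" if "x \<in> W" "y \<in> W" for x y
    using that r(3) by (simp add: W_def distrib_left)
  show "K c * x \<in> W" if "x \<in> W" for c x
    using that r(5)[OF KR[of c]] by (simp add: W_def mult.left_commute)
qed

lemma R_W: "y \<in> R \<Longrightarrow> y \<in> W"
  unfolding W_def using r(5)[OF \<pi>_power] by blast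

lemma W_mult: "y \<in> W \<Longrightarrow> x \<in> R \<Longrightarrow> y * x \<in> W"
  unfolding W_def using r(5) by (fastforce simp flip: mult.assoc)

lemma subspace_V: "KV.subspace V"
  unfolding V_def by (rule KV.subspace_span)

lemma V_base: "k \<le> i \<Longrightarrow> mo i k \<in> V"
  unfolding V_def by (rule KV.span_base) blast

lemma subspace_VW: "KV.subspace VW"
  unfolding VW_def using KV.subspace_sums[OF subspace_V subspace_W] by simp

lemma VW_I: "v \<in> V \<Longrightarrow> v \<in> VW" "y \<in> W \<Longrightarrow> y \<in> VW"
proof -
  assume "v \<in> V"
  then show "v \<in> VW" unfolding VW_def using KV.subspace_0[OF subspace_W] by force
next
  assume "y \<in> W"
  then show "y \<in> VW" unfolding VW_def using KV.subspace_0[OF subspace_V] by force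
qed

lemma mo_expand: "U ^ i * pv b g = (\<Sum>k\<le>degree g. K (coeff g k) * mo i k)"
  unfolding pv_sum mo_def by (simp add: sum_distrib_left mult_ac)

text \<open>
  In weight \<open>N\<close> the monomials with large \<open>i\<close> lie in \<open>V\<close>; the others are reached by expanding
  \<open>(U - pv b \<phi>) ^ c\<close> times a monomial, which has a small pole because of the factor \<open>\<pi> ^ (d * d)\<close>.
\<close>

lemma mo_VW: "mo i k \<in> VW"
proof -
  have "\<forall>i k. d * i + k = N \<longrightarrow> mo i k \<in> VW" for N
  proof (induction N rule: less_induct)
    case (less N)
    show ?case
    proof (cases "N \<le> d * (d + 1)")
      case True
      then show ?thesis by (auto simp: W_def intro!: VW_I(2) mo_pole)
    next
      case False
      \<comment> \<open>In weight N, \<open>q\<close> is the largest possible i, and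
        \<open>a\<close>, which is N/(d+1) rounded up, is the smallest i whose monomial lies in
        \<open>V\<close>. By the choice of \<open>c\<close>, i + c \<le> q whenever i < a.\<close>
      define q where "q = N div d"
      define a where "a = (N + d) div (d + 1)"
      define c where "c = q + 1 - a"
      have q: "d * q \<le> N" "N + 1 \<le> d * (q + 1)"
        using \<phi>(3) dividend_less_times_div[of d N] by (simp_all add: q_def)
      have a: "N \<le> a * (d + 1)" "a * (d + 1) \<le> N + d"
        using dividend_less_times_div[of "d + 1" "N + d"] div_times_less_eq_dividend[of "N + d" "d + 1"]
        unfolding a_def by (simp_all add: algebra_simps)
      have aq: "a \<le> q + 1"
      proof (rule ccontr)
        assume "\<not> a \<le> q + 1"
        then have "(q + 2) * (d + 1) \<le> a * (d + 1)" by (intro mult_le_mono1) simp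
        with a(2) q(2) show False by (simp add: algebra_simps)
      qed
      \<comment> \<open>The expanded product involves a monomial of weight N - d c, and its
        \<open>c\<close> factors \<pi>^(d * d) reduce the pole to N - c d (d+1). This has to be at
        most d(d+1).\<close>
      have cD: "N \<le> d * (d + 1) + c * (d * (d + 1))"
      proof -
        have "c * (d * (d + 1)) + (a * (d + 1)) * d = d * (q + 1) * (d + 1)"
        proof -
          have "c + a = q + 1" using aq by (simp add: c_def)
          then have "(c + a) * (d * (d + 1)) = (q + 1) * (d * (d + 1))" by simp
          then show ?thesis by (simp add: algebra_simps)
        qed
        moreover have "(a * (d + 1)) * d \<le> (N + d) * d" "(N + 1) * (d + 1) \<le> d * (q + 1) * (d + 1)"
          using a(2) q(2) by (intro mult_le_mono1; simp)+
        ultimately have "(N + 1) * (d + 1) \<le> c * (d * (d + 1)) + (N + d) * d" by linarith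
        then show ?thesis by (simp add: algebra_simps)
      qed
      \<comment> \<open>Descending induction on i within the weight N: in the expansion, the terms
        with m \<ge> 1 have a larger i or a smaller weight.\<close>
      have "d * i \<le> N \<longrightarrow> mo i (N - d * i) \<in> VW" for i
      proof (induction "q - i" arbitrary: i rule: less_induct)
        case (less i)
        note inner = less
        show ?case
        proof (intro impI)
          assume iN: "d * i \<le> N"
          define k where "k = N - d * i"
          show "mo i (N - d * i) \<in> VW"
          proof (cases "a \<le> i")
            case True
            then have "a * (d + 1) \<le> i * (d + 1)" by (rule mult_le_mono1)
            then have "N - d * i \<le> i" using a(1) by (simp add: algebra_simps)
            then show ?thesis by (intro VW_I(1) V_base)
          next
            case False
            have ic: "i + c \<le> q" using False aq by (simp add: c_def)
            have "d * (i + c) \<le> d * q" using ic by (rule mult_le_mono2)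
            then have dc: "d * i + d * c \<le> N" using q(1) by (simp add: algebra_simps)
            define e where "e = k - d * c"
            have k: "k = e + d * c" "d * i + k = N" using dc iN by (simp_all add: e_def k_def)
            define g where "g m = \<phi> ^ (c - m) * monom 1 e" for m
            define t where "t m = K (of_nat (c choose m) * (- 1) ^ (c - m)) * (U ^ (i + m) * pv b (g m))" for m
            define y where "y = (U - pv b \<phi>) ^ c * (U ^ i * b ^ e)"
            interpret p: rhom "pv b" by (rule rhom_pv)
            have pm: "pv b (monom 1 e) = b ^ e" by (simp add: monom_altdef p.hom_power)
            have yt: "y = (\<Sum>m\<le>c. t m)"
            proof -
              have "(U - pv b \<phi>) ^ c = (\<Sum>m\<le>c. of_nat (c choose m) * U ^ m * (- pv b \<phi>) ^ (c - m))"
                using binomial_ring[of U "- pv b \<phi>" c] by simp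
              moreover have "of_nat (c choose m) * U ^ m * (- pv b \<phi>) ^ (c - m) * (U ^ i * b ^ e) = t m" for m
              proof -
                have "(- pv b \<phi>) ^ (c - m) = (- 1) ^ (c - m) * pv b \<phi> ^ (c - m)" by (rule power_minus)
                then show ?thesis
                  unfolding t_def g_def p.hom_mult p.hom_power pm K.hom_mult K.hom_of_nat K.hom_power K.hom_uminus
                    K.hom_one power_add by (simp only: mult_ac)
              qed
              ultimately show ?thesis unfolding y_def by (simp only: sum_distrib_right)
            qed
            have gm: "degree (g m) = k - d * m" "lead_coeff (g m) = 1" if "m \<le> c" for m
            proof -
              have "\<phi> \<noteq> 0" using \<phi>(1) by auto
              then have "degree (g m) = (c - m) * d + e"
                unfolding g_def by (subst degree_mult_eq) (simp_all add: degree_power_eq degree_monom_eq \<phi>)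
              moreover have "(c - m) * d + d * m = d * c" using that by (simp add: diff_mult_distrib algebra_simps)
              ultimately show "degree (g m) = k - d * m" unfolding k by simp
              show "lead_coeff (g m) = 1" unfolding g_def lead_coeff_mult lead_coeff_power \<phi>(1) by (simp add: degree_monom_eq)
            qed
            have low: "mo i' k' \<in> VW" if "d * i' + k' < N" for i' k'
              using \<open>\<And>y. y < N \<Longrightarrow> _ y\<close> that by blast
            have tm: "t m \<in> VW" if "m \<in> {1..c}" for m
            proof -
              have m: "m \<le> c" "m \<ge> 1" using that by auto
              have dm: "d * m \<le> d * c" using m(1) by (rule mult_le_mono2)
              have wt: "d * (i + m) + (k - d * m) = N" using dm k unfolding distrib_left by linarith
              have top: "mo (i + m) (k - d * m) \<in> VW"
              proof -
                have "q - (i + m) < q - i" using m ic by linarith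
                moreover have "d * (i + m) \<le> N" using wt by linarith
                moreover have "N - d * (i + m) = k - d * m" using wt by linarith
                ultimately show ?thesis using inner[of "i + m"] by simp
              qed
              have "mo (i + m) k' \<in> VW" if "k' \<le> k - d * m" for k'
              proof (cases "k' = k - d * m")
                case False
                then have "d * (i + m) + k' < N" using that wt by linarith
                then show ?thesis by (rule low)
              qed (use top in simp)
              then show ?thesis
                unfolding t_def mo_expand gm(1)[OF m(1)]
                by (intro KV.subspace_scale[OF subspace_VW] KV.subspace_sum[OF subspace_VW]) simp
            qed
            have "y \<in> W"
            proof -
              have le: "d * i + e \<le> d * (d + 1) + d * d * c"
                using cD k by (simp add: algebra_simps)
              have "\<pi> ^ (d * (d + 1)) * y = \<pi> ^ (d * (d + 1) + d * d * c) * mo i e * w ^ c"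
                unfolding y_def \<delta> mo_def power_mult_distrib power_add power_mult by (simp only: mult_ac)
              also have "\<dots> \<in> R" by (intro r(5)[OF mo_pole[OF le]] r(7)[OF wR])
              finally show ?thesis by (simp add: W_def)
            qed
            \<comment> \<open>What remains is the term m = 0. Up to sign it is \<open>mo i k\<close>
              plus monomials of smaller weight.\<close>
            then have "y - (\<Sum>m\<in>{1..c}. t m) \<in> VW"
              by (intro KV.subspace_diff[OF subspace_VW] VW_I(2) KV.subspace_sum[OF subspace_VW] tm)
            also have "y - (\<Sum>m\<in>{1..c}. t m) = t 0"
              unfolding yt by (simp add: atMost_atLeast0 sum.atLeast_Suc_atMost)
            finally have "K ((- 1) ^ c) * t 0 \<in> VW" by (rule KV.subspace_scale[OF subspace_VW])
            moreover have "K ((- 1) ^ c) * t 0 = U ^ i * pv b (g 0)"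
            proof -
              have "(- 1 :: 'a) ^ c * (- 1) ^ c = 1" by (simp flip: power_mult_distrib)
              then have "K ((- 1) ^ c) * K ((- 1) ^ c) = K (1 :: 'a)" unfolding K.hom_mult[symmetric] by simp
              then show ?thesis unfolding t_def by (simp flip: mult.assoc)
            qed
            moreover have "U ^ i * pv b (g 0) = (\<Sum>k'<k. K (coeff (g 0) k') * mo i k') + mo i k"
            proof -
              have "coeff (g 0) k = 1" using gm[of 0] by simp
              then show ?thesis
                unfolding mo_expand using gm(1)[of 0] by (simp flip: lessThan_Suc_atMost)
            qed
            ultimately have "(\<Sum>k'<k. K (coeff (g 0) k') * mo i k') + mo i k \<in> VW" by simp
            moreover have "(\<Sum>k'<k. K (coeff (g 0) k') * mo i k') \<in> VW"
              using k by (intro KV.subspace_sum[OF subspace_VW] KV.subspace_scale[OF subspace_VW] low) auto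
            ultimately have "((\<Sum>k'<k. K (coeff (g 0) k') * mo i k') + mo i k) - (\<Sum>k'<k. K (coeff (g 0) k') * mo i k') \<in> VW"
              by (rule KV.subspace_diff[OF subspace_VW])
            then show ?thesis by (simp add: k_def)
          qed
        qed
      qed
      then show ?thesis by (metis add_diff_cancel_left' le_add1)
    qed
  qed
  then show ?thesis by blast
qed

lemma C_VW: "x \<in> C \<Longrightarrow> x \<in> VW"
  using KV.span_minimal[OF _ subspace_VW, of "{mo i k | i k. True}"] mo_VW unfolding C_def by blast

lemma V_C: "x \<in> V \<Longrightarrow> x \<in> C"
  using KV.span_mono[of "{mo i k | i k. k \<le> i}" "{mo i k | i k. True}"] unfolding V_def C_def by blast

lemma C_power: "x \<in> C \<Longrightarrow> x * b ^ e \<in> C"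
proof -
  have S: "KV.subspace {x. x * b ^ e \<in> C}"
  proof (rule KV.subspaceI)
    show "0 \<in> {x. x * b ^ e \<in> C}" by (simp add: C_def KV.span_zero)
    show "x + y \<in> {x. x * b ^ e \<in> C}" if "x \<in> {x. x * b ^ e \<in> C}" "y \<in> {x. x * b ^ e \<in> C}" for x y
      using that by (simp add: C_def distrib_right KV.span_add)
    show "K c * x \<in> {x. x * b ^ e \<in> C}" if "x \<in> {x. x * b ^ e \<in> C}" for c x
      using that by (simp add: C_def mult.assoc KV.span_scale)
  qed
  have "mo i k * b ^ e = mo i (k + e)" for i k by (simp add: mo_def power_add mult_ac)
  then have "{mo i k | i k. True} \<subseteq> {x. x * b ^ e \<in> C}"
    by (auto simp: C_def intro!: KV.span_base)
  from KV.span_minimal[OF this S] show "x \<in> C \<Longrightarrow> x * b ^ e \<in> C" unfolding C_def by blast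
qed

text \<open>Here Z + b is \<zeta>: these are the elements which, up to an admissible pole, are
  images of polynomials in z over A of degree at most r.\<close>

definition "T r = {x. \<exists>g\<in>coeffs_in V. degree g \<le> r \<and> x - poly g (Z + b) \<in> W}"

lemma subspace_T: "KV.subspace (T r)"
proof (rule KV.subspaceI)
  show "0 \<in> T r" unfolding T_def using KV.subspace_0[OF subspace_W] KV.subspace_0[OF subspace_V]
    by (auto simp: coeffs_in_def intro!: exI[of _ 0])
  fix x assume "x \<in> T r"
  then obtain g where g: "g \<in> coeffs_in V" "degree g \<le> r" "x - poly g (Z + b) \<in> W" by (auto simp: T_def)
  show "K c * x \<in> T r" for c
  proof -
    have "smult (K c) g \<in> coeffs_in V" using g KV.subspace_scale[OF subspace_V] by (auto simp: coeffs_in_def)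
    moreover have "K c * x - poly (smult (K c) g) (Z + b) \<in> W"
      using KV.subspace_scale[OF subspace_W g(3), of c] by (simp add: right_diff_distrib)
    moreover have "degree (smult (K c) g) \<le> r" using g(2) degree_smult_le[of "K c" g] by linarith
    ultimately show ?thesis unfolding T_def by blast
  qed
  fix y assume "y \<in> T r"
  then obtain h where h: "h \<in> coeffs_in V" "degree h \<le> r" "y - poly h (Z + b) \<in> W" by (auto simp: T_def)
  have "g + h \<in> coeffs_in V" using g h KV.subspace_add[OF subspace_V] by (auto simp: coeffs_in_def)
  moreover have "x + y - poly (g + h) (Z + b) \<in> W"
    using KV.subspace_add[OF subspace_W g(3) h(3)] by (simp add: algebra_simps)
  moreover have "degree (g + h) \<le> r" using g(2) h(2) by (rule degree_add_le)
  ultimately show "x + y \<in> T r" unfolding T_def by blast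
qed

lemma T_mono: "x \<in> T r \<Longrightarrow> r \<le> r' \<Longrightarrow> x \<in> T r'"
  unfolding T_def using order_trans by blast

lemma W_T: "x \<in> W \<Longrightarrow> x \<in> T r"
  unfolding T_def using KV.subspace_0[OF subspace_V] by (auto simp: coeffs_in_def intro!: exI[of _ 0])

text \<open>Modulo \<open>W\<close>, x may be replaced by some v in \<open>V\<close>, and Z^r by (Z
  + b)^r minus lower powers of Z. The new coefficients v b^(r-i) may leave \<open>V\<close> but not
  \<open>C\<close>, so the induction covers them.\<close>

lemma C_Z: "x \<in> C \<Longrightarrow> x * Z ^ r \<in> T r"
proof (induction r arbitrary: x rule: less_induct)
  case (less r)
  obtain v y where vy: "x = v + y" "v \<in> V" "y \<in> W" using C_VW[OF less.prems] by (auto simp: VW_def)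
  have "monom v r \<in> coeffs_in V" using vy(2) KV.subspace_0[OF subspace_V] by (auto simp: coeffs_in_def)
  moreover have "degree (monom v r) \<le> r" by (rule degree_monom_le)
  moreover have "v * (Z + b) ^ r - poly (monom v r) (Z + b) \<in> W"
    using KV.subspace_0[OF subspace_W] by (simp add: poly_monom)
  ultimately have v: "v * (Z + b) ^ r \<in> T r" unfolding T_def by blast
  have s: "(\<Sum>i<r. K (of_nat (r choose i)) * (v * b ^ (r - i) * Z ^ i)) \<in> T r"
    by (intro KV.subspace_sum[OF subspace_T] KV.subspace_scale[OF subspace_T])
      (auto intro!: T_mono[OF less.IH] C_power[OF V_C[OF vy(2)]])
  have "v * (Z + b) ^ r = (\<Sum>i<r. K (of_nat (r choose i)) * (v * b ^ (r - i) * Z ^ i)) + v * Z ^ r"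
    unfolding binomial_ring by (simp add: sum_distrib_left K.hom_of_nat algebra_simps flip: lessThan_Suc_atMost)
  then have "x * Z ^ r = (v * (Z + b) ^ r - (\<Sum>i<r. K (of_nat (r choose i)) * (v * b ^ (r - i) * Z ^ i))) + y * Z ^ r"
    unfolding vy(1) by (simp add: algebra_simps)
  also have "\<dots> \<in> T r"
    by (intro KV.subspace_add[OF subspace_T] KV.subspace_diff[OF subspace_T] v s W_T W_mult[OF vy(3)] r(7)[OF ZR])
  finally show ?case .
qed

text \<open>In (Z + b)^l the term Z^l has no pole, and the others fall under \<open>C_Z\<close> with
  exponents below l; so a correction of degree less than l suffices.\<close>

lemma monic_small_pole:
  assumes "l \<ge> 1"
  shows "\<exists>g\<in>coeffs_in V. degree g < l \<and> \<pi> ^ (d * (d + 1)) * ((Z + b) ^ l - poly g (Z + b)) \<in> R"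
proof -
  have "b ^ e \<in> C" for e
  proof -
    have "b ^ e = mo 0 e" by (simp add: mo_def)
    then show ?thesis unfolding C_def by (intro KV.span_base) blast
  qed
  then have s: "(\<Sum>i<l. K (of_nat (l choose i)) * (b ^ (l - i) * Z ^ i)) \<in> T (l - 1)"
    by (intro KV.subspace_sum[OF subspace_T] KV.subspace_scale[OF subspace_T]) (auto intro!: T_mono[OF C_Z])
  have "(Z + b) ^ l = (\<Sum>i<l. K (of_nat (l choose i)) * (b ^ (l - i) * Z ^ i)) + Z ^ l"
    unfolding binomial_ring by (simp add: K.hom_of_nat mult_ac flip: lessThan_Suc_atMost)
  also have "\<dots> \<in> T (l - 1)"
    by (intro KV.subspace_add[OF subspace_T] s W_T R_W r(7)[OF ZR])
  finally obtain g where "g \<in> coeffs_in V" "degree g \<le> l - 1" "(Z + b) ^ l - poly g (Z + b) \<in> W"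
    by (auto simp: T_def)
  then show ?thesis using assms by (intro bexI[of _ g]) (auto simp: W_def)
qed

end

section \<open>Order of vanishing, infinite generation and the fraction field\<close>

lemma hom_poly:
  assumes "rhom h"
  shows "h (poly f x) = poly (map_poly h f) (h x)"
proof -
  interpret rhom h by fact
  show ?thesis by (induction f) (simp_all add: map_poly_pCons)
qed

section \<open>Order of vanishing along the curve\<close>

text \<open>
  \<open>blow\<close> deforms the identity along \<open>x\<^sub>i \<mapsto> \<phi>\<^sub>i + \<lambda> (x\<^sub>i - \<phi>\<^sub>i)\<close>: its value at \<open>\<lambda> = 1\<close> is the
  identity and its value at \<open>\<lambda> = 0\<close> is the restriction to the curve.
\<close>

definition blow :: "nat \<Rightarrow> (nat \<Rightarrow> 'a::field poly) \<Rightarrow> nat \<Rightarrow> (nat, 'a) mpoly \<Rightarrow> 'a ratfun poly" where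
  "blow j \<Phi> n = ev (\<lambda>c. [:K c:])
    (\<lambda>i. if i < n then [:pv (ratvar j) (\<Phi> i), ratvar i - pv (ratvar j) (\<Phi> i):] else [:ratvar i:])"

lemma rhom_const_K: "rhom (\<lambda>c. [:K c:])"
  by (rule rhom_compose[OF rhom_const_poly rhom_K])

lemma rhom_blow: "rhom (blow j \<Phi> n)"
  unfolding blow_def by (rule rhom.rhom_ev[OF rhom_const_K])

lemma blow_cst [simp]: "blow j \<Phi> n (cst c) = [:K c:]"
  unfolding blow_def by (rule rhom.ev_cst[OF rhom_const_K])

lemma coeff_blow_0: "coeff (blow j \<Phi> n p) 0 = rs j \<Phi> n p"
proof -
  have "poly (blow j \<Phi> n p) 0 = rs j \<Phi> n p"
    unfolding blow_def rs_def hom_ev[OF rhom_poly rhom_const_K]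
    by (simp, rule ev_agree[OF rhom_K, of _ UNIV]) auto
  then show ?thesis by (simp add: poly_0_coeff_0)
qed

lemma blow_eq_0D:
  assumes "blow j \<Phi> n p = 0"
  shows "p = 0"
proof -
  have "poly (blow j \<Phi> n p) 1 = of_mpoly p"
    unfolding blow_def of_mpoly_ev hom_ev[OF rhom_poly rhom_const_K]
    by (simp, rule ev_agree[OF rhom_K, of _ UNIV]) auto
  with assms show ?thesis by simp
qed

definition polys_over :: "'a::field ratfun set \<Rightarrow> nat \<Rightarrow> (nat, 'a) mpoly set" where
  "polys_over A n = {p. \<exists>f\<in>coeffs_in A. of_mpoly p = poly f (ratvar n)}"

lemma polys_over_closed:
  assumes A: "is_subring A" "\<And>c. K c \<in> A"
  shows "cst c \<in> polys_over A n" "p \<in> polys_over A n \<Longrightarrow> q \<in> polys_over A n \<Longrightarrow> p + q \<in> polys_over A n"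
    "p \<in> polys_over A n \<Longrightarrow> q \<in> polys_over A n \<Longrightarrow> p * q \<in> polys_over A n"
    "p \<in> polys_over A n \<Longrightarrow> q \<in> polys_over A n \<Longrightarrow> p - q \<in> polys_over A n"
    "p \<in> polys_over A n \<Longrightarrow> p ^ e \<in> polys_over A n"
proof -
  note c = is_subring_coeffs_in[OF A(1)]
  show cst: "cst c \<in> polys_over A n" for c
    unfolding polys_over_def using c(7)[OF A(2), of c 0]
    by (auto simp: K_def poly_monom intro!: bexI[of _ "monom (K c) 0"])
  show mult: "p * q \<in> polys_over A n" if "p \<in> polys_over A n" "q \<in> polys_over A n" for p q
  proof -
    from that obtain f g where "f \<in> coeffs_in A" "of_mpoly p = poly f (ratvar n)"
      "g \<in> coeffs_in A" "of_mpoly q = poly g (ratvar n)" by (auto simp: polys_over_def)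
    then show ?thesis unfolding polys_over_def by (intro CollectI bexI[of _ "f * g"]) (simp_all add: c)
  qed
  show "p ^ e \<in> polys_over A n" if "p \<in> polys_over A n"
    using that cst[of 1] by (induction e) (auto intro: mult simp: rhom.hom_one[OF rhom_cst])
  assume "p \<in> polys_over A n" "q \<in> polys_over A n"
  then obtain f g where fg: "f \<in> coeffs_in A" "of_mpoly p = poly f (ratvar n)"
    "g \<in> coeffs_in A" "of_mpoly q = poly g (ratvar n)" by (auto simp: polys_over_def)
  then show "p + q \<in> polys_over A n"
    unfolding polys_over_def by (intro CollectI bexI[of _ "f + g"]) (simp_all add: c)
  from fg show "p - q \<in> polys_over A n"
    unfolding polys_over_def by (intro CollectI bexI[of _ "f - g"]) (simp_all add: c)
qed

lemma polys_over_vars: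
  assumes "A \<subseteq> poly_ring n" "p \<in> polys_over A n"
  shows "poly_vars p \<subseteq> {..<Suc n}"
proof -
  obtain f where f: "f \<in> coeffs_in A" "of_mpoly p = poly f (ratvar n)" using assms(2) by (auto simp: polys_over_def)
  then have "f \<in> coeffs_in (poly_ring n)" using coeffs_in_mono[OF assms(1)] by auto
  then obtain p' where "\<And>i. coeff f i = of_mpoly (p' i)"
    "poly f (ratvar n) = of_mpoly (\<Sum>i\<le>degree f. p' i * var n ^ i)"
    "poly_vars (\<Sum>i\<le>degree f. p' i * var n ^ i) \<subseteq> {..<Suc n}" by (rule coeffs_in_poly_ringE) blast
  then show ?thesis using f(2) by (metis of_mpoly_eq_iff)
qed

text \<open>\<nu> is the smallest order of vanishing that occurs among the elements of A[z] that are
  0 on the curve; the order of p is that of \<open>blow j \<Phi> n p\<close> at 0.\<close>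

lemma minimal_order_exists:
  assumes "q \<in> polys_over A n" "q \<noteq> 0" "rs j \<Phi> n q = 0"
  obtains p \<nu> where "p \<in> polys_over A n" "rs j \<Phi> n p = 0" "coeff (blow j \<Phi> n p) \<nu> \<noteq> 0"
    "\<And>p k. p \<in> polys_over A n \<Longrightarrow> rs j \<Phi> n p = 0 \<Longrightarrow> k < \<nu> \<Longrightarrow> coeff (blow j \<Phi> n p) k = 0"
proof -
  define B where "B \<nu> \<longleftrightarrow> (\<exists>p\<in>polys_over A n. rs j \<Phi> n p = 0 \<and> coeff (blow j \<Phi> n p) \<nu> \<noteq> 0)" for \<nu>
  have "blow j \<Phi> n q \<noteq> 0" using assms(2) blow_eq_0D by blast
  then obtain k where "coeff (blow j \<Phi> n q) k \<noteq> 0" by (auto simp: poly_eq_iff)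
  then have "B k" using assms by (auto simp: B_def)
  then have "B (LEAST \<nu>. B \<nu>)" by (rule LeastI)
  then obtain p where "p \<in> polys_over A n" "rs j \<Phi> n p = 0" "coeff (blow j \<Phi> n p) (LEAST \<nu>. B \<nu>) \<noteq> 0"
    by (auto simp: B_def)
  then show thesis by (rule that) (use not_less_Least in \<open>unfold B_def, blast\<close>)
qed

lemma monic_restriction:
  fixes h :: "'a::field_char_0 ratfun poly"
  assumes h: "h \<in> coeffs_in (poly_ring n)" "lead_coeff h = 1" and p: "of_mpoly p = poly h (ratvar n)" and j: "j < n"
  obtains g where "g \<in> coeffs_in (rat_field n)" "degree g \<le> degree h" "coeff g (degree h) = 1"
    "rs j \<Phi> n p = poly g (ratvar n)"
proof -
  obtain q where q: "\<And>i. coeff h i = of_mpoly (q i)" "\<And>i. poly_vars (q i) \<subseteq> {..<n}"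
    "poly h (ratvar n) = of_mpoly (\<Sum>i\<le>degree h. q i * var n ^ i)"
    "\<And>j \<Phi>. rs j \<Phi> n (\<Sum>i\<le>degree h. q i * var n ^ i) = (\<Sum>i\<le>degree h. pv (ratvar j) (uev \<Phi> (q i)) * ratvar n ^ i)"
    by (rule coeffs_in_poly_ringE[OF h(1)]) blast
  have pq: "p = (\<Sum>i\<le>degree h. q i * var n ^ i)" using q(3) p by (simp only: of_mpoly_eq_iff)
  define g where "g = (\<Sum>i\<le>degree h. monom (pv (ratvar j) (uev \<Phi> (q i))) i)"
  have cg: "coeff g i = (if i \<le> degree h then pv (ratvar j) (uev \<Phi> (q i)) else 0)" for i
    unfolding g_def by (simp add: coeff_sum)
  show thesis
  proof (rule that)
    have "pv (ratvar j) \<phi> \<in> poly_ring n" for \<phi> :: "'a poly"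
      using j by (intro pv_in_subring is_subring_poly_ring) auto
    then show "g \<in> coeffs_in (rat_field n)"
      using poly_ring_subset_rat_field[of n] poly_ring_closed(1)[of n] by (auto simp: coeffs_in_def cg)
    show "degree g \<le> degree h" by (rule degree_le) (simp add: cg)
    have "of_mpoly (q (degree h)) = of_mpoly (1 :: (nat, 'a) mpoly)" using h(2) q(1) by simp
    then have "q (degree h) = 1" by (simp only: of_mpoly_eq_iff)
    then show "coeff g (degree h) = 1"
      by (simp add: cg rhom.hom_one[OF rhom.rhom_ev[OF rhom_const_poly]] rhom.hom_one[OF rhom_pv])
    show "rs j \<Phi> n p = poly g (ratvar n)"
      unfolding pq q(4) g_def by (simp add: poly_sum poly_monom)
  qed
qed

text \<open>Monic polynomials in z of degrees 1, 2, ... are linearly independent over k, also after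
  multiplication by \<open>e\<close>; card S + 1 of them do not fit into a span of card S
  elements.\<close>

lemma monic_not_in_finite_span:
  fixes h :: "nat \<Rightarrow> 'a::field_char_0 ratfun poly"
  assumes fin: "finite S" and e: "e \<noteq> 0"
    and h: "\<And>l. l \<ge> 1 \<Longrightarrow> h l \<in> coeffs_in (rat_field n)" "\<And>l. l \<ge> 1 \<Longrightarrow> degree (h l) \<le> l"
      "\<And>l. l \<ge> 1 \<Longrightarrow> coeff (h l) l = 1"
    and S: "\<And>l. l \<ge> 1 \<Longrightarrow> e * poly (h l) (ratvar n) \<in> KV.span S"
  shows False
proof -
  have "\<forall>l. \<exists>c. l \<ge> 1 \<longrightarrow> e * poly (h l) (ratvar n) = (\<Sum>y\<in>S. K (c y) * y)"
    using S by (auto simp: KV.span_finite[OF fin])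
  from choice[OF this] obtain c where c: "\<And>l. l \<ge> 1 \<Longrightarrow> e * poly (h l) (ratvar n) = (\<Sum>y\<in>S. K (c l y) * y)"
    by blast
  define L where "L = {1..Suc (card S)}"
  obtain a where a: "\<exists>l\<in>L. a l \<noteq> 0" "\<And>y. y \<in> S \<Longrightarrow> (\<Sum>l\<in>L. a l * c l y) = 0"
    using kernel_exists[OF fin, of L c] by (auto simp: L_def)
  define f where "f = (\<Sum>l\<in>L. smult (K (a l)) (h l))"
  have "f = 0"
  proof (rule ratvar_transcendental)
    note R = is_subfieldD(1)[OF is_subfield_rat_field[of n]]
    have "K (a l) * coeff (h l) i \<in> rat_field n" if "l \<in> L" for l i
      using coeffs_inD[OF h(1), of l i] that poly_ring_subset_rat_field[of n]
      by (intro is_subringD(5)[OF R]) (auto simp: L_def)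
    then show "f \<in> coeffs_in (rat_field n)"
      unfolding coeffs_in_def mem_Collect_eq f_def coeff_sum coeff_smult by (intro allI is_subringD(8)[OF R])
    have "e * poly f (ratvar n) = (\<Sum>l\<in>L. K (a l) * (e * poly (h l) (ratvar n)))"
      unfolding f_def poly_sum by (simp add: sum_distrib_left mult_ac)
    also have "\<dots> = (\<Sum>l\<in>L. K (a l) * (\<Sum>y\<in>S. K (c l y) * y))"
      by (rule sum.cong) (auto simp: c L_def)
    also have "\<dots> = (\<Sum>y\<in>S. K (\<Sum>l\<in>L. a l * c l y) * y)"
      unfolding K.hom_sum sum_distrib_left sum_distrib_right K.hom_mult mult.assoc by (rule sum.swap)
    also have "\<dots> = 0" by (simp add: a(2))
    finally show "poly f (ratvar n) = 0" using e by simp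
  qed
  define m where "m = Max {l\<in>L. a l \<noteq> 0}"
  have fm: "finite {l\<in>L. a l \<noteq> 0}" "{l\<in>L. a l \<noteq> 0} \<noteq> {}" using a(1) by (auto simp: L_def)
  have m: "m \<in> L" "a m \<noteq> 0" using Max_in[OF fm] by (auto simp: m_def)
  have "a l = 0" if "l \<in> L" "m < l" for l
    using Max_ge[OF fm(1), of l] that by (auto simp: m_def)
  moreover have "coeff (h l) m = 0" if "l \<in> L" "l < m" for l
    using h(2)[of l] that by (intro coeff_eq_0) (auto simp: L_def)
  ultimately have z: "K (a l) * coeff (h l) m = 0" if "l \<in> L - {m}" for l
    using that by (cases "l < m") auto
  have "(\<Sum>l\<in>L - {m}. K (a l) * coeff (h l) m) = 0" by (rule sum.neutral) (use z in blast)
  moreover have "finite L" by (simp add: L_def)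
  ultimately have "coeff f m = K (a m) * coeff (h m) m"
    unfolding f_def coeff_sum coeff_smult using m(1) by (simp add: sum.remove)
  also have "\<dots> = K (a m)" using h(3)[of m] m(1) by (simp add: L_def)
  finally show False using \<open>f = 0\<close> m(2) by simp
qed

text \<open>The factor x_j^c in \<open>approximation\<close> is cancelled at the price of N \<ge> c
  + e.\<close>

lemma curve_approximation:
  fixes \<Phi> :: "nat \<Rightarrow> 'a::field_char_0 poly"
  assumes "j < n" "\<Phi> j = [:0, 1:]" "poly_vars p \<subseteq> {..<Suc n}"
  shows "\<exists>c. \<forall>N e. c + e \<le> N \<longrightarrow>
    (\<exists>r\<in>poly_ring (Suc n). curve.P n j N \<Phi> p - ev K (curve.th0 n j \<Phi>) p = ratvar j ^ e * r)"
proof -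
  obtain c where c: "\<And>N. \<exists>r\<in>poly_ring (Suc n).
      ratvar j ^ c * (curve.P n j N \<Phi> p - ev K (curve.th0 n j \<Phi>) p) = ratvar j ^ N * r"
    using approximation[of j n \<Phi> p, OF assms] by blast
  show ?thesis
  proof (intro exI[of _ c] allI impI)
    fix N e assume "c + e \<le> N"
    then obtain k where k: "N = c + e + k" by (auto simp: le_iff_add)
    interpret curve n j N \<Phi> using assms by unfold_locales
    obtain r where r: "r \<in> poly_ring (Suc n)" "X j ^ c * (P p - ev K th0 p) = X j ^ N * r" using c[of N] by auto
    have "X j ^ c * (P p - ev K th0 p) = X j ^ c * (X j ^ e * (X j ^ k * r))"
    proof -
      have "X j ^ N = X j ^ c * (X j ^ e * X j ^ k)" by (simp add: k power_add)
      then show ?thesis unfolding r(2) by (simp only: mult.assoc)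
    qed
    from mult_left_cancel[THEN iffD1, OF _ this] have "P p - ev K th0 p = X j ^ e * (X j ^ k * r)"
      by (simp only: power_not_zero Xj0 not_False_eq_True)
    moreover have "X j ^ k * r \<in> poly_ring (Suc n)"
      using jn by (intro poly_ring_closed(5)[OF poly_ring_closed(7) r(1)]) simp
    ultimately show "\<exists>r\<in>poly_ring (Suc n). P p - ev K th0 p = X j ^ e * r" by blast
  qed
qed

context curve
begin

lemma P_pole:
  assumes "poly_vars p \<subseteq> {..<Suc n}"
  shows "\<exists>k. X j ^ k * P p \<in> poly_ring (Suc n)"
proof -
  obtain c r where c: "X j ^ c * ev K th0 p \<in> poly_ring (Suc n)" "r \<in> poly_ring (Suc n)"
    "X j ^ c * (P p - ev K th0 p) = X j ^ N * r"
    using approximation[of j n \<Phi> p, OF jn \<Phi>j assms] by metis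
  have "X j ^ c * P p = X j ^ c * ev K th0 p + X j ^ N * r" unfolding c(3)[symmetric] by (simp add: algebra_simps)
  also have "\<dots> \<in> poly_ring (Suc n)"
    using jn by (intro poly_ring_closed(3)[OF c(1)] poly_ring_closed(5)[OF poly_ring_closed(7) c(2)]) simp
  finally show ?thesis by blast
qed

lemma P_eq_iff: "P p = P q \<longleftrightarrow> p = q"
  using P_inj[of "p - q"] by (auto simp: rhom.hom_diff[OF rhom_P])

text \<open>The image of \<open>p0\<close> absorbs the pole of order d(d+1) that
  \<open>monic_small_pole\<close> leaves along x_j = 0, and images of polynomials have no other
  poles.\<close>

lemma monic_multiple:
  assumes A: "is_subring A" "\<And>c. K c \<in> A" "A \<subseteq> poly_ring n"
    and uv: "of_mpoly u \<in> A" "of_mpoly v \<in> A"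
    and \<phi>: "lead_coeff \<phi> = 1" "degree \<phi> = d" "d \<ge> 1"
    and r: "r1 \<in> poly_ring (Suc n)" "P u - pv \<tau> \<phi> = X j ^ (d * d + 1) * r1"
      "r2 \<in> poly_ring (Suc n)" "P v - \<tau> * pv \<tau> \<phi> = X j ^ (d * d + 1) * r2"
    and p0: "p0 \<in> polys_over A n" "r0 \<in> poly_ring (Suc n)" "P p0 = X j ^ (d * (d + 1)) * r0" and l: "l \<ge> 1"
  shows "\<exists>g. \<exists>h\<in>coeffs_in A. lead_coeff h = 1 \<and> degree h = l \<and> of_mpoly g = poly h (X n) \<and>
    P (p0 * g) \<in> poly_ring (Suc n)"
proof -
  let ?O = "loc_ring (hyp j :: (nat, 'a) mpoly \<Rightarrow> _)"
  have pO: "of_mpoly p \<in> ?O" for p by (rule of_mpoly_in_loc_ring[OF rhom_hyp])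
  then have prO: "poly_ring (Suc n) \<subseteq> ?O" by (auto simp: poly_ring_def)
  note lc = local_coordinates[OF \<phi> subsetD[OF prO r(1)] subsetD[OF prO r(3)] r(2,4)]
  obtain w where w: "w \<in> ?O" "P u - pv (P v / P u) \<phi> = X j ^ (d * d) * w" using lc(5) by auto
  interpret B: pole_bound ?O "X j" "P u" "P v / P u" "\<zeta> - P v / P u" w \<phi> d
    by unfold_locales
      (use w lc \<phi> pO is_subring_loc_ring[OF rhom_hyp] in \<open>auto simp: K_def ratvar_eq\<close>)
  interpret \<sigma>: rhom \<sigma> by (rule rhom_\<sigma>)
  interpret \<sigma>': rhom \<sigma>' by (rule rhom_\<sigma>')
  obtain g where g: "g \<in> coeffs_in B.V" "degree g < l" "X j ^ (d * (d + 1)) * (\<zeta> ^ l - poly g \<zeta>) \<in> ?O"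
    using B.monic_small_pole[OF l] by auto
  \<comment> \<open>u^(i-k) v^k is mapped to U^i (V/U)^k, which makes sense only for k \<le>
    i.\<close>
  have V: "B.V \<subseteq> \<sigma> ` A"
    unfolding B.V_def
  proof (rule KV.span_minimal)
    show "KV.subspace (\<sigma> ` A)"
    proof (rule KV.subspaceI)
      show "0 \<in> \<sigma> ` A" using is_subringD(1)[OF A(1)] by (force intro: rev_image_eqI)
      show "x + y \<in> \<sigma> ` A" if "x \<in> \<sigma> ` A" "y \<in> \<sigma> ` A" for x y
        using that is_subringD(3)[OF A(1)] by (auto simp flip: \<sigma>.hom_add)
      show "K c * x \<in> \<sigma> ` A" if "x \<in> \<sigma> ` A" for c x
      proof -
        from that obtain a where "a \<in> A" "x = \<sigma> a" by auto
        then show ?thesis using is_subringD(5)[OF A(1) A(2)[of c]] by (auto intro!: image_eqI[of _ _ "K c * a"])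
      qed
    qed
    have "P u ^ i * (P v / P u) ^ k \<in> \<sigma> ` A" if "k \<le> i" for i k
    proof -
      have "P u ^ i = P u ^ (i - k) * P u ^ k" using that by (simp flip: power_add)
      then have "P u ^ i * (P v / P u) ^ k = P u ^ (i - k) * P v ^ k" using lc(1) by (simp add: power_divide)
      also have "\<dots> = \<sigma> (of_mpoly u ^ (i - k) * of_mpoly v ^ k)" by (simp add: \<sigma>_of_mpoly)
      finally show ?thesis using is_subringD(5)[OF A(1) is_subringD(7)[OF A(1) uv(1)] is_subringD(7)[OF A(1) uv(2)]] by blast
    qed
    then show "{B.mo i k | i k. k \<le> i} \<subseteq> \<sigma> ` A" by (auto simp: B.mo_def)
  qed
  define g' where "g' = map_poly \<sigma>' g"
  have g': "g' \<in> coeffs_in A"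
    unfolding coeffs_in_def mem_Collect_eq
  proof
    fix i
    obtain a where "a \<in> A" "coeff g i = \<sigma> a" using coeffs_inD[OF g(1), of i] V by auto
    then show "coeff g' i \<in> A" by (simp add: g'_def coeff_map_poly)
  qed
  have dg': "degree g' < l"
    by (rule le_less_trans[OF degree_le g(2)]) (simp add: g'_def coeff_map_poly coeff_eq_0)
  have mg: "map_poly \<sigma> g' = g" unfolding g'_def by (rule poly_eqI) (simp add: coeff_map_poly)
  define h where "h = monom 1 l - g'"
  have hA: "h \<in> coeffs_in A"
    unfolding h_def using g' is_subringD(2)[OF A(1)] by (intro is_subring_coeffs_in[OF A(1)])
  have ch: "coeff h l = 1" using dg' by (simp add: h_def coeff_eq_0)
  have dh: "degree h = l"
  proof (rule antisym)
    show "degree h \<le> l" unfolding h_def using dg' by (intro degree_diff_le degree_monom_le) simp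
    show "l \<le> degree h" using ch by (intro le_degree) simp
  qed
  have "poly h (X n) \<in> poly_ring (Suc n)"
    using hA coeffs_in_mono[OF A(3)] coeffs_in_mono[OF poly_ring_mono[of n "Suc n"]]
    by (intro poly_in_subring[OF is_subring_poly_ring] ratvar_in_poly_ring) auto
  then obtain G where G: "poly h (X n) = of_mpoly G" by (auto simp: poly_ring_def)
  have PG: "P G = \<zeta> ^ l - poly g \<zeta>"
  proof -
    have "\<sigma> (X n) = \<zeta>" using jn by (simp add: \<sigma>_X th_def)
    then have "\<sigma> (poly h (X n)) = \<zeta> ^ l - poly g \<zeta>"
      unfolding h_def by (simp add: poly_monom hom_poly[OF rhom_\<sigma>] mg)
    then show ?thesis by (simp add: G \<sigma>_of_mpoly)
  qed
  have GA: "G \<in> polys_over A n" using hA G unfolding polys_over_def by force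
  have "P (p0 * G) = r0 * (X j ^ (d * (d + 1)) * (\<zeta> ^ l - poly g \<zeta>))"
    by (simp add: rhom.hom_mult[OF rhom_P] p0(3) PG)
  also have "\<dots> \<in> ?O" by (rule is_subringD(5)[OF B.R subsetD[OF prO p0(2)] g(3)])
  finally have "P (p0 * G) \<in> ?O" .
  moreover have "\<exists>k. X j ^ k * P (p0 * G) \<in> poly_ring (Suc n)"
    using P_pole[of "p0 * G"] polys_over_vars[OF A(3) polys_over_closed(3)[OF A(1,2) p0(1) GA]] by blast
  ultimately have "P (p0 * G) \<in> poly_ring (Suc n)"
    using loc_ring_poly jn by (metis less_Suc_eq)
  then show ?thesis using hA ch dh G by (intro exI[of _ G] bexI[of _ h]) auto
qed

end

section \<open>The theorem\<close>

text \<open>The product has order at least 2 \<nu>, which exceeds \<nu>.\<close>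

lemma coeff_mult_vanishing:
  assumes "\<And>k. k < \<nu> \<Longrightarrow> coeff f k = 0" "\<And>k. k < \<nu> \<Longrightarrow> coeff g k = 0" "\<nu> \<ge> 1"
  shows "coeff (f * g) \<nu> = 0"
  unfolding coeff_mult
proof (rule sum.neutral, rule ballI)
  fix i assume "i \<in> {..\<nu>}"
  then show "coeff f i * coeff g (\<nu> - i) = 0"
    using assms by (cases "i = \<nu>") auto
qed

lemma coeff_mult_first:
  assumes "\<And>k. k < \<nu> \<Longrightarrow> coeff f k = 0"
  shows "coeff (f * g) \<nu> = coeff f \<nu> * coeff g 0"
proof -
  have "(\<Sum>i\<in>{..\<nu>} - {\<nu>}. coeff f i * coeff g (\<nu> - i)) = 0" by (rule sum.neutral) (use assms in auto)
  then show ?thesis unfolding coeff_mult by (simp add: sum.remove[of "{..\<nu>}" \<nu>])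
qed

context curve
begin

text \<open>On elements that are constant on the curve, the coefficient of order \<nu> behaves like
  a derivation: if p and q have the constants c and e, that of p q is c times that of q plus e times
  that of p. Hence the elements whose coefficient lies in the span of the coefficients of the
  generators form a ring, which would contain all of R.\<close>

lemma not_fin_gen:
  assumes A: "is_subring A" "\<And>c. K c \<in> A" "A \<subseteq> poly_ring n"
    and p0: "p0 \<in> polys_over A n" "rs j \<Phi> n p0 = 0" "coeff (blow j \<Phi> n p0) \<nu> \<noteq> 0"
    and min: "\<And>p k. p \<in> polys_over A n \<Longrightarrow> rs j \<Phi> n p = 0 \<Longrightarrow> k < \<nu> \<Longrightarrow> coeff (blow j \<Phi> n p) k = 0"
    and E: "\<And>l. l \<ge> 1 \<Longrightarrow> \<exists>g. \<exists>h\<in>coeffs_in A. lead_coeff h = 1 \<and> degree h = l \<and>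
      of_mpoly g = poly h (X n) \<and> P (p0 * g) \<in> poly_ring (Suc n)"
    and B: "\<And>y. y \<in> B \<Longrightarrow> \<exists>p\<in>polys_over A n. y = P p \<and> rs j \<Phi> n p \<in> range K"
      "\<And>p. p \<in> polys_over A n \<Longrightarrow> P p \<in> poly_ring (Suc n) \<Longrightarrow> P p \<in> B"
  shows "\<not> fin_gen_algebra const_field B"
proof
  assume "fin_gen_algebra const_field B"
  then obtain S where S: "finite S" "B = is_subring hull (const_field \<union> S)" by (auto simp: fin_gen_algebra_def)
  let ?T = "blow j \<Phi> n" and ?r = "rs j \<Phi> n"
  interpret T: rhom ?T by (rule rhom_blow)
  interpret r: rhom ?r by (rule rhom_rs)
  interpret P: rhom P by (rule rhom_P)
  note cl = polys_over_closed[OF A(1,2)]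
  have \<nu>: "\<nu> \<ge> 1" using p0(2,3) coeff_blow_0[of j \<Phi> n p0] by (cases \<nu>) auto
  have SB: "s \<in> B" if "s \<in> S" for s unfolding S(2) using that by (simp add: hull_inc)
  have "\<forall>s\<in>S. \<exists>p. p \<in> polys_over A n \<and> s = P p \<and> ?r p \<in> range K" using B(1)[OF SB] by blast
  then obtain \<psi> where \<psi>: "\<And>s. s \<in> S \<Longrightarrow> \<psi> s \<in> polys_over A n" "\<And>s. s \<in> S \<Longrightarrow> s = P (\<psi> s)"
    "\<And>s. s \<in> S \<Longrightarrow> ?r (\<psi> s) \<in> range K" by metis
  define Y where "Y = (\<lambda>s. coeff (?T (\<psi> s)) \<nu>) ` S"
  define G where "G = {p \<in> polys_over A n. ?r p \<in> range K \<and> coeff (?T p) \<nu> \<in> KV.span Y}"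
  have Gcst: "cst c \<in> G" for c
    using \<nu> by (auto simp: G_def cl(1) KV.span_zero coeff_pCons split: nat.splits)
  have Gadd: "p + q \<in> G" if "p \<in> G" "q \<in> G" for p q
    using that by (auto simp: G_def cl(2) KV.span_add simp flip: K.hom_add)
  have Gmult: "p * q \<in> G" if "p \<in> G" "q \<in> G" for p q
  proof -
    have "?r p \<in> range K" "?r q \<in> range K" using that by (simp_all add: G_def)
    then obtain c e where c: "?r p = K c" "?r q = K e" by (elim imageE)
    \<comment> \<open>Without their constants both factors vanish on the curve, and their product
      contributes nothing in order \<nu>.\<close>
    define p' q' where "p' = p - cst c" and "q' = q - cst e"
    have pq: "p' \<in> polys_over A n" "q' \<in> polys_over A n" "?r p' = 0" "?r q' = 0"
      using that by (auto simp: p'_def q'_def G_def cl(1,4) c)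
    have "?T (p * q) = ?T p' * ?T q' + smult (K c) (?T q) + smult (K e) (?T p) - smult (K c) [:K e:]"
      unfolding p'_def q'_def by (simp add: algebra_simps)
    moreover have "coeff (?T p' * ?T q') \<nu> = 0"
      by (rule coeff_mult_vanishing[OF min[OF pq(1,3)] min[OF pq(2,4)] \<nu>])
    moreover have "coeff [:a:] \<nu> = 0" for a :: "'a ratfun" using \<nu> by (simp add: coeff_pCons split: nat.split)
    ultimately have "coeff (?T (p * q)) \<nu> = K c * coeff (?T q) \<nu> + K e * coeff (?T p) \<nu>" by simp
    also have "\<dots> \<in> KV.span Y" using that by (intro KV.span_add KV.span_scale) (auto simp: G_def)
    finally show ?thesis using that c by (auto simp: G_def cl(3) simp flip: K.hom_mult)
  qed
  have "B \<subseteq> P ` G"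
    unfolding S(2)
  proof (rule hull_minimal)
    have "s \<in> P ` G" if "s \<in> S" for s
      using \<psi>[OF that] that by (intro image_eqI[of _ _ "\<psi> s"]) (auto simp: G_def Y_def intro: KV.span_base)
    moreover have "K c \<in> P ` G" for c using Gcst[of c] by (metis P_cst image_eqI)
    ultimately show "const_field \<union> S \<subseteq> P ` G" by (auto simp: const_field_eq)
    have neg: "- p \<in> G" if "p \<in> G" for p
      using Gmult[OF Gcst[of "- 1"] that] by (simp add: rhom.hom_uminus[OF rhom_cst] rhom.hom_one[OF rhom_cst])
    have "0 \<in> G" "1 \<in> G" using Gcst[of 0] Gcst[of 1] by (simp_all add: rhom.hom_zero[OF rhom_cst] rhom.hom_one[OF rhom_cst])
    then have "P 0 \<in> P ` G" "P 1 \<in> P ` G" by blast+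
    then show "is_subring (P ` G)"
      unfolding is_subring_def using Gadd Gmult neg
      by (auto simp flip: P.hom_add P.hom_mult P.hom_uminus)
  qed
  have "\<forall>l. \<exists>h. l \<ge> 1 \<longrightarrow> h \<in> coeffs_in (rat_field n) \<and> degree h \<le> l \<and> coeff h l = 1 \<and>
      coeff (?T p0) \<nu> * poly h (X n) \<in> KV.span Y"
  proof (intro allI)
    fix l :: nat
    show "\<exists>h. l \<ge> 1 \<longrightarrow> h \<in> coeffs_in (rat_field n) \<and> degree h \<le> l \<and> coeff h l = 1 \<and>
      coeff (?T p0) \<nu> * poly h (X n) \<in> KV.span Y"
    proof (cases "l \<ge> 1")
      case True
      obtain g h where gh: "h \<in> coeffs_in A" "lead_coeff h = 1" "degree h = l" "of_mpoly g = poly h (X n)"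
        "P (p0 * g) \<in> poly_ring (Suc n)" using E[OF True] by blast
      have gA: "g \<in> polys_over A n" using gh(1,4) by (auto simp: polys_over_def)
      have "P (p0 * g) \<in> P ` G" using B(2)[OF cl(3)[OF p0(1) gA] gh(5)] \<open>B \<subseteq> P ` G\<close> by blast
      then have "p0 * g \<in> G" by (auto simp only: P_eq_iff image_iff)
      then have "coeff (?T (p0 * g)) \<nu> \<in> KV.span Y" by (simp add: G_def)
      moreover have "coeff (?T (p0 * g)) \<nu> = coeff (?T p0) \<nu> * ?r g"
        unfolding T.hom_mult coeff_blow_0[symmetric]
        by (rule coeff_mult_first) (rule min[OF p0(1,2)])
      moreover have "h \<in> coeffs_in (poly_ring n)" using gh(1) coeffs_in_mono[OF A(3)] by auto
      then obtain f where "f \<in> coeffs_in (rat_field n)" "degree f \<le> degree h" "coeff f (degree h) = 1"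
        "?r g = poly f (X n)" using gh(2,4) jn by (rule monic_restriction)
      ultimately show ?thesis using gh(3) by auto
    qed auto
  qed
  from choice[OF this] obtain h where h: "\<And>l. l \<ge> 1 \<Longrightarrow> h l \<in> coeffs_in (rat_field n)"
    "\<And>l. l \<ge> 1 \<Longrightarrow> degree (h l) \<le> l" "\<And>l. l \<ge> 1 \<Longrightarrow> coeff (h l) l = 1"
    "\<And>l. l \<ge> 1 \<Longrightarrow> coeff (?T p0) \<nu> * poly (h l) (X n) \<in> KV.span Y" by blast
  have "finite Y" using S(1) by (simp add: Y_def)
  from monic_not_in_finite_span[OF this p0(3) h] show False .
qed

text \<open>The image of \<open>p0\<close> is divisible by x_j, so a high power of \<open>p0\<close>
  clears the pole of the image of any element of A[z]; the same power in numerator and denominator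
  cancels. Coefficients in M are brought into A beforehand, by Q(A) = M.\<close>

lemma frac_field_image:
  assumes M: "is_subfield M" "frac_field A = M" and A: "is_subring A" "\<And>c. K c \<in> A" "A \<subseteq> poly_ring n"
    and p0: "p0 \<in> polys_over A n" "p0 \<noteq> 0" "r0 \<in> poly_ring (Suc n)" "P p0 = X j * r0"
    and B: "B \<subseteq> \<sigma> ` adjoin M (X n)" "\<And>p. p \<in> polys_over A n \<Longrightarrow> P p \<in> poly_ring (Suc n) \<Longrightarrow> P p \<in> B"
  shows "frac_field B = \<sigma> ` adjoin M (X n)"
proof
  interpret \<sigma>: rhom \<sigma> by (rule rhom_\<sigma>)
  interpret P: rhom P by (rule rhom_P)
  note cl = polys_over_closed[OF A(1,2)]
  have ad: "is_subfield (adjoin M (X n))" unfolding adjoin_def by (rule is_subfield_hull)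
  show "frac_field B \<subseteq> \<sigma> ` adjoin M (X n)"
  proof
    fix y assume "y \<in> frac_field B"
    then obtain c e where "y = c / e" "c \<in> B" "e \<in> B" by (auto simp: frac_field_def)
    moreover from this(2,3) obtain a b where "c = \<sigma> a" "e = \<sigma> b" "a \<in> adjoin M (X n)" "b \<in> adjoin M (X n)"
      using B(1) by blast
    ultimately have "y = \<sigma> a / \<sigma> b" "a \<in> adjoin M (X n)" "b \<in> adjoin M (X n)" by simp_all
    then show "y \<in> \<sigma> ` adjoin M (X n)"
      using is_subfieldD(3)[OF ad] by (auto simp flip: rhom_divide(1)[OF rhom_\<sigma>])
  qed
  have pole: "\<exists>k. \<forall>m\<ge>k. P (p0 ^ m * p) \<in> B" if pA: "p \<in> polys_over A n" for p
  proof -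
    obtain k where k: "X j ^ k * P p \<in> poly_ring (Suc n)"
      using P_pole[OF polys_over_vars[OF A(3) pA]] by blast
    have "P (p0 ^ m * p) \<in> B" if "m \<ge> k" for m
    proof (rule B(2))
      have "X j ^ m = X j ^ (m - k) * X j ^ k" using that by (simp flip: power_add)
      then have "P (p0 ^ m * p) = r0 ^ m * X j ^ (m - k) * (X j ^ k * P p)"
        by (simp add: p0 power_mult_distrib mult_ac)
      also have "\<dots> \<in> poly_ring (Suc n)"
        using jn by (intro poly_ring_closed(5)[OF poly_ring_closed(5)[OF poly_ring_closed(7)[OF p0(3)] poly_ring_closed(7)] k]) simp
      finally show "P (p0 ^ m * p) \<in> poly_ring (Suc n)" .
      show "p0 ^ m * p \<in> polys_over A n" by (intro cl p0 \<open>p \<in> polys_over A n\<close>)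
    qed
    then show ?thesis by blast
  qed
  have clear: "\<exists>q\<in>polys_over A n. \<exists>a\<in>A. a \<noteq> 0 \<and> of_mpoly q = a * poly f (X n)" if f: "f \<in> coeffs_in M" for f
  proof -
    have "coeff f ` {..degree f} \<subseteq> frac_field A" using coeffs_inD[OF f] M(2) by auto
    then obtain a where a: "a \<in> A" "a \<noteq> 0" "\<And>i. i \<le> degree f \<Longrightarrow> a * coeff f i \<in> A"
      using common_denominator_frac_field[OF A(1), of "coeff f ` {..degree f}"] by auto
    have "a * coeff f i \<in> A" for i
      using a(3)[of i] is_subringD(1)[OF A(1)] by (cases "i \<le> degree f") (auto simp: coeff_eq_0)
    then have af: "smult a f \<in> coeffs_in A" by (simp add: coeffs_in_def)
    then have "smult a f \<in> coeffs_in (poly_ring n)" using coeffs_in_mono[OF A(3)] by auto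
    then obtain p where "poly (smult a f) (X n) = of_mpoly (\<Sum>i\<le>degree (smult a f). p i * var n ^ i)"
      by (rule coeffs_in_poly_ringE) blast
    then obtain q where q: "of_mpoly q = poly (smult a f) (X n)" by metis
    then have "q \<in> polys_over A n" unfolding polys_over_def using af by blast
    with a q show ?thesis by auto
  qed
  show "\<sigma> ` adjoin M (X n) \<subseteq> frac_field B"
  proof
    fix y assume "y \<in> \<sigma> ` adjoin M (X n)"
    then obtain f g where fg: "y = \<sigma> (poly f (X n) / poly g (X n))" "f \<in> coeffs_in M" "g \<in> coeffs_in M" "poly g (X n) \<noteq> 0"
      by (auto simp: adjoin_eq[OF M(1)])
    obtain q a where q: "q \<in> polys_over A n" "a \<in> A" "a \<noteq> 0" "of_mpoly q = a * poly f (X n)" using clear[OF fg(2)] by blast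
    obtain q' a' where q': "q' \<in> polys_over A n" "a' \<in> A" "a' \<noteq> 0" "of_mpoly q' = a' * poly g (X n)" using clear[OF fg(3)] by blast
    obtain e e' where e: "a = of_mpoly e" "a' = of_mpoly e'" using q(2) q'(2) A(3) unfolding poly_ring_def by blast
    have inA: "w \<in> polys_over A n" if "of_mpoly w \<in> A" for w
      using that is_subring_coeffs_in(7)[OF A(1) that, of 0]
      by (auto simp: polys_over_def poly_monom intro!: bexI[of _ "monom (of_mpoly w) 0"])
    have ee: "e' * q \<in> polys_over A n" "e * q' \<in> polys_over A n"
      using inA q q' e by (auto intro: cl(3))
    obtain k where k: "\<And>m. m \<ge> k \<Longrightarrow> P (p0 ^ m * (e' * q)) \<in> B" using pole[OF ee(1)] by blast
    obtain k' where k': "\<And>m. m \<ge> k' \<Longrightarrow> P (p0 ^ m * (e * q')) \<in> B" using pole[OF ee(2)] by blast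
    define m where "m = max k k'"
    have P0: "P w \<noteq> 0" if "w \<noteq> 0" for w using P_inj that by blast
    have "of_mpoly (e * q') = a * (a' * poly g (X n))" using q' e by simp
    then have nz: "e * q' \<noteq> 0" using q(3) q'(3) fg(4) by auto
    have "of_mpoly (e' * q) = a' * (a * poly f (X n))" using q e by simp
    then have "of_mpoly (e' * q) / of_mpoly (e * q') = poly f (X n) / poly g (X n)"
      using \<open>of_mpoly (e * q') = _\<close> q(3) q'(3) by simp
    then have "y = P (e' * q) / P (e * q')"
      unfolding fg(1) by (simp only: rhom_divide(1)[OF rhom_\<sigma>, symmetric] \<sigma>_of_mpoly[symmetric])
    also have "\<dots> = P (p0 ^ m * (e' * q)) / P (p0 ^ m * (e * q'))"
      using P0[OF p0(2)] unfolding P.hom_mult[of "p0 ^ m"] P.hom_power by simp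
    finally have "y = P (p0 ^ m * (e' * q)) / P (p0 ^ m * (e * q'))" .
    moreover have "P (p0 ^ m * (e * q')) \<noteq> 0" using nz p0(2) by (intro P0) simp
    moreover have "P (p0 ^ m * (e' * q)) \<in> B" "P (p0 ^ m * (e * q')) \<in> B"
      by (rule k k'; simp add: m_def)+
    ultimately show "y \<in> frac_field B" unfolding frac_field_def by blast
  qed
qed

end

theorem theorem1p3:
  fixes n :: nat and M :: "'a::field_char_0 ratfun set"
  assumes "is_subfield M" and "const_field \<subseteq> M" and "M \<subseteq> rat_field n"
    and "trdeg const_field M \<ge> 2"
    and "M \<noteq> rat_field n"
    and "minimal_field n M"
  shows "\<exists>\<sigma> \<in> field_auts const_field (rat_field (Suc n)).
    let Mz = \<sigma> ` adjoin M (ratvar n); A = Mz \<inter> poly_ring (Suc n)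
    in \<not> fin_gen_algebra const_field A \<and> frac_field A = Mz"
proof -
  define A where "A = M \<inter> poly_ring n"
  have A: "is_subring A" "\<And>c. K c \<in> A" "A \<subseteq> poly_ring n"
    using is_subring_Int[OF is_subfieldD(1)[OF assms(1)] is_subring_poly_ring] assms(2)
    by (auto simp: A_def const_field_eq)
  have "trdeg const_field (M \<inter> poly_ring n) \<ge> 2" using assms(4,6) by (simp add: minimal_field_def)
  then obtain j \<Phi> u v q where j: "j < n" "ratvar j \<notin> M" "\<Phi> j = [:0, 1:]"
    and t: "\<And>p. of_mpoly p \<in> M \<inter> poly_ring n \<Longrightarrow> uev \<Phi> p \<noteq> [:0, 1:]"
    and uvq: "of_mpoly u \<in> M \<inter> poly_ring n" "of_mpoly v \<in> M \<inter> poly_ring n" "of_mpoly q \<in> M \<inter> poly_ring n"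
    and \<phi>: "lead_coeff (uev \<Phi> u) = 1" "degree (uev \<Phi> u) \<ge> 1"
    and v: "uev \<Phi> v = [:0, 1:] * uev \<Phi> u" and q: "q \<noteq> 0" "uev \<Phi> q = 0"
    by (rule curve_exists[OF assms(1-3,5)]) (rule that; (assumption | blast))
  define \<phi> where "\<phi> = uev \<Phi> u"
  define d where "d = degree \<phi>"
  have vars: "poly_vars p \<subseteq> {..<n}" if "of_mpoly p \<in> A" for p
    using that by (auto simp: A_def poly_ring_def)
  have inA: "p \<in> polys_over A n" if "of_mpoly p \<in> A" for p
    using is_subring_coeffs_in(7)[OF A(1) that, of 0]
    by (auto simp: polys_over_def poly_monom intro!: bexI[of _ "monom (of_mpoly p) 0"])
  have "rs j \<Phi> n q = 0" using rs_curve[OF vars] uvq(3) q(2) by (simp add: A_def)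
  then obtain p0 \<nu> where p0: "p0 \<in> polys_over A n" "rs j \<Phi> n p0 = 0" "coeff (blow j \<Phi> n p0) \<nu> \<noteq> 0"
    and min: "\<And>p k. p \<in> polys_over A n \<Longrightarrow> rs j \<Phi> n p = 0 \<Longrightarrow> k < \<nu> \<Longrightarrow> coeff (blow j \<Phi> n p) k = 0"
    using minimal_order_exists[OF inA q(1)] uvq(3) by (metis A_def)
  have vars': "poly_vars p \<subseteq> {..<Suc n}" if "p \<in> polys_over A n" for p
    using polys_over_vars[OF A(3) that] .
  have uA: "of_mpoly u \<in> A" and vA: "of_mpoly v \<in> A" using uvq by (simp_all add: A_def)
  \<comment> \<open>The constants \<open>cu\<close>, \<open>cv\<close> and \<open>c0\<close> are
    independent of \<open>N\<close>, which is fixed after them.\<close>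
  obtain cu where cu: "\<And>N e. cu + e \<le> N \<Longrightarrow> \<exists>r\<in>poly_ring (Suc n).
      curve.P n j N \<Phi> u - ev K (curve.th0 n j \<Phi>) u = ratvar j ^ e * r"
    using curve_approximation[of j n \<Phi>, OF j(1,3) vars'[OF inA[OF uA]]] by blast
  obtain cv where cv: "\<And>N e. cv + e \<le> N \<Longrightarrow> \<exists>r\<in>poly_ring (Suc n).
      curve.P n j N \<Phi> v - ev K (curve.th0 n j \<Phi>) v = ratvar j ^ e * r"
    using curve_approximation[of j n \<Phi>, OF j(1,3) vars'[OF inA[OF vA]]] by blast
  obtain c0 where c0: "\<And>N e. c0 + e \<le> N \<Longrightarrow> \<exists>r\<in>poly_ring (Suc n).
      curve.P n j N \<Phi> p0 - ev K (curve.th0 n j \<Phi>) p0 = ratvar j ^ e * r"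
    using curve_approximation[of j n \<Phi>, OF j(1,3) vars'[OF p0(1)]] by blast
  \<comment> \<open>Room for precision \<open>d * d + 1\<close> in the images of u and v, and for a
    factor x_j^(d(d+1)) in the image of \<open>p0\<close>.\<close>
  define N where "N = cu + cv + c0 + (d * d + 1) + d * (d + 1)"
  interpret curve n j N \<Phi> using j by unfold_locales
  have \<phi>': "lead_coeff \<phi> = 1" "degree \<phi> = d" "d \<ge> 1" using \<phi> by (simp_all add: \<phi>_def d_def)
  obtain r1 where r1: "r1 \<in> poly_ring (Suc n)" "P u - pv \<tau> \<phi> = X j ^ (d * d + 1) * r1"
    using cu[of "d * d + 1" N] th0_curve[OF vars[OF uA]] by (auto simp: N_def \<phi>_def)
  have "ev K th0 v = \<tau> * pv \<tau> \<phi>"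
    using th0_curve[OF vars[OF vA]] unfolding v \<phi>_def by (simp add: rhom.hom_mult[OF rhom_pv])
  then obtain r2 where r2: "r2 \<in> poly_ring (Suc n)" "P v - \<tau> * pv \<tau> \<phi> = X j ^ (d * d + 1) * r2"
    using cv[of "d * d + 1" N] by (auto simp: N_def)
  \<comment> \<open>\<open>p0\<close> vanishes on the curve, so its image consists of the error term
    alone and is divisible by a high power of x_j.\<close>
  have "ev K th0 p0 = 0" using \<sigma>_rs[of p0] p0(2) by (simp add: rhom.hom_zero[OF rhom_\<sigma>])
  then obtain r0 where r0: "r0 \<in> poly_ring (Suc n)" "P p0 = X j ^ (d * (d + 1)) * r0"
    using c0[of "d * (d + 1)" N] by (auto simp: N_def)
  define B where "B = \<sigma> ` adjoin M (X n) \<inter> poly_ring (Suc n)"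
  have B1: "\<exists>p\<in>polys_over A n. y = P p \<and> rs j \<Phi> n p \<in> range K" if "y \<in> B" for y
  proof -
    from that obtain F where F: "y = \<sigma> F" "F \<in> adjoin M (X n)" "\<sigma> F \<in> poly_ring (Suc n)" by (auto simp: B_def)
    obtain f where f: "f \<in> coeffs_in A" "F = poly f (X n)"
      using contraction[OF assms(1,3) j(2) F(2,3)] unfolding A_def .
    have "F \<in> poly_ring (Suc n)"
      unfolding f(2) using f(1) coeffs_in_mono[OF A(3)] coeffs_in_mono[OF poly_ring_mono[of n "Suc n"]]
      by (intro poly_in_subring[OF is_subring_poly_ring] ratvar_in_poly_ring) auto
    then obtain p where p: "F = of_mpoly p" by (auto simp: poly_ring_def)
    have "y = P p" by (simp add: F(1) p \<sigma>_of_mpoly)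
    moreover have "rs j \<Phi> n p \<in> range K"
      by (rule upper_bound[OF A _ f(1)]) (use t f p F \<open>y = P p\<close> in \<open>auto simp: A_def\<close>)
    moreover have "p \<in> polys_over A n" using f p by (auto simp: polys_over_def)
    ultimately show ?thesis by blast
  qed
  have B2: "P p \<in> B" if p: "p \<in> polys_over A n" "P p \<in> poly_ring (Suc n)" for p
  proof -
    obtain f where f: "f \<in> coeffs_in A" "of_mpoly p = poly f (X n)" using p(1) by (auto simp: polys_over_def)
    have "f \<in> coeffs_in (adjoin M (X n))"
      using f(1) by (auto simp: coeffs_in_def A_def adjoin_def hull_inc)
    then have "of_mpoly p \<in> adjoin M (X n)"
      unfolding f(2) adjoin_def by (intro poly_in_subring is_subfieldD(1)[OF is_subfield_hull]) (auto simp: hull_inc)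
    then show ?thesis using p(2) by (auto simp: B_def simp flip: \<sigma>_of_mpoly)
  qed
  have nfg: "\<not> fin_gen_algebra const_field B"
    by (rule not_fin_gen[OF A p0 min _ B1 B2])
      (use monic_multiple[OF A uA vA \<phi>' r1 r2 p0(1) r0] in blast)+
  \<comment> \<open>d \<ge> 1 leaves at least one factor x_j in the image of \<open>p0\<close>,
    enough for the fraction field.\<close>
  obtain e where e: "d * (d + 1) = Suc e" using \<phi>'(3) by (cases "d * (d + 1)") auto
  have "frac_field B = \<sigma> ` adjoin M (X n)"
  proof (rule frac_field_image[OF assms(1) _ A p0(1)])
    show "frac_field A = M" unfolding A_def by (rule minimal_frac_field[OF assms(1-3,6)])
    show "p0 \<noteq> 0" using p0(3) by (auto simp: rhom.hom_zero[OF rhom_blow])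
    show "P p0 = X j * (X j ^ e * r0)" unfolding r0(2) e by simp
    show "X j ^ e * r0 \<in> poly_ring (Suc n)"
      using jn by (intro poly_ring_closed(5)[OF poly_ring_closed(7) r0(1)]) simp
    show "B \<subseteq> \<sigma> ` adjoin M (X n)" by (auto simp: B_def)
  qed (rule B2)
  with nfg show ?thesis
    by (intro bexI[OF _ \<sigma>_field_aut]) (simp add: Let_def B_def)
qed

end
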